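(* Let $G$ be a finite group, let $k$ be a field of characteristic $p>0$ and let $c$ be a block idempotent of $kG$. Then for any choice of maximal $(kG,c)$-Brauer pair $(P,f)$, the extension axiom holds for the fusion system $\mathcal{F}_{(P,f)}(kGc)$.
   Context: Brauer pairs. A block idempotent of $kG$ is a primitive idempotent of $Z(kG)$. $G$ acts on $kG$ by conjugation, ${}^{x}a=xax^{-1}$, and $(kG)^P$ denotes the fixed points of a subgroup $P$. For a $p$-subgroup $P\le G$, the Brauer homomorphism $\mathrm{Br}_P\colon(kG)^P\to kC_G(P)$, $\sum_{g\in G}\alpha_g g\mapsto\sum_{g\in C_G(P)}\alpha_g g$, is a surjective $k$-algebra homomorphism. A $kG$-Brauer pair is a pair $(P,e)$ with $P$ a $p$-subgroup of $G$ and $e$ a block idempotent of $kC_G(P)$; for a block idempotent $c$ of $kG$ it is a $(kG,c)$-Brauer pair if $\mathrm{Br}_P(c)e=e$. An idempotent $i\in(kG)^P$ is associated to $(P,e)$ if $e\,\mathrm{Br}_P(i)=\mathrm{Br}_P(i)\ne0$. One writes $(Q,f)\le(P,e)$ if $Q\le P$ and every primitive idempotent $i$ of $(kG)^P$ associated to $(P,e)$ is also associated to $(Q,f)$; this is a partial order, respected by the conjugation action ${}^{x}(P,e)=({}^{x}P,{}^{x}e)$ of $G$. A maximal $(kG,c)$-Brauer pair is one that is maximal for $\le$ among $(kG,c)$-Brauer pairs. For every Brauer pair $(P,e)$ and $Q\le P$ there is a unique block idempotent $e_Q$ of $kC_G(Q)$ with $(Q,e_Q)\le(P,e)$. Fusion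 systems. For a finite $p$-group $P$, a fusion system $\mathcal{F}$ over $P$ is a subcategory of the category of finite groups whose objects are the subgroups of $P$, such that for all $Q,R\le P$: (i) $\mathrm{Hom}_{\mathcal{F}}(Q,R)$ contains all homomorphisms $Q\to R$ induced by conjugation with elements of $P$, and all its elements are injective; (ii) for $\varphi\in\mathrm{Hom}_{\mathcal{F}}(Q,R)$, the isomorphism $Q\to\varphi(Q)$, $u\mapsto\varphi(u)$, and its inverse are morphisms in $\mathcal{F}$. A subgroup $Q\le P$ is fully $\mathcal{F}$-normalized if $|N_P(Q)|\ge|N_P(Q')|$ for every $Q'\le P$ that is $\mathcal{F}$-isomorphic to $Q$. For an isomorphism $\varphi\colon Q\to R$ in $\mathcal{F}$, $N_\varphi$ is the set of $y\in N_P(Q)$ for which there is $z\in N_P(R)$ with $\varphi\circ c_y=c_z\circ\varphi\colon Q\to R$, where $c_y$ is conjugation $u\mapsto yuy^{-1}$; for $\varphi\in\mathrm{Hom}_{\mathcal{F}}(Q,P)$, $N_\varphi$ is defined via the isomorphism $Q\to\varphi(Q)$. The extension axiom holds for $\mathcal{F}$ if for every $Q\le P$ and every $\varphi\in\mathrm{Hom}_{\mathcal{F}}(Q,P)$ such that $\varphi(Q)$ is fully $\mathcal{F}$-normalized there exists $\psi\in\mathrm{Hom}_{\mathcal{F}}(N_\varphi,P)$ with $\psi|_Q=\varphi$. For a block idempotent $c$ of $kG$ and a maximal $(kG,c)$-Brauer pair $(P,e)$, $\mathcal{F}_{(P,e)}(kGc)$ is the fusion system over $P$ in which $\mathrm{Hom}(Q,R)$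 is the set of homomorphisms $\varphi\colon Q\to R$ for which there is $x\in G$ with $\varphi(u)=xux^{-1}$ for all $u\in Q$ and ${}^{x}(Q,e_Q)\le(R,e_R)$. *)

theory Defs
  imports "HOL-Algebra.Ring" "HOL-Algebra.Group_Action"
begin

text \<open>
  The group algebra of a finite group over a field (given as a type of class \<open>field\<close>): its
  elements are the coefficient functions that vanish outside the carrier. Restricting the carrier
  of the group to a subgroup \<open>H\<close> gives the group algebra of \<open>H\<close>, whose elements are literally
  elements of the group algebra of \<open>G\<close> as well. No finite support condition is imposed, so this is
  only meant for finite groups.
\<close>

definition group_algebra :: "('g, 'm) monoid_scheme \<Rightarrow> ('g \<Rightarrow> 'k::field) ring" where
  "group_algebra G =
     \<lparr>carrier = {a. \<forall>g. g \<notin> carrier G \<longrightarrow> a g = 0},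
      mult = (\<lambda>a b g. \<Sum>(x, y) \<in> {(x, y) \<in> carrier G \<times> carrier G. x \<otimes>\<^bsub>G\<^esub> y = g}. a x * b y),
      one = (\<lambda>g. if g = \<one>\<^bsub>G\<^esub> then 1 else 0),
      zero = (\<lambda>g. 0),
      add = (\<lambda>a b g. a g + b g)\<rparr>"

definition ga_basis :: "'g \<Rightarrow> 'g \<Rightarrow> 'k::field" where
  "ga_basis x = (\<lambda>g. if g = x then 1 else 0)"

definition ga_conj :: "('g, 'm) monoid_scheme \<Rightarrow> 'g \<Rightarrow> ('g \<Rightarrow> 'k::field) \<Rightarrow> 'g \<Rightarrow> 'k" where
  "ga_conj G x a =
     (ga_basis x \<otimes>\<^bsub>group_algebra G\<^esub> a) \<otimes>\<^bsub>group_algebra G\<^esub> ga_basis (inv\<^bsub>G\<^esub> x)"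

definition ga_fixed :: "('g, 'm) monoid_scheme \<Rightarrow> 'g set \<Rightarrow> ('g \<Rightarrow> 'k::field) ring" where
  "ga_fixed G P =
     (group_algebra G)\<lparr>carrier :=
        {a \<in> carrier (group_algebra G). \<forall>x \<in> P. ga_conj G x a = a}\<rparr>"

definition ring_center :: "('a, 'm) ring_scheme \<Rightarrow> ('a, 'm) ring_scheme" where
  "ring_center R =
     R\<lparr>carrier := {z \<in> carrier R. \<forall>a \<in> carrier R. z \<otimes>\<^bsub>R\<^esub> a = a \<otimes>\<^bsub>R\<^esub> z}\<rparr>"

definition idempotent_of :: "('a, 'm) ring_scheme \<Rightarrow> 'a \<Rightarrow> bool" where
  "idempotent_of R i \<longleftrightarrow> i \<in> carrier R \<and> i \<otimes>\<^bsub>R\<^esub> i = i"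

definition primitive_idempotent :: "('a, 'm) ring_scheme \<Rightarrow> 'a \<Rightarrow> bool" where
  "primitive_idempotent R i \<longleftrightarrow>
     idempotent_of R i \<and> i \<noteq> \<zero>\<^bsub>R\<^esub> \<and>
     \<not> (\<exists>j l. idempotent_of R j \<and> idempotent_of R l \<and> j \<noteq> \<zero>\<^bsub>R\<^esub> \<and> l \<noteq> \<zero>\<^bsub>R\<^esub> \<and>
          j \<otimes>\<^bsub>R\<^esub> l = \<zero>\<^bsub>R\<^esub> \<and> l \<otimes>\<^bsub>R\<^esub> j = \<zero>\<^bsub>R\<^esub> \<and> i = j \<oplus>\<^bsub>R\<^esub> l)"

definition block_idempotent :: "('g, 'm) monoid_scheme \<Rightarrow> ('g \<Rightarrow> 'k::field) \<Rightarrow> bool" where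
  "block_idempotent G c \<longleftrightarrow> primitive_idempotent (ring_center (group_algebra G)) c"


definition p_subgroup :: "nat \<Rightarrow> ('g, 'm) monoid_scheme \<Rightarrow> 'g set \<Rightarrow> bool" where
  "p_subgroup p G P \<longleftrightarrow> subgroup P G \<and> (\<exists>n. card P = p ^ n)"

definition centralizer :: "('g, 'm) monoid_scheme \<Rightarrow> 'g set \<Rightarrow> 'g set" where
  "centralizer G P = {g \<in> carrier G. \<forall>u \<in> P. g \<otimes>\<^bsub>G\<^esub> u = u \<otimes>\<^bsub>G\<^esub> g}"

definition conj_by :: "('g, 'm) monoid_scheme \<Rightarrow> 'g \<Rightarrow> 'g \<Rightarrow> 'g" where
  "conj_by G x u = x \<otimes>\<^bsub>G\<^esub> u \<otimes>\<^bsub>G\<^esub> inv\<^bsub>G\<^esub> x"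

definition brauer_map :: "('g, 'm) monoid_scheme \<Rightarrow> 'g set \<Rightarrow> ('g \<Rightarrow> 'k::field) \<Rightarrow> 'g \<Rightarrow> 'k" where
  "brauer_map G P a = (\<lambda>g. if g \<in> centralizer G P then a g else 0)"

abbreviation centralizer_algebra ::
    "('g, 'm) monoid_scheme \<Rightarrow> 'g set \<Rightarrow> ('g \<Rightarrow> 'k::field) ring" where
  "centralizer_algebra G P \<equiv> group_algebra (G\<lparr>carrier := centralizer G P\<rparr>)"

definition brauer_pair ::
    "nat \<Rightarrow> ('g, 'm) monoid_scheme \<Rightarrow> 'g set \<times> ('g \<Rightarrow> 'k::field) \<Rightarrow> bool" where
  "brauer_pair p G = (\<lambda>(P, e).
     p_subgroup p G P \<and> block_idempotent (G\<lparr>carrier := centralizer G P\<rparr>) e)"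

definition block_brauer_pair ::
    "nat \<Rightarrow> ('g, 'm) monoid_scheme \<Rightarrow> ('g \<Rightarrow> 'k::field) \<Rightarrow> 'g set \<times> ('g \<Rightarrow> 'k) \<Rightarrow> bool" where
  "block_brauer_pair p G c = (\<lambda>(P, e).
     brauer_pair p G (P, e) \<and> brauer_map G P c \<otimes>\<^bsub>centralizer_algebra G P\<^esub> e = e)"

definition associated ::
    "('g, 'm) monoid_scheme \<Rightarrow> ('g \<Rightarrow> 'k::field) \<Rightarrow> 'g set \<times> ('g \<Rightarrow> 'k) \<Rightarrow> bool" where
  "associated G i = (\<lambda>(P, e).
     idempotent_of (ga_fixed G P) i \<and>
     e \<otimes>\<^bsub>centralizer_algebra G P\<^esub> brauer_map G P i = brauer_map G P i \<and>
     brauer_map G P i \<noteq> \<zero>\<^bsub>centralizer_algebra G P\<^esub>)"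

definition brauer_le ::
    "nat \<Rightarrow> ('g, 'm) monoid_scheme \<Rightarrow> 'g set \<times> ('g \<Rightarrow> 'k::field) \<Rightarrow>
     'g set \<times> ('g \<Rightarrow> 'k) \<Rightarrow> bool" where
  "brauer_le p G = (\<lambda>(Q, f) (P, e).
     brauer_pair p G (Q, f) \<and> brauer_pair p G (P, e) \<and> Q \<subseteq> P \<and>
     (\<forall>i. primitive_idempotent (ga_fixed G P) i \<and> associated G i (P, e) \<longrightarrow>
          associated G i (Q, f)))"

definition conj_pair ::
    "('g, 'm) monoid_scheme \<Rightarrow> 'g \<Rightarrow> 'g set \<times> ('g \<Rightarrow> 'k::field) \<Rightarrow> 'g set \<times> ('g \<Rightarrow> 'k)" where
  "conj_pair G x = (\<lambda>(P, e). (conj_by G x ` P, ga_conj G x e))"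

definition maximal_brauer_pair ::
    "nat \<Rightarrow> ('g, 'm) monoid_scheme \<Rightarrow> ('g \<Rightarrow> 'k::field) \<Rightarrow> 'g set \<times> ('g \<Rightarrow> 'k) \<Rightarrow> bool" where
  "maximal_brauer_pair p G c X \<longleftrightarrow>
     block_brauer_pair p G c X \<and>
     (\<forall>Y. block_brauer_pair p G c Y \<and> brauer_le p G X Y \<longrightarrow> Y = X)"

text \<open>The block idempotent \<open>e\<^sub>Q\<close> determined by a Brauer pair \<open>X = (P, e)\<close> and a subgroup \<open>Q\<close> of \<open>P\<close>.\<close>

definition brauer_block ::
    "nat \<Rightarrow> ('g, 'm) monoid_scheme \<Rightarrow> 'g set \<times> ('g \<Rightarrow> 'k::field) \<Rightarrow> 'g set \<Rightarrow> 'g \<Rightarrow> 'k" where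
  "brauer_block p G X Q = (THE f. brauer_le p G (Q, f) X)"


text \<open>
  A category of subgroups of a finite group \<open>S\<close> is given by its morphism sets \<open>F Q R\<close>, for subgroups
  \<open>Q\<close> and \<open>R\<close> of \<open>S\<close>. Morphisms out of \<open>Q\<close> are extensional functions on \<open>Q\<close>, so that equality of
  morphisms is equality of functions; they compose by \<open>compose\<close>.
\<close>

type_synonym 'g hom_family = "'g set \<Rightarrow> 'g set \<Rightarrow> ('g \<Rightarrow> 'g) set"

definition fusion_isomorphic :: "'g hom_family \<Rightarrow> 'g set \<Rightarrow> 'g set \<Rightarrow> bool" where
  "fusion_isomorphic F Q R \<longleftrightarrow>
     (\<exists>\<phi> \<in> F Q R. \<exists>\<psi> \<in> F R Q.
        compose Q \<psi> \<phi> = (\<lambda>u \<in> Q. u) \<and> compose R \<phi> \<psi> = (\<lambda>u \<in> R. u))"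

definition fully_normalized ::
    "('g, 'm) monoid_scheme \<Rightarrow> 'g hom_family \<Rightarrow> 'g set \<Rightarrow> bool" where
  "fully_normalized S F Q \<longleftrightarrow>
     subgroup Q S \<and>
     (\<forall>Q'. subgroup Q' S \<and> fusion_isomorphic F Q Q' \<longrightarrow>
        card (normalizer S Q') \<le> card (normalizer S Q))"

text \<open>The group \<open>N\<^sub>\<phi>\<close> for \<open>\<phi>\<close> defined on \<open>Q\<close>, taken via the isomorphism from \<open>Q\<close> onto its image.\<close>

definition extension_group :: "('g, 'm) monoid_scheme \<Rightarrow> 'g set \<Rightarrow> ('g \<Rightarrow> 'g) \<Rightarrow> 'g set" where
  "extension_group S Q \<phi> =
     {y \<in> normalizer S Q. \<exists>z \<in> normalizer S (\<phi> ` Q).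
        \<forall>u \<in> Q. \<phi> (conj_by S y u) = conj_by S z (\<phi> u)}"

definition extension_axiom :: "('g, 'm) monoid_scheme \<Rightarrow> 'g hom_family \<Rightarrow> bool" where
  "extension_axiom S F \<longleftrightarrow>
     (\<forall>Q \<phi>. subgroup Q S \<and> \<phi> \<in> F Q (carrier S) \<and> fully_normalized S F (\<phi> ` Q) \<longrightarrow>
        (\<exists>\<psi> \<in> F (extension_group S Q \<phi>) (carrier S). restrict \<psi> Q = \<phi>))"

definition block_fusion_system ::
    "nat \<Rightarrow> ('g, 'm) monoid_scheme \<Rightarrow> 'g set \<times> ('g \<Rightarrow> 'k::field) \<Rightarrow> 'g hom_family" where
  "block_fusion_system p G X Q R =
     {\<phi> \<in> hom (G\<lparr>carrier := Q\<rparr>) (G\<lparr>carrier := R\<rparr>) \<inter> extensional Q.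
        \<exists>x \<in> carrier G. (\<forall>u \<in> Q. \<phi> u = conj_by G x u) \<and>
          brauer_le p G (conj_pair G x (Q, brauer_block p G X Q)) (R, brauer_block p G X R)}"

end

theory Submission
  imports Defs "HOL-Algebra.Sylow" "HOL-Library.Function_Algebras" "HOL.Vector_Spaces"
begin

text \<open>
  Let \<open>\<phi>\<close> be conjugation by \<open>x\<close> on \<open>Q\<close>, with fully normalized image \<open>R\<close>, let \<open>S\<close> be the normalizer of \<open>R\<close>
  in \<open>P\<close>, and write \<open>e\<^sub>T\<close> for the block attached to a subgroup \<open>T\<close> of \<open>P\<close>. In the group \<open>H = S C(R)\<close>, where
  \<open>C(R)\<close> is the centralizer in \<open>G\<close>, the block \<open>e\<^sub>R\<close> is stable. The extension
  group \<open>E\<close> of \<open>\<phi>\<close> consists of the \<open>y \<in> P\<close> with \<open>xyx\<^sup>-\<^sup>1 \<in> H\<close>, so conjugation by \<open>x\<close> takes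
  \<open>(E, e\<^sub>E)\<close> to a Brauer pair of \<open>H\<close> above \<open>(R, e\<^sub>R)\<close>. Another such pair is \<open>(S, e\<^sub>S)\<close>, and it is
  maximal: a larger one has a \<open>G\<close>-conjugate below \<open>(P, f)\<close>, which would make the normalizer in \<open>P\<close> of the
  corresponding conjugate of \<open>R\<close> larger than \<open>S\<close>. All maximal pairs of \<open>H\<close> above \<open>(R, e\<^sub>R)\<close> are
  \<open>H\<close>-conjugate, so some \<open>h \<in> H\<close> moves the first pair below \<open>(S, e\<^sub>S)\<close>. Modulo \<open>S\<close>, which fixes
  \<open>(S, e\<^sub>S)\<close>, the element \<open>h\<close> may be chosen in \<open>C(R)\<close>; then conjugation by \<open>hx\<close> extends \<open>\<phi>\<close> to \<open>E\<close>.

  This argument rests on the existence and uniqueness of the blocks \<open>e\<^sub>T\<close> (\<open>exists_brauer_le\<close>,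
  \<open>brauer_le_unique\<close>), on transitivity of the order (\<open>brauer_le_trans\<close>), and on conjugacy of maximal pairs
  (\<open>maximal_pair_contains_conjugate\<close>), which is used both for \<open>G\<close> with \<open>R = 1\<close> and for \<open>H\<close>. All of them
  hold over every field of characteristic \<open>p\<close>, because they use only Fitting's lemma (\<open>power_idempotent\<close>) and
  one lifting result for Brauer homomorphisms (\<open>lift_stable\<close>). The latter takes the place of relative traces:
  instead of the image of a trace map it uses the ideal of all fixed elements that are annihilated by the
  Brauer homomorphisms of the \<open>p\<close>-subgroups not conjugate into a given one. Such elements can be written down
  coefficient by coefficient, with Sylow's theorem for centralizers of group elements guaranteeing that the
  definition makes sense.
\<close>

section \<open>Conjugation, p-group actions and Sylow subgroups\<close>

context group
begin

lemma conj_by_closed [simp, intro]: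
  "x \<in> carrier G \<Longrightarrow> u \<in> carrier G \<Longrightarrow> conj_by G x u \<in> carrier G"
  by (simp add: conj_by_def)

lemma conj_by_one [simp]: "u \<in> carrier G \<Longrightarrow> conj_by G \<one> u = u"
  by (simp add: conj_by_def)

lemma conj_by_conj_by:
  "x \<in> carrier G \<Longrightarrow> y \<in> carrier G \<Longrightarrow> u \<in> carrier G \<Longrightarrow>
    conj_by G x (conj_by G y u) = conj_by G (x \<otimes> y) u"
  by (simp add: conj_by_def inv_mult_group m_assoc)

lemma conj_by_mult:
  "x \<in> carrier G \<Longrightarrow> u \<in> carrier G \<Longrightarrow> v \<in> carrier G \<Longrightarrow>
    conj_by G x (u \<otimes> v) = conj_by G x u \<otimes> conj_by G x v"
proof -
  assume "x \<in> carrier G" "u \<in> carrier G" "v \<in> carrier G"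
  then have "inv x \<otimes> (x \<otimes> (v \<otimes> inv x)) = v \<otimes> inv x"
    using inv_solve_left' by force
  with \<open>x \<in> carrier G\<close> \<open>u \<in> carrier G\<close> \<open>v \<in> carrier G\<close> show ?thesis
    by (simp add: conj_by_def m_assoc)
qed

lemma conj_by_inv_conj_by [simp]:
  "x \<in> carrier G \<Longrightarrow> u \<in> carrier G \<Longrightarrow> conj_by G (inv x) (conj_by G x u) = u"
  "x \<in> carrier G \<Longrightarrow> u \<in> carrier G \<Longrightarrow> conj_by G x (conj_by G (inv x) u) = u"
  by (simp_all add: conj_by_conj_by)

lemma conj_by_fixed_iff:
  "x \<in> carrier G \<Longrightarrow> u \<in> carrier G \<Longrightarrow> conj_by G x u = u \<longleftrightarrow> x \<otimes> u = u \<otimes> x"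
  unfolding conj_by_def by (metis inv_closed inv_solve_right m_closed)

lemma conj_by_one_right [simp]: "x \<in> carrier G \<Longrightarrow> conj_by G x \<one> = \<one>"
  by (simp add: conj_by_def)

lemma conj_by_inv_right:
  "x \<in> carrier G \<Longrightarrow> u \<in> carrier G \<Longrightarrow> conj_by G x (inv u) = inv (conj_by G x u)"
  by (simp add: conj_by_def inv_mult_group m_assoc)

lemma inj_on_conj_by: "x \<in> carrier G \<Longrightarrow> A \<subseteq> carrier G \<Longrightarrow> inj_on (conj_by G x) A"
  by (rule inj_on_inverseI[where g = "conj_by G (inv x)"]) auto

lemma card_conj_by: "x \<in> carrier G \<Longrightarrow> A \<subseteq> carrier G \<Longrightarrow> card (conj_by G x ` A) = card A"
  by (simp add: card_image inj_on_conj_by)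

lemma conj_by_image_conj_by:
  "x \<in> carrier G \<Longrightarrow> y \<in> carrier G \<Longrightarrow> A \<subseteq> carrier G \<Longrightarrow>
    conj_by G x ` conj_by G y ` A = conj_by G (x \<otimes> y) ` A"
  by (force simp: image_image conj_by_conj_by subset_iff)

lemma conj_by_image_one: "A \<subseteq> carrier G \<Longrightarrow> conj_by G \<one> ` A = A"
  by (force simp: subset_iff)

lemma conj_by_image_subset: "x \<in> carrier G \<Longrightarrow> A \<subseteq> carrier G \<Longrightarrow> conj_by G x ` A \<subseteq> carrier G"
  by auto

lemma subgroup_conj_by:
  assumes "x \<in> carrier G" "subgroup H G"
  shows "subgroup (conj_by G x ` H) G"
proof -
  interpret H: subgroup H G by fact
  show ?thesis
  proof
    show "conj_by G x ` H \<subseteq> carrier G" using assms(1) by auto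
    show "u \<otimes> v \<in> conj_by G x ` H" if "u \<in> conj_by G x ` H" "v \<in> conj_by G x ` H" for u v
      using that assms(1) by (auto simp flip: conj_by_mult)
    show "\<one> \<in> conj_by G x ` H" using assms(1) by (metis H.one_closed conj_by_one_right imageI)
    show "inv u \<in> conj_by G x ` H" if "u \<in> conj_by G x ` H" for u
      using that assms(1) by (auto simp flip: conj_by_inv_right)
  qed
qed

lemma p_subgroup_conj_by: "x \<in> carrier G \<Longrightarrow> p_subgroup p G Q \<Longrightarrow> p_subgroup p G (conj_by G x ` Q)"
  by (auto simp: p_subgroup_def subgroup_conj_by card_conj_by subgroup.subset)

lemma p_subgroup_subset_carrier: "p_subgroup p G Q \<Longrightarrow> Q \<subseteq> carrier G"
  by (auto simp: p_subgroup_def subgroup.subset)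

lemma p_subgroup_imp_subgroup: "p_subgroup p G Q \<Longrightarrow> subgroup Q G"
  by (auto simp: p_subgroup_def)

lemma p_subgroup_subgroup:
  assumes "p_subgroup p G Q" "prime p" "subgroup R G" "R \<subseteq> Q"
  shows "p_subgroup p G R"
proof -
  obtain n where n: "card Q = p ^ n" using assms by (auto simp: p_subgroup_def)
  have "subgroup R (G\<lparr>carrier := Q\<rparr>)"
    using assms by (simp add: p_subgroup_def subgroup_incl)
  then have "card R dvd card Q"
    using group.lagrange[of "G\<lparr>carrier := Q\<rparr>" R] assms
    by (metis dvdI mult.commute order_def p_subgroup_def partial_object.select_convs(1)
        partial_object.surjective partial_object.update_convs(1) subgroup_imp_group)
  then show ?thesis
    using n assms divides_primepow_nat[of p "card R" n] by (auto simp: p_subgroup_def)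
qed

text \<open>
  Orbits that are not fixed points have size divisible by \<open>p\<close>, and \<open>F\<close> is constant on each of them.
  The sum may live in any commutative semiring: in \<open>nat\<close> with \<open>F = 1\<close> this counts cosets, in a field of
  characteristic \<open>p\<close> it says that only fixed points contribute.
\<close>
lemma p_group_action_sum:
  fixes F :: "'x \<Rightarrow> 'r::comm_semiring_1"
  assumes Q: "p_subgroup p G Q" and p: "prime p" and fin: "finite \<Omega>"
    and cl: "\<And>q w. q \<in> Q \<Longrightarrow> w \<in> \<Omega> \<Longrightarrow> act q w \<in> \<Omega>"
    and one: "\<And>w. w \<in> \<Omega> \<Longrightarrow> act \<one> w = w"
    and mul: "\<And>q r w. q \<in> Q \<Longrightarrow> r \<in> Q \<Longrightarrow> w \<in> \<Omega> \<Longrightarrow> act (q \<otimes> r) w = act q (act r w)"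
    and F: "\<And>q w. q \<in> Q \<Longrightarrow> w \<in> \<Omega> \<Longrightarrow> F (act q w) = F w"
  shows "\<exists>r. sum F \<Omega> = sum F {w \<in> \<Omega>. \<forall>q \<in> Q. act q w = w} + of_nat p * r"
proof -
  have sub: "subgroup Q G" using Q by (simp add: p_subgroup_def)
  interpret Q: subgroup Q G by fact
  let ?Q = "G\<lparr>carrier := Q\<rparr>" and ?\<phi> = "\<lambda>q. \<lambda>w \<in> \<Omega>. act q w"
  interpret GQ: group ?Q using sub by (rule subgroup_imp_group)
  have bij: "?\<phi> q \<in> Bij \<Omega>" if q: "q \<in> Q" for q
  proof -
    have iq: "inv q \<in> Q" using q by auto
    have "act (inv q) (act q w) = w" "act q (act (inv q) w) = w" if "w \<in> \<Omega>" for w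
      using mul[OF iq q that] mul[OF q iq that] one[OF that] q by auto
    then have "bij_betw (act q) \<Omega> \<Omega>"
      using cl q iq by (intro bij_betw_byWitness[where f' = "act (inv q)"]) auto
    then have "bij_betw (?\<phi> q) \<Omega> \<Omega>"
      by (subst bij_betw_cong[of \<Omega> "?\<phi> q" "act q"]) auto
    then show ?thesis by (simp add: Bij_def)
  qed
  have "group_hom ?Q (BijGroup \<Omega>) ?\<phi>"
    unfolding group_hom_def group_hom_axioms_def
  proof (intro conjI homI)
    show "Group.group ?Q" by (rule GQ.is_group)
    show "Group.group (BijGroup \<Omega>)" by (rule group_BijGroup)
    show "?\<phi> q \<in> carrier (BijGroup \<Omega>)" if "q \<in> carrier ?Q" for q
      using bij that by (simp add: BijGroup_def)
    show "?\<phi> (q \<otimes>\<^bsub>?Q\<^esub> r) = ?\<phi> q \<otimes>\<^bsub>BijGroup \<Omega>\<^esub> ?\<phi> r" if "q \<in> carrier ?Q" "r \<in> carrier ?Q" for q r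
      using that bij cl mul by (auto simp: BijGroup_def compose_def fun_eq_iff)
  qed
  then interpret A: group_action ?Q \<Omega> ?\<phi> by (rule group_action.intro)
  let ?O = "orbits ?Q \<Omega> ?\<phi>"
  have orb: "orbit ?Q ?\<phi> w = (\<lambda>q. act q w) ` Q" if "w \<in> \<Omega>" for w
    using that by (auto simp: orbit_def)
  define \<Phi> where "\<Phi> = {w \<in> \<Omega>. \<forall>q \<in> Q. act q w = w}"
  have sing: "C = {w}" if "w \<in> C" "C \<in> ?O" "card C = 1" for w C
    using that by (metis card_1_singletonE singletonD)
  have mem: "w \<in> \<Omega>" if "w \<in> C" "C \<in> ?O" for w C
    using that A.orbits_coverture by blast
  have orb': "C = (\<lambda>q. act q w) ` Q" if C: "C \<in> ?O" and w: "w \<in> C" for C w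
  proof -
    have w': "w \<in> \<Omega>" using mem that by blast
    then have "w \<in> orbit ?Q ?\<phi> w" "orbit ?Q ?\<phi> w \<in> ?O"
      using A.orbit_refl by (auto simp: orbits_def)
    then show ?thesis using A.disjoint_union[OF C, of "orbit ?Q ?\<phi> w"] w orb[OF w'] by auto
  qed
  have ex: "\<exists>r. sum F C = sum F (C \<inter> \<Phi>) + of_nat p * r" if C: "C \<in> ?O" for C
  proof -
    obtain w where w: "w \<in> \<Omega>" "C = orbit ?Q ?\<phi> w" using C by (auto simp: orbits_def)
    then have wC: "w \<in> C" using A.orbit_refl by auto
    have cst: "sum F C = of_nat (card C) * F w"
      using orb[OF w(1)] w F by (subst sum.cong[OF refl, of C F "\<lambda>_. F w"]) auto
    have "card C * card (stabilizer ?Q ?\<phi> w) = card Q"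
      using A.orbit_stabilizer_theorem[OF w(1)] w(2) by (simp add: order_def)
    then have "card C dvd card Q" by (rule dvdI[OF sym])
    then obtain i where i: "card C = p ^ i"
      using Q p divides_primepow_nat by (auto simp: p_subgroup_def)
    show ?thesis
    proof (cases i)
      case 0
      with i have "C = {w}" using sing C wC by auto
      moreover from this have "w \<in> \<Phi>" using orb'[OF C wC] w by (auto simp: \<Phi>_def)
      ultimately show ?thesis by (intro exI[of _ 0]) auto
    next
      case (Suc j)
      have "v \<notin> \<Phi>" if "v \<in> C" for v
      proof
        assume "v \<in> \<Phi>"
        then have "C \<subseteq> {v}" using orb'[OF C that] by (auto simp: \<Phi>_def)
        then have "card C \<le> 1" by (metis card.empty card.insert card_mono finite.emptyI finite_insert insert_absorb insert_not_empty empty_iff One_nat_def)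
        moreover have "p ^ Suc j > 1" using p prime_gt_1_nat one_less_power by blast
        ultimately show False using i Suc by simp
      qed
      then have "C \<inter> \<Phi> = {}" by auto
      then show ?thesis using cst i Suc by (intro exI[of _ "of_nat (p ^ j) * F w"]) (simp add: mult.assoc)
    qed
  qed
  then obtain r where r: "\<And>C. C \<in> ?O \<Longrightarrow> sum F C = sum F (C \<inter> \<Phi>) + of_nat p * r C" by metis
  have "sum F \<Omega> = (\<Sum>C\<in>?O. sum F C)" by (simp only: A.disjoint_sum[OF fin])
  also have "\<dots> = (\<Sum>C\<in>?O. sum F (C \<inter> \<Phi>)) + of_nat p * sum r ?O"
    by (simp add: r sum.distrib sum_distrib_left cong: sum.cong)
  also have "(\<Sum>C\<in>?O. sum F (C \<inter> \<Phi>)) = (\<Sum>C\<in>?O. \<Sum>w\<in>C. if w \<in> \<Phi> then F w else 0)"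
  proof (rule sum.cong[OF refl], rule sum.inter_restrict)
    fix C assume "C \<in> ?O"
    then have "C \<subseteq> \<Omega>" using mem by auto
    then show "finite C" using fin by (rule finite_subset)
  qed
  also have "\<dots> = (\<Sum>w\<in>\<Omega>. if w \<in> \<Phi> then F w else 0)" by (simp only: A.disjoint_sum[OF fin])
  also have "\<dots> = sum F (\<Omega> \<inter> \<Phi>)" using fin by (simp add: sum.inter_restrict)
  also have "\<Omega> \<inter> \<Phi> = \<Phi>" by (auto simp: \<Phi>_def)
  finally show ?thesis by (auto simp: \<Phi>_def)
qed

abbreviation normalizer_in :: "'a set \<Rightarrow> 'a set \<Rightarrow> 'a set" where
  "normalizer_in M T \<equiv> {m \<in> M. conj_by G m ` T = T}"

lemma subgroup_normalizer_in:
  assumes "subgroup M G" "T \<subseteq> carrier G"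
  shows "subgroup (normalizer_in M T) G"
proof -
  interpret M: subgroup M G by fact
  show ?thesis
  proof
    show "normalizer_in M T \<subseteq> carrier G" by auto
    show "\<one> \<in> normalizer_in M T" using assms by (simp add: conj_by_image_one)
    show "x \<otimes> y \<in> normalizer_in M T" if "x \<in> normalizer_in M T" "y \<in> normalizer_in M T" for x y
      using that assms conj_by_image_conj_by[of x y T] by auto
    show "inv x \<in> normalizer_in M T" if "x \<in> normalizer_in M T" for x
      using that assms conj_by_image_conj_by[of "inv x" x T] by (auto simp: conj_by_image_one)
  qed
qed

lemma subset_normalizer_in:
  assumes "subgroup T G" "T \<subseteq> M"
  shows "T \<subseteq> normalizer_in M T"
proof -
  interpret T: subgroup T G by fact
  have "conj_by G t u \<in> T" if "t \<in> T" "u \<in> T" for t u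
    using that by (auto simp: conj_by_def)
  moreover have "u \<in> conj_by G t ` T" if "t \<in> T" "u \<in> T" for t u
    using that calculation[of "inv t" u] by (intro image_eqI[of _ _ "conj_by G (inv t) u"]) auto
  ultimately show ?thesis using assms(2) by blast
qed

lemma normalizer_restrict:
  assumes "subgroup M G" "T \<subseteq> M"
  shows "normalizer (G\<lparr>carrier := M\<rparr>) T = normalizer_in M T"
proof -
  interpret M: subgroup M G by fact
  have "m <#\<^bsub>G\<lparr>carrier := M\<rparr>\<^esub> T #>\<^bsub>G\<lparr>carrier := M\<rparr>\<^esub> (inv\<^bsub>G\<lparr>carrier := M\<rparr>\<^esub> m) = conj_by G m ` T"
    if "m \<in> M" for m
    using that m_inv_consistent[OF assms(1) that]
    by (auto simp: l_coset_def r_coset_def conj_by_def)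
  then show ?thesis using assms(2)
    by (auto simp: normalizer_def stabilizer_def)
qed

lemma image_conj_by_eqI:
  assumes "x \<in> carrier G" "finite T" "T \<subseteq> carrier G" "conj_by G x ` T \<subseteq> T"
  shows "conj_by G x ` T = T"
  using assms by (simp add: card_subset_eq card_conj_by)

lemma index_mult_card:
  assumes "subgroup M G" "subgroup T G" "T \<subseteq> M"
  shows "card ((\<lambda>m. T #> m) ` M) * card T = card M"
proof -
  have "subgroup T (G\<lparr>carrier := M\<rparr>)" using assms by (simp add: subgroup_incl)
  then have "card (rcosets\<^bsub>G\<lparr>carrier := M\<rparr>\<^esub> T) * card T = card M"
    using group.lagrange[OF subgroup_imp_group[OF assms(1)]] by (simp add: order_def)
  moreover have "rcosets\<^bsub>G\<lparr>carrier := M\<rparr>\<^esub> T = (\<lambda>m. T #> m) ` M"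
    by (auto simp: RCOSETS_def r_coset_def)
  ultimately show ?thesis by simp
qed

text \<open>
  The subgroup \<open>Q\<close> acts on the right cosets of \<open>T\<close> in \<open>M\<close> by \<open>q \<cdot> Tm = Tmq\<^sup>-\<^sup>1\<close>, and the coset \<open>Tm\<close> is fixed
  iff \<open>mQm\<^sup>-\<^sup>1 \<subseteq> T\<close>.
\<close>
lemma coset_fixed_points:
  assumes M: "subgroup M G" "finite M" and T: "subgroup T G" "T \<subseteq> M"
    and Q: "p_subgroup p G Q" "Q \<subseteq> M" and p: "prime p"
  shows "\<exists>r. card ((\<lambda>m. T #> m) ` M) =
    card ((\<lambda>m. T #> m) ` {m \<in> M. conj_by G m ` Q \<subseteq> T}) + p * r"
proof -
  interpret M: subgroup M G by fact
  interpret T: subgroup T G by fact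
  interpret Q: subgroup Q G using Q by (simp add: p_subgroup_def)
  have TG: "T \<subseteq> carrier G" by (rule T.subset)
  let ?\<Omega> = "(\<lambda>m. T #> m) ` M"
  have "\<exists>r. sum (\<lambda>_. 1::nat) ?\<Omega> =
      sum (\<lambda>_. 1) {C \<in> ?\<Omega>. \<forall>q \<in> Q. C #> inv q = C} + of_nat p * r"
  proof (rule p_group_action_sum[OF Q(1) p])
    show "finite ?\<Omega>" using M by auto
    show "C #> inv q \<in> ?\<Omega>" if q: "q \<in> Q" and C: "C \<in> ?\<Omega>" for q C
    proof -
      obtain m where m: "m \<in> M" "C = T #> m" using C by auto
      have "m \<in> carrier G" "inv q \<in> carrier G" using m q by auto
      then have "C #> inv q = T #> (m \<otimes> inv q)" using m TG by (simp add: coset_mult_assoc)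
      moreover have "m \<otimes> inv q \<in> M" using m q Q(2) by auto
      ultimately show ?thesis by auto
    qed
    show "C #> inv \<one> = C" if "C \<in> ?\<Omega>" for C
      using that TG by (auto simp: coset_mult_assoc)
    show "C #> inv (q \<otimes> r) = C #> inv r #> inv q" if "q \<in> Q" "r \<in> Q" "C \<in> ?\<Omega>" for q r C
      using that TG by (auto simp: coset_mult_assoc inv_mult_group m_assoc)
  qed auto
  moreover have "{C \<in> ?\<Omega>. \<forall>q \<in> Q. C #> inv q = C} = (\<lambda>m. T #> m) ` {m \<in> M. conj_by G m ` Q \<subseteq> T}"
  proof -
    have "(\<forall>q \<in> Q. T #> m #> inv q = T #> m) \<longleftrightarrow> conj_by G m ` Q \<subseteq> T" if m: "m \<in> M" for m
    proof -
      have eq: "T #> m #> inv q = T #> m \<longleftrightarrow> conj_by G m (inv q) \<in> T" if "q \<in> Q" for q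
      proof -
        have mq: "m \<in> carrier G" "inv q \<in> carrier G" "m \<otimes> inv q \<in> carrier G" using m that by auto
        have e1: "T #> m #> inv q = T #> (m \<otimes> inv q)" using mq TG by (simp add: coset_mult_assoc)
        have e2: "T #> (m \<otimes> inv q) = T #> m \<longleftrightarrow> T #> (m \<otimes> inv q) #> inv m = T"
        proof
          assume "T #> (m \<otimes> inv q) = T #> m"
          then show "T #> (m \<otimes> inv q) #> inv m = T" using mq TG by (simp add: coset_mult_assoc)
        next
          assume "T #> (m \<otimes> inv q) #> inv m = T"
          then have "T #> (m \<otimes> inv q) #> inv m #> m = T #> m" by simp
          then show "T #> (m \<otimes> inv q) = T #> m" using mq TG by (simp add: coset_mult_assoc m_assoc)
        qed
        have e3: "T #> (m \<otimes> inv q) #> inv m = T #> conj_by G m (inv q)"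
          using mq TG by (simp add: coset_mult_assoc conj_by_def)
        have e4: "T #> conj_by G m (inv q) = T \<longleftrightarrow> conj_by G m (inv q) \<in> T"
          using mq T by (meson T.rcos_const coset_join1 conj_by_closed is_group TG T.subgroup_axioms)
        show ?thesis unfolding e1 e2 e3 by (rule e4)
      qed
      show ?thesis
      proof (intro iffI ballI)
        assume H: "\<forall>q\<in>Q. T #> m #> inv q = T #> m"
        show "conj_by G m ` Q \<subseteq> T"
        proof safe
          fix q assume "q \<in> Q"
          then have iq: "inv q \<in> Q" by auto
          with H have "T #> m #> inv (inv q) = T #> m" by blast
          with eq[OF iq] have "conj_by G m (inv (inv q)) \<in> T" by blast
          then show "conj_by G m q \<in> T" using \<open>q \<in> Q\<close> by simp
        qed
      next
        fix q assume "conj_by G m ` Q \<subseteq> T" "q \<in> Q"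
        then show "T #> m #> inv q = T #> m" using eq[of q] Q.m_inv_closed by blast
      qed
    qed
    then show ?thesis by blast
  qed
  ultimately show ?thesis by auto
qed

text \<open>
  Let \<open>T\<close> act on its own cosets in \<open>X\<close>. Their number is divisible by \<open>p\<close>, hence so is the number of
  fixed cosets; the coset \<open>T\<close> itself is fixed, so there is another one.
\<close>
lemma p_subgroup_normalizer_grows:
  assumes T: "p_subgroup p G T" and X: "p_subgroup p G X" "finite X" and less: "T \<subset> X" and p: "prime p"
  shows "\<exists>m \<in> X - T. conj_by G m ` T = T"
proof -
  have sT: "subgroup T G" and sX: "subgroup X G" using T X by (auto simp: p_subgroup_def)
  interpret T: subgroup T G by fact
  interpret X: subgroup X G by fact
  have finT: "finite T" using less X finite_subset by blast
  obtain n k where n: "card T = p ^ n" "card X = p ^ k" using T X by (auto simp: p_subgroup_def)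
  have idx: "card ((\<lambda>m. T #> m) ` X) * card T = card X"
    using sX sT less by (intro index_mult_card) auto
  have "card T < card X" using less X psubset_card_mono by blast
  then have "card ((\<lambda>m. T #> m) ` X) \<noteq> 1" using idx by auto
  moreover have "card ((\<lambda>m. T #> m) ` X) dvd p ^ k" using idx n by (metis dvd_triv_left)
  ultimately have dvd: "p dvd card ((\<lambda>m. T #> m) ` X)"
    using p by (metis divides_primepow_nat dvd_power not_gr_zero power_0)
  let ?A = "{m \<in> X. conj_by G m ` T \<subseteq> T}"
  obtain r where "card ((\<lambda>m. T #> m) ` X) = card ((\<lambda>m. T #> m) ` ?A) + p * r"
    using coset_fixed_points[OF sX X(2) sT _ T _ p] less by auto
  then have pA: "p dvd card ((\<lambda>m. T #> m) ` ?A)" using dvd by (simp add: dvd_add_left_iff)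
  show ?thesis
  proof (rule ccontr)
    assume "\<not> ?thesis"
    then have no: "\<forall>m \<in> X - T. conj_by G m ` T \<noteq> T" by blast
    have "m \<in> T" if "m \<in> X" "conj_by G m ` T \<subseteq> T" for m
      using image_conj_by_eqI[OF X.mem_carrier[OF that(1)] finT T.subset that(2)] no that(1) by blast
    then have "?A \<subseteq> T" by blast
    then have "T #> m = T" if "m \<in> ?A" for m
      using that T.rcos_const[OF is_group] by blast
    then have "(\<lambda>m. T #> m) ` ?A \<subseteq> {T}" by blast
    moreover have "\<one> \<in> ?A" by (auto simp: conj_by_image_one)
    ultimately have "(\<lambda>m. T #> m) ` ?A = {T}" by blast
    then show False using pA p by (simp add: prime_nat_iff)
  qed
qed

text \<open>
  Sylow's second theorem, with the maximality of \<open>T\<close> tested inside its normalizer only: \<open>T\<close> lies in some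
  Sylow subgroup \<open>Y\<close> of \<open>M\<close>, and if \<open>T \<noteq> Y\<close> then the normalizer of \<open>T\<close> in \<open>Y\<close> is larger than \<open>T\<close>.
\<close>
lemma p_subgroups_conj_into:
  assumes M: "subgroup M G" "finite M" and T: "p_subgroup p G T" "T \<subseteq> M" and p: "prime p"
    and max: "\<And>X. p_subgroup p G X \<Longrightarrow> T \<subset> X \<Longrightarrow> X \<subseteq> normalizer_in M T \<Longrightarrow> False"
    and Q: "p_subgroup p G Q" "Q \<subseteq> M"
  shows "\<exists>m \<in> M. conj_by G m ` Q \<subseteq> T"
proof -
  interpret M: subgroup M G by fact
  have TG: "T \<subseteq> carrier G" "Q \<subseteq> carrier G" using T Q p_subgroup_subset_carrier by auto
  have "card M \<noteq> 0" using M M.one_closed by (metis card_0_eq empty_iff)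
  then obtain a m where am: "card M = p ^ a * m" "\<not> p dvd m"
    using p by (metis multiplicity_decompose' mult.commute not_prime_unit prime_elem_multiplicity_mult_distrib)
  obtain H where H: "subgroup H (G\<lparr>carrier := M\<rparr>)" "card H = p ^ a"
    using sylow_thm[OF p subgroup_imp_group[OF M(1)], of a m] am M by (auto simp: order_def)
  have HM: "H \<subseteq> M" using subgroup.subset[OF H(1)] by simp
  have sH: "subgroup H G" using H(1) M(1) incl_subgroup by blast
  have pH: "p_subgroup p G H" using sH H by (auto simp: p_subgroup_def)
  have "card ((\<lambda>m. H #> m) ` M) * p ^ a = p ^ a * m"
    using index_mult_card[OF M(1) sH HM] H am by simp
  then have idx: "\<not> p dvd card ((\<lambda>m. H #> m) ` M)" using am p by (auto simp: mult.commute prime_gt_0_nat)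
  have into: "\<exists>m \<in> M. conj_by G m ` Y \<subseteq> H" if Y: "p_subgroup p G Y" "Y \<subseteq> M" for Y
  proof (rule ccontr)
    assume "\<not> ?thesis"
    then have "{m \<in> M. conj_by G m ` Y \<subseteq> H} = {}" by auto
    then show False using coset_fixed_points[OF M sH HM Y p] idx
      by (metis (no_types, lifting) add_0 card.empty dvd_triv_left image_empty)
  qed
  obtain m1 where m1: "m1 \<in> M" "conj_by G m1 ` T \<subseteq> H" using into T by blast
  obtain m2 where m2: "m2 \<in> M" "conj_by G m2 ` Q \<subseteq> H" using into Q by blast
  have m: "m1 \<in> carrier G" "m2 \<in> carrier G" "inv m1 \<in> M" using m1 m2 by auto
  define Y where "Y = conj_by G (inv m1) ` H"
  have TY: "T \<subseteq> Y"
  proof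
    fix t assume "t \<in> T"
    then show "t \<in> Y" unfolding Y_def using m1 TG m by (intro image_eqI[of _ _ "conj_by G m1 t"]) auto
  qed
  have pY: "p_subgroup p G Y" unfolding Y_def using pH m by (simp add: p_subgroup_conj_by)
  have "conj_by G (inv m1) x \<in> M" if "x \<in> H" for x
    unfolding conj_by_def using m1(1) m(3) HM that by (intro M.m_closed M.m_inv_closed) auto
  then have YM: "Y \<subseteq> M" by (auto simp: Y_def)
  have "T = Y"
  proof (rule ccontr)
    assume "T \<noteq> Y"
    then have less: "T \<subset> Y" using TY by auto
    obtain m where m: "m \<in> Y - T" "conj_by G m ` T = T"
      using p_subgroup_normalizer_grows[OF T(1) pY _ less p] YM M finite_subset by blast
    let ?X = "normalizer_in Y T"
    have "p_subgroup p G ?X"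
      by (rule p_subgroup_subgroup[OF pY p subgroup_normalizer_in[OF p_subgroup_imp_subgroup[OF pY] TG(1)]]) auto
    moreover have "T \<subset> ?X" using subset_normalizer_in[OF p_subgroup_imp_subgroup[OF T(1)] TY] m by auto
    moreover have "?X \<subseteq> normalizer_in M T" using YM by auto
    ultimately show False by (rule max)
  qed
  have "conj_by G (inv m1 \<otimes> m2) ` Q = conj_by G (inv m1) ` conj_by G m2 ` Q"
    using m TG by (simp add: conj_by_image_conj_by)
  also have "\<dots> \<subseteq> T" using m2 \<open>T = Y\<close> by (auto simp: Y_def)
  finally show ?thesis using m m2 by auto
qed

end

section \<open>The group algebra\<close>

text \<open>
  The parameter \<open>K\<close> only carries the type of the coefficient field. The product of the group algebra is defined
  for arbitrary functions on the type \<open>'g\<close> and depends on their values on the carrier alone, so it is associative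
  and bilinear on all functions; membership in the algebra (\<open>supported\<close> below) matters for the unit.
\<close>
locale modular_group_algebra = group G
  for G :: "('g, 'm) monoid_scheme" (structure) +
  fixes K :: "'k::field itself" and p :: nat
  assumes finite_carrier [simp, intro]: "finite (carrier G)"
    and char: "CHAR('k) = p" and p_pos: "p > 0"
begin

lemma prime_p: "prime p"
  using char p_pos prime_CHAR_semidom by (metis)

lemma of_nat_p [simp]: "of_nat p = (0 :: 'k)"
  using char by (metis of_nat_CHAR)

abbreviation conv :: "('g \<Rightarrow> 'k) \<Rightarrow> ('g \<Rightarrow> 'k) \<Rightarrow> 'g \<Rightarrow> 'k" (infixl "\<star>" 70) where
  "a \<star> b \<equiv> a \<otimes>\<^bsub>group_algebra G\<^esub> b"

definition scale :: "'k \<Rightarrow> ('g \<Rightarrow> 'k) \<Rightarrow> 'g \<Rightarrow> 'k" where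
  "scale r a = (\<lambda>g. r * a g)"

text \<open>
  The group algebra of a subgroup \<open>C\<close>, as a subset of the group algebra of \<open>G\<close>.
\<close>
definition supported :: "'g set \<Rightarrow> ('g \<Rightarrow> 'k) set" where
  "supported C = {a. \<forall>g. g \<notin> C \<longrightarrow> a g = 0}"

lemma supportedI: "(\<And>g. g \<notin> C \<Longrightarrow> a g = 0) \<Longrightarrow> a \<in> supported C"
  and supportedD: "a \<in> supported C \<Longrightarrow> g \<notin> C \<Longrightarrow> a g = 0"
  by (auto simp: supported_def)

lemma supported_mono: "C \<subseteq> D \<Longrightarrow> a \<in> supported C \<Longrightarrow> a \<in> supported D"
  by (auto simp: supported_def)

lemma scale_apply [simp]: "scale r a g = r * a g"
  by (simp add: scale_def)

lemma conv_pairs: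
  "(a \<star> b) g = (\<Sum>(x, y) \<in> {(x, y) \<in> carrier G \<times> carrier G. x \<otimes> y = g}. a x * b y)"
  by (simp add: group_algebra_def)

lemma conv_apply:
  "(a \<star> b) g = (if g \<in> carrier G then \<Sum>x \<in> carrier G. a x * b (inv x \<otimes> g) else 0)"
proof (cases "g \<in> carrier G")
  case True
  have "(\<Sum>x \<in> carrier G. a x * b (inv x \<otimes> g)) =
      (\<Sum>(x, y) \<in> {(x, y) \<in> carrier G \<times> carrier G. x \<otimes> y = g}. a x * b y)"
    by (rule sum.reindex_bij_witness[where i = fst and j = "\<lambda>x. (x, inv x \<otimes> g)"])
       (use True in \<open>auto simp: m_assoc[symmetric]\<close>)
  with True show ?thesis by (simp add: conv_pairs)
next
  case False
  then have "{(x, y) \<in> carrier G \<times> carrier G. x \<otimes> y = g} = {}" by auto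
  with False show ?thesis by (simp only: conv_pairs) simp
qed

lemma conv_supported_carrier [simp, intro]: "a \<star> b \<in> supported (carrier G)"
  by (rule supportedI) (simp add: conv_apply)

lemma conv_assoc: "(a \<star> b) \<star> c = a \<star> (b \<star> c)"
proof
  fix g
  show "((a \<star> b) \<star> c) g = (a \<star> (b \<star> c)) g"
  proof (cases "g \<in> carrier G")
    case True
    have "((a \<star> b) \<star> c) g =
        (\<Sum>x \<in> carrier G. \<Sum>u \<in> carrier G. a u * b (inv u \<otimes> x) * c (inv x \<otimes> g))"
      using True by (subst conv_apply) (simp add: conv_apply[of a b] sum_distrib_right cong: sum.cong)
    also have "\<dots> = (\<Sum>u \<in> carrier G. \<Sum>x \<in> carrier G. a u * b (inv u \<otimes> x) * c (inv x \<otimes> g))"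
      by (rule sum.swap)
    also have "\<dots> = (\<Sum>u \<in> carrier G. \<Sum>x \<in> carrier G. a u * b x * c (inv (u \<otimes> x) \<otimes> g))"
    proof (rule sum.cong[OF refl])
      fix u assume u: "u \<in> carrier G"
      show "(\<Sum>x \<in> carrier G. a u * b (inv u \<otimes> x) * c (inv x \<otimes> g)) =
          (\<Sum>x \<in> carrier G. a u * b x * c (inv (u \<otimes> x) \<otimes> g))"
        by (rule sum.reindex_bij_witness[where i = "\<lambda>x. u \<otimes> x" and j = "\<lambda>x. inv u \<otimes> x"])
           (use u in \<open>auto simp: m_assoc[symmetric]\<close>)
    qed
    also have "\<dots> = (\<Sum>u \<in> carrier G. a u * (\<Sum>x \<in> carrier G. b x * c (inv x \<otimes> (inv u \<otimes> g))))"
      using True by (simp add: sum_distrib_left inv_mult_group m_assoc mult.assoc cong: sum.cong)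
    also have "\<dots> = (a \<star> (b \<star> c)) g"
      using True by (simp add: conv_apply cong: sum.cong)
    finally show ?thesis .
  qed (simp add: conv_apply)
qed

lemma conv_add_left: "(a + b) \<star> c = a \<star> c + b \<star> c"
  and conv_add_right: "c \<star> (a + b) = c \<star> a + c \<star> b"
  and conv_diff_left: "(a - b) \<star> c = a \<star> c - b \<star> c"
  and conv_diff_right: "c \<star> (a - b) = c \<star> a - c \<star> b"
  and conv_scale_left: "scale r a \<star> c = scale r (a \<star> c)"
  and conv_scale_right: "c \<star> scale r a = scale r (c \<star> a)"
  by (auto simp: fun_eq_iff conv_apply algebra_simps sum.distrib sum_subtractf sum_distrib_left)

lemma conv_zero_left [simp]: "0 \<star> a = 0"
  and conv_zero_right [simp]: "a \<star> 0 = 0"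
  by (auto simp: fun_eq_iff conv_apply)

lemma conv_sum_left: "sum f I \<star> c = (\<Sum>i \<in> I. f i \<star> c)"
  by (induction I rule: infinite_finite_induct)
    (simp_all only: sum.infinite sum.empty sum.insert conv_zero_left conv_add_left simp_thms)

lemma conv_sum_right: "c \<star> sum f I = (\<Sum>i \<in> I. c \<star> f i)"
  by (induction I rule: infinite_finite_induct)
    (simp_all only: sum.infinite sum.empty sum.insert conv_zero_right conv_add_right simp_thms)

lemma sum_fun_apply: "(sum f I) g = (\<Sum>i \<in> I. f i g)" for f :: "'i \<Rightarrow> 'g \<Rightarrow> 'k"
  by (induction I rule: infinite_finite_induct) auto

lemma ga_basis_conv:
  "x \<in> carrier G \<Longrightarrow> (ga_basis x \<star> a) g = (if g \<in> carrier G then a (inv x \<otimes> g) else 0)"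
  by (auto simp: conv_apply ga_basis_def if_distrib[of "\<lambda>t. t * _"] cong: if_cong)

lemma conv_ga_basis:
  assumes "y \<in> carrier G"
  shows "(a \<star> ga_basis y) g = (if g \<in> carrier G then a (g \<otimes> inv y) else 0)"
proof (cases "g \<in> carrier G")
  case True
  have "inv x \<otimes> g = y \<longleftrightarrow> x = g \<otimes> inv y" if "x \<in> carrier G" for x
    using assms True that by (metis inv_closed inv_inv inv_solve_left' inv_solve_right m_closed inv_mult_group m_assoc)
  then have "(a \<star> ga_basis y) g = (\<Sum>x \<in> carrier G. if x = g \<otimes> inv y then a x else 0)"
    using True by (simp add: conv_apply ga_basis_def if_distrib cong: sum.cong if_cong)
  then show ?thesis using True assms by simp
qed (simp add: conv_apply)

definition unit :: "'g \<Rightarrow> 'k" where "unit = ga_basis \<one>"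

lemma unit_conv [simp]: "a \<in> supported (carrier G) \<Longrightarrow> unit \<star> a = a"
  by (auto simp: fun_eq_iff unit_def ga_basis_conv supportedD)

lemma conv_unit [simp]: "a \<in> supported (carrier G) \<Longrightarrow> a \<star> unit = a"
  by (auto simp: fun_eq_iff unit_def conv_ga_basis supportedD)

lemma unit_in_supported [intro]: "\<one> \<in> C \<Longrightarrow> unit \<in> supported C"
  by (auto simp: supported_def unit_def ga_basis_def)

lemma supported_conv:
  assumes C: "subgroup C G" and a: "a \<in> supported C" and b: "b \<in> supported C"
  shows "a \<star> b \<in> supported C"
proof (rule supportedI)
  interpret C: subgroup C G by fact
  fix g assume g: "g \<notin> C"
  have "a x * b y = 0" if "x \<otimes> y = g" for x y
    using that g a b C.m_closed[of x y] by (auto dest: supportedD)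
  then show "(a \<star> b) g = 0" unfolding conv_pairs by (intro sum.neutral) auto
qed

text \<open>
  By this lemma all products can be computed in the group algebra of \<open>G\<close>.
\<close>
lemma subgroup_algebra_mult:
  assumes C: "subgroup C G" and a: "a \<in> supported C" and b: "b \<in> supported C"
  shows "a \<otimes>\<^bsub>group_algebra (G\<lparr>carrier := C\<rparr>)\<^esub> b = a \<star> b"
proof
  interpret C: subgroup C G by fact
  fix g
  have "(\<Sum>(x, y) \<in> {(x, y) \<in> C \<times> C. x \<otimes> y = g}. a x * b y) =
     (\<Sum>(x, y) \<in> {(x, y) \<in> carrier G \<times> carrier G. x \<otimes> y = g}. a x * b y)"
    using a b by (intro sum.mono_neutral_left) (auto dest: supportedD intro: finite_subset[of _ "carrier G \<times> carrier G"])
  then show "(a \<otimes>\<^bsub>group_algebra (G\<lparr>carrier := C\<rparr>)\<^esub> b) g = (a \<star> b) g"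
    by (simp add: group_algebra_def)
qed

section \<open>Conjugation and fixed points\<close>

lemma ga_conj_apply:
  fixes a :: "'g \<Rightarrow> 'k"
  assumes "x \<in> carrier G"
  shows "ga_conj G x a g = (if g \<in> carrier G then a (conj_by G (inv x) g) else 0)"
  using assms by (simp add: ga_conj_def ga_basis_conv conv_ga_basis conj_by_def m_assoc)

lemma ga_conj_add: "ga_conj G x (a + b) = ga_conj G x a + ga_conj G x (b :: 'g \<Rightarrow> 'k)"
  and ga_conj_scale: "ga_conj G x (scale r a) = scale r (ga_conj G x a)"
  and ga_conj_zero [simp]: "ga_conj G x (0 :: 'g \<Rightarrow> 'k) = 0"
  by (simp_all add: ga_conj_def conv_add_left conv_add_right conv_diff_left conv_diff_right
      conv_scale_left conv_scale_right)

lemma ga_conj_sum: "ga_conj G x (sum f I) = (\<Sum>i \<in> I. ga_conj G x (f i :: 'g \<Rightarrow> 'k))"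
  by (simp add: ga_conj_def conv_sum_left conv_sum_right)

lemma ga_conj_supported_carrier [simp, intro]: "ga_conj G x (a :: 'g \<Rightarrow> 'k) \<in> supported (carrier G)"
  by (simp add: ga_conj_def)

lemma ga_conj_one [simp]: "a \<in> supported (carrier G) \<Longrightarrow> ga_conj G \<one> a = a"
  by (auto simp: fun_eq_iff ga_conj_apply supportedD)

lemma ga_conj_ga_conj:
  fixes a :: "'g \<Rightarrow> 'k"
  assumes "x \<in> carrier G" "y \<in> carrier G"
  shows "ga_conj G x (ga_conj G y a) = ga_conj G (x \<otimes> y) a"
  using assms by (auto simp: fun_eq_iff ga_conj_apply conj_by_conj_by inv_mult_group)

lemma ga_conj_inv [simp]:
  assumes "x \<in> carrier G" "a \<in> supported (carrier G)"
  shows "ga_conj G (inv x) (ga_conj G x a) = a" "ga_conj G x (ga_conj G (inv x) a) = a"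
  using assms by (simp_all add: ga_conj_ga_conj)

lemma ga_conj_eq_0_iff:
  assumes "x \<in> carrier G" "a \<in> supported (carrier G)"
  shows "ga_conj G x a = 0 \<longleftrightarrow> a = 0"
  using assms ga_conj_inv(1) ga_conj_zero by metis

lemma ga_conj_conv:
  assumes "x \<in> carrier G"
  shows "ga_conj G x (a \<star> b) = ga_conj G x a \<star> ga_conj G x b"
proof
  fix g
  show "ga_conj G x (a \<star> b) g = (ga_conj G x a \<star> ga_conj G x b) g"
  proof (cases "g \<in> carrier G")
    case True
    have "(\<Sum>u \<in> carrier G. a u * b (inv u \<otimes> conj_by G (inv x) g)) =
      (\<Sum>u \<in> carrier G. a (conj_by G (inv x) u) * b (conj_by G (inv x) (inv u \<otimes> g)))"
      by (rule sum.reindex_bij_witness[where i = "conj_by G (inv x)" and j = "conj_by G x"])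
         (use assms True in \<open>auto simp: conj_by_mult conj_by_inv_right\<close>)
    with True assms show ?thesis by (simp add: conv_apply ga_conj_apply cong: sum.cong)
  qed (simp add: conv_apply ga_conj_apply assms)
qed

lemma ga_conj_supported:
  assumes "x \<in> carrier G" "a \<in> supported C" "C \<subseteq> carrier G"
  shows "ga_conj G x a \<in> supported (conj_by G x ` C)"
proof (rule supportedI)
  fix g assume g: "g \<notin> conj_by G x ` C"
  have "conj_by G (inv x) g \<notin> C" if "g \<in> carrier G"
    using g that assms image_eqI[of g "conj_by G x" "conj_by G (inv x) g" C] by auto
  then show "ga_conj G x a g = 0" using assms by (auto simp: ga_conj_apply dest: supportedD)
qed

abbreviation fixed :: "'g set \<Rightarrow> ('g \<Rightarrow> 'k) set" where
  "fixed M \<equiv> carrier (ga_fixed G M)"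

lemma fixed_def: "fixed M = {a \<in> supported (carrier G). \<forall>x \<in> M. ga_conj G x a = a}"
  by (simp add: ga_fixed_def group_algebra_def supported_def)

lemma fixed_supported [dest]: "a \<in> fixed M \<Longrightarrow> a \<in> supported (carrier G)"
  by (simp add: fixed_def)

lemma fixed_conj: "a \<in> fixed M \<Longrightarrow> x \<in> M \<Longrightarrow> ga_conj G x a = a"
  by (simp add: fixed_def)

lemma fixed_mono: "M \<subseteq> N \<Longrightarrow> a \<in> fixed N \<Longrightarrow> a \<in> fixed M"
  by (auto simp: fixed_def)

lemma fixed_apply:
  assumes "a \<in> fixed M" "x \<in> M" "x \<in> carrier G" "g \<in> carrier G"
  shows "a (conj_by G x g) = a g"
proof -
  have "ga_conj G x a (conj_by G x g) = a (conj_by G x g)" using assms by (simp add: fixed_conj)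
  then show ?thesis using assms by (simp add: ga_conj_apply)
qed

lemma fixedI:
  assumes "subgroup M G" "a \<in> supported (carrier G)"
    and "\<And>x g. x \<in> M \<Longrightarrow> g \<in> carrier G \<Longrightarrow> a (conj_by G x g) = a g"
  shows "a \<in> fixed M"
proof -
  interpret M: subgroup M G by fact
  show ?thesis using assms(2,3) by (auto simp: fixed_def fun_eq_iff ga_conj_apply supportedD)
qed

lemma fixed_conv: "M \<subseteq> carrier G \<Longrightarrow> a \<in> fixed M \<Longrightarrow> b \<in> fixed M \<Longrightarrow> a \<star> b \<in> fixed M"
  by (auto simp: fixed_def ga_conj_conv subset_iff)

lemma fixed_mult [simp]: "a \<otimes>\<^bsub>ga_fixed G M\<^esub> b = a \<star> b"
  by (simp add: ga_fixed_def)

section \<open>The Brauer homomorphism\<close>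

abbreviation cent :: "'g set \<Rightarrow> 'g set" where "cent \<equiv> centralizer G"

lemma centralizer_subset: "cent T \<subseteq> carrier G"
  by (auto simp: centralizer_def)

lemma mem_centralizer_iff:
  "T \<subseteq> carrier G \<Longrightarrow> g \<in> cent T \<longleftrightarrow> g \<in> carrier G \<and> (\<forall>u \<in> T. conj_by G u g = g)"
  by (auto simp: centralizer_def conj_by_fixed_iff subset_iff) 

lemma mem_centralizer_iff':
  "T \<subseteq> carrier G \<Longrightarrow> g \<in> cent T \<longleftrightarrow> g \<in> carrier G \<and> (\<forall>u \<in> T. conj_by G g u = u)"
  by (auto simp: centralizer_def conj_by_fixed_iff subset_iff) 

lemma centralizer_mono: "S \<subseteq> T \<Longrightarrow> cent T \<subseteq> cent S"
  by (auto simp: centralizer_def)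

lemma subgroup_centralizer: "T \<subseteq> carrier G \<Longrightarrow> subgroup (cent T) G"
  by unfold_locales
     (auto simp: mem_centralizer_iff conj_by_mult conj_by_inv_right conj_by_one_right subset_iff)

lemma centralizer_conj_by:
  assumes "x \<in> carrier G" "T \<subseteq> carrier G"
  shows "cent (conj_by G x ` T) = conj_by G x ` cent T"
proof -
  have "conj_by G x g \<in> cent (conj_by G x ` T)" if "g \<in> cent T" "x \<in> carrier G" "T \<subseteq> carrier G" for g x T
    using that by (auto simp: centralizer_def subset_iff simp flip: conj_by_mult)
  note * = this
  have "g \<in> conj_by G x ` cent T" if g: "g \<in> cent (conj_by G x ` T)" for g
  proof -
    have gG: "g \<in> carrier G" using g by (simp add: centralizer_def)
    have "conj_by G (inv x) g \<in> cent (conj_by G (inv x) ` conj_by G x ` T)"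
      using assms by (intro *[OF g]) auto
    then have "conj_by G (inv x) g \<in> cent T"
      using assms by (simp add: conj_by_image_conj_by conj_by_image_one)
    then show ?thesis using gG assms by (intro image_eqI[of _ _ "conj_by G (inv x) g"]) auto
  qed
  then show ?thesis using *[OF _ assms] by blast
qed

abbreviation Br :: "'g set \<Rightarrow> ('g \<Rightarrow> 'k) \<Rightarrow> 'g \<Rightarrow> 'k" where "Br \<equiv> brauer_map G"

lemma Br_apply: "Br P a g = (if g \<in> cent P then a g else 0)"
  by (simp add: brauer_map_def)

lemma Br_supported [simp, intro]: "Br P a \<in> supported (cent P)"
  by (auto simp: supported_def Br_apply)

lemma Br_supported_carrier [simp, intro]: "Br P a \<in> supported (carrier G)"
  using supported_mono[OF centralizer_subset Br_supported] .

lemma Br_add: "Br P (a + b) = Br P a + Br P b"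
  and Br_diff: "Br P (a - b) = Br P a - Br P b"
  and Br_scale: "Br P (scale r a) = scale r (Br P a)"
  and Br_zero [simp]: "Br P 0 = 0"
  by (auto simp: fun_eq_iff Br_apply)

lemma Br_id: "a \<in> supported (cent P) \<Longrightarrow> Br P a = a"
  by (auto simp: fun_eq_iff Br_apply supportedD)

lemma Br_Br: "Q \<subseteq> P \<Longrightarrow> Br P (Br Q a) = Br P a"
  using centralizer_mono by (auto simp: fun_eq_iff Br_apply)

lemma Br_unit [simp]: "P \<subseteq> carrier G \<Longrightarrow> Br P unit = unit"
  using subgroup_centralizer[THEN subgroup.one_closed] by (intro Br_id) auto

lemma supported_centralizer_fixed:
  assumes "subgroup P G" "a \<in> supported (cent P)"
  shows "a \<in> fixed P"
proof (rule fixedI)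
  interpret P: subgroup P G by fact
  show "a \<in> supported (carrier G)" using assms(2) centralizer_subset by (rule supported_mono[rotated])
  fix x g assume x: "x \<in> P" and g: "g \<in> carrier G"
  have inv: "h \<in> cent P \<Longrightarrow> conj_by G y h = h" if "y \<in> P" for h y
    using mem_centralizer_iff[OF P.subset] that by auto
  show "a (conj_by G x g) = a g"
  proof (cases "g \<in> cent P")
    case True then show ?thesis using inv[OF x] by simp
  next
    case False
    then have "conj_by G x g \<notin> cent P"
      using inv[of "inv x" "conj_by G x g"] x g by auto
    with False show ?thesis using assms(2) by (simp add: supportedD)
  qed
qed fact

lemma Br_conj:
  assumes "x \<in> carrier G" "P \<subseteq> carrier G"
  shows "ga_conj G x (Br P a) = Br (conj_by G x ` P) (ga_conj G x a)"
proof
  fix g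
  have "conj_by G (inv x) g \<in> cent P \<longleftrightarrow> g \<in> cent (conj_by G x ` P)" if "g \<in> carrier G"
    using that assms centralizer_subset by (force simp: centralizer_conj_by subset_iff image_iff)
  then show "ga_conj G x (Br P a) g = Br (conj_by G x ` P) (ga_conj G x a) g"
    using assms centralizer_subset by (auto simp: ga_conj_apply Br_apply)
qed

text \<open>
  The coefficient of \<open>a \<star> b\<close> at a \<open>P\<close>-fixed element \<open>g\<close> is a sum over the pairs \<open>(x, y)\<close> with \<open>xy = g\<close>. The
  \<open>p\<close>-group \<open>P\<close> permutes these pairs by simultaneous conjugation, and the pairs it fixes are those with both
  entries in the centralizer.
\<close>
lemma Br_conv:
  assumes P: "p_subgroup p G P" and a: "a \<in> fixed P" and b: "b \<in> fixed P"
  shows "Br P (a \<star> b) = Br P a \<star> Br P b"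
proof
  fix g
  have sP: "subgroup P G" using P by (rule p_subgroup_imp_subgroup)
  interpret P: subgroup P G by fact
  have sC: "subgroup (cent P) G" by (rule subgroup_centralizer) (rule P.subset)
  show "Br P (a \<star> b) g = (Br P a \<star> Br P b) g"
  proof (cases "g \<in> cent P")
    case True
    let ?\<Omega> = "{(x, y) \<in> carrier G \<times> carrier G. x \<otimes> y = g}"
    let ?act = "\<lambda>u (x, y). (conj_by G u x, conj_by G u y)"
    let ?F = "\<lambda>(x, y). a x * b y"
    have gfix: "conj_by G u g = g" if "u \<in> P" for u
      using True that mem_centralizer_iff[OF P.subset] by auto
    have "\<exists>r. sum ?F ?\<Omega> = sum ?F {w \<in> ?\<Omega>. \<forall>u \<in> P. ?act u w = w} + of_nat p * r"
    proof (rule p_group_action_sum[OF P prime_p])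
      show "finite ?\<Omega>" by (rule finite_subset[of _ "carrier G \<times> carrier G"]) auto
      show "?act u w \<in> ?\<Omega>" if "u \<in> P" "w \<in> ?\<Omega>" for u w
        using that gfix[OF that(1)] by (auto simp flip: conj_by_mult)
      show "?F (?act u w) = ?F w" if "u \<in> P" "w \<in> ?\<Omega>" for u w
        using that a b by (auto simp: fixed_apply)
    qed (auto simp: conj_by_conj_by)
    then have "(a \<star> b) g = sum ?F {w \<in> ?\<Omega>. \<forall>u \<in> P. ?act u w = w}"
      unfolding conv_pairs by auto
    also have "\<dots> = sum (\<lambda>(x, y). Br P a x * Br P b y) ?\<Omega>"
    proof (rule sum.mono_neutral_cong_left)
      show "finite ?\<Omega>" by (rule finite_subset[of _ "carrier G \<times> carrier G"]) auto
      show "{w \<in> ?\<Omega>. \<forall>u \<in> P. ?act u w = w} \<subseteq> ?\<Omega>" by auto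
      show "\<forall>w \<in> ?\<Omega> - {w \<in> ?\<Omega>. \<forall>u \<in> P. ?act u w = w}. (case w of (x, y) \<Rightarrow> Br P a x * Br P b y) = 0"
        using P.subset by (fastforce simp: Br_apply mem_centralizer_iff split: if_splits)
      show "?F w = (case w of (x, y) \<Rightarrow> Br P a x * Br P b y)"
        if "w \<in> {w \<in> ?\<Omega>. \<forall>u \<in> P. ?act u w = w}" for w
        using that P.subset by (auto simp: Br_apply mem_centralizer_iff)
    qed
    also have "\<dots> = (Br P a \<star> Br P b) g" by (simp add: conv_pairs)
    finally show ?thesis using True by (simp add: Br_apply)
  next
    case False
    then show ?thesis
      using supported_conv[OF sC Br_supported Br_supported] by (auto simp: Br_apply dest: supportedD)
  qed
qed

section \<open>Fitting's lemma and primitive idempotents\<close>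

text \<open>From here on functions are added as elements of an algebra and not evaluated.\<close>

declare plus_fun_apply [simp del] zero_fun_apply [simp del] minus_apply [simp del] scale_apply [simp del]

lemmas fun_apply = plus_fun_apply zero_fun_apply minus_apply scale_apply

sublocale V: vector_space scale
  by unfold_locales (auto simp: fun_eq_iff algebra_simps fun_apply)

lemma supported_span: "a \<in> supported (carrier G) \<Longrightarrow> a = (\<Sum>x \<in> carrier G. scale (a x) (ga_basis x))"
proof
  fix g assume a: "a \<in> supported (carrier G)"
  have "(\<Sum>x \<in> carrier G. scale (a x) (ga_basis x)) g = (\<Sum>x \<in> carrier G. if x = g then a x else 0)"
    unfolding sum_fun_apply by (intro sum.cong) (auto simp: ga_basis_def fun_apply)
  then show "a g = (\<Sum>x \<in> carrier G. scale (a x) (ga_basis x)) g"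
    using supportedD[OF a, of g] by (auto simp: sum.delta)
qed

lemma independent_bound:
  assumes "V.independent B" "B \<subseteq> supported (carrier G)"
  shows "finite B" "card B \<le> card (carrier G)"
proof -
  have "B \<subseteq> V.span (ga_basis ` carrier G)"
  proof
    fix a assume "a \<in> B"
    then have "a = (\<Sum>x \<in> carrier G. scale (a x) (ga_basis x))" using assms supported_span by blast
    then show "a \<in> V.span (ga_basis ` carrier G)"
      by (metis (no_types, lifting) V.span_sum V.span_scale V.span_base image_eqI)
  qed
  from V.independent_span_bound[OF _ assms(1) this]
  show "finite B" "card B \<le> card (carrier G)"
    using card_image_le[OF finite_carrier, of "ga_basis :: 'g \<Rightarrow> 'g \<Rightarrow> 'k"] by auto
qed

definition subalgebra :: "('g \<Rightarrow> 'k) set \<Rightarrow> bool" where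
  "subalgebra S \<longleftrightarrow> S \<subseteq> supported (carrier G) \<and> 0 \<in> S \<and> (\<forall>a \<in> S. \<forall>b \<in> S. a + b \<in> S) \<and>
     (\<forall>r. \<forall>a \<in> S. scale r a \<in> S) \<and> (\<forall>a \<in> S. \<forall>b \<in> S. a \<star> b \<in> S)"

lemma subalgebraD:
  assumes "subalgebra S"
  shows "a \<in> S \<Longrightarrow> a \<in> supported (carrier G)" "0 \<in> S" "a \<in> S \<Longrightarrow> b \<in> S \<Longrightarrow> a + b \<in> S"
    "a \<in> S \<Longrightarrow> scale r a \<in> S" "a \<in> S \<Longrightarrow> b \<in> S \<Longrightarrow> a \<star> b \<in> S"
  using assms by (auto simp: subalgebra_def)

lemma subalgebra_diff:
  assumes "subalgebra S" "a \<in> S" "b \<in> S" shows "a - b \<in> S"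
proof -
  have "a + scale (-1) b \<in> S" using assms by (intro subalgebraD[OF assms(1)])
  moreover have "a + scale (-1) b = a - b" by (auto simp: fun_eq_iff fun_apply)
  ultimately show ?thesis by (simp only:)
qed

text \<open>
  Powers for \<open>\<star>\<close>; note that \<open>^\<close> would be the pointwise power of functions.
\<close>
definition conv_pow :: "('g \<Rightarrow> 'k) \<Rightarrow> nat \<Rightarrow> 'g \<Rightarrow> 'k" where
  "conv_pow z n = ((\<lambda>b. z \<star> b) ^^ n) unit"

lemma conv_pow_0 [simp]: "conv_pow z 0 = unit" and conv_pow_Suc: "conv_pow z (Suc n) = z \<star> conv_pow z n"
  by (simp_all add: conv_pow_def)

lemma conv_pow_supported [simp, intro]: "conv_pow z n \<in> supported (carrier G)"
  by (cases n) (auto simp: conv_pow_Suc)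

lemma conv_pow_add: "conv_pow z (m + n) = conv_pow z m \<star> conv_pow z n"
  by (induction m) (simp_all add: conv_pow_Suc conv_assoc)

lemma conv_pow_1: "z \<in> supported (carrier G) \<Longrightarrow> conv_pow z (Suc 0) = z"
  by (simp add: conv_pow_Suc)

lemma conv_pow_commute: "z \<in> supported (carrier G) \<Longrightarrow> conv_pow z n \<star> z = z \<star> conv_pow z n"
  using conv_pow_add[of z n 1] by (simp add: conv_pow_1 flip: conv_pow_Suc)

lemma conv_pow_subalgebra: "subalgebra S \<Longrightarrow> z \<in> S \<Longrightarrow> n \<ge> 1 \<Longrightarrow> conv_pow z n \<in> S"
proof (induction n)
  case (Suc n)
  then show ?case by (cases n) (simp_all add: conv_pow_1 conv_pow_Suc subalgebraD)
qed simp

text \<open>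
  Fitting's lemma. The spans \<open>W n\<close> of the powers from \<open>z\<^sup>n\<close> on form a descending chain of subspaces of a
  finite-dimensional space, so \<open>z\<^sup>n \<in> W (2n + 1)\<close> for some \<open>n\<close>, that is \<open>z\<^sup>n = z\<^sup>2\<^sup>n \<star> h\<close>; then
  \<open>z\<^sup>n \<star> h\<close> is idempotent and acts as the identity on \<open>z\<^sup>n\<close>. The subalgebra \<open>S\<close> may lack a unit;
  it will be an ideal, and the point is that the idempotent lies in it.
\<close>
lemma power_idempotent:
  assumes S: "subalgebra S" and z: "z \<in> S"
  shows "(\<exists>n \<ge> 1. conv_pow z n = 0) \<or>
    (\<exists>h \<in> S. h \<star> z = z \<star> h \<and> (z \<star> h) \<star> (z \<star> h) = z \<star> h \<and> z \<star> h \<noteq> 0)"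
proof -
  have zs: "z \<in> supported (carrier G)" using S z by (rule subalgebraD)
  define W where "W n = V.span (conv_pow z ` {n..})" for n
  have W_mono: "W m \<subseteq> W n" if "n \<le> m" for m n
    unfolding W_def using that by (intro V.span_mono image_mono) auto
  have W_mult: "conv_pow z i \<star> a \<in> W (k + i)" if "a \<in> W k" for i k a
    using that unfolding W_def
  proof (induction rule: V.span_induct_alt)
    case base show ?case by (simp add: V.span_zero)
  next
    case (step c x y)
    then obtain m where m: "m \<ge> k" "x = conv_pow z m" by auto
    have "conv_pow z (i + m) \<in> V.span (conv_pow z ` {k + i..})" using m by (intro V.span_base) auto
    with step.IH show ?case unfolding m(2)
      by (simp add: conv_add_right conv_scale_right V.span_add V.span_scale flip: conv_pow_add)
  qed
  have "\<exists>n \<ge> 1. conv_pow z n \<in> W (Suc n)"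
  proof (rule ccontr)
    assume "\<not> ?thesis"
    then have notin: "conv_pow z n \<notin> W (Suc n)" if "n \<ge> 1" for n using that by blast
    have "V.independent (conv_pow z ` {n..<n + k}) \<and> card (conv_pow z ` {n..<n + k}) = k" if "n \<ge> 1" for n k
      using that
    proof (induction k arbitrary: n)
      case 0 show ?case by (simp add: V.independent_empty)
    next
      case (Suc k)
      have eq: "{n..<n + Suc k} = insert n {Suc n..<Suc n + k}" by auto
      have "conv_pow z ` {Suc n..<Suc n + k} \<subseteq> conv_pow z ` {Suc n..}" by auto
      then have ni: "conv_pow z n \<notin> V.span (conv_pow z ` {Suc n..<Suc n + k})"
        using notin[OF Suc.prems] V.span_mono unfolding W_def by blast
      then have "conv_pow z n \<notin> conv_pow z ` {Suc n..<Suc n + k}" using V.span_base by blast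
      moreover have "V.independent (conv_pow z ` {Suc n..<Suc n + k})"
        "card (conv_pow z ` {Suc n..<Suc n + k}) = k" using Suc.IH[of "Suc n"] by auto
      ultimately show ?case using ni unfolding eq by (simp add: V.independent_insertI)
    qed
    from this[of 1 "Suc (card (carrier G))"]
    show False using independent_bound(2)[of "conv_pow z ` {1..<1 + Suc (card (carrier G))}"] by auto
  qed
  then obtain n where n: "n \<ge> 1" "conv_pow z n \<in> W (Suc n)" by blast
  have "conv_pow z n \<in> W (n + j)" for j
  proof (induction j)
    case 0 show ?case by (auto simp: W_def intro: V.span_base)
  next
    case (Suc j)
    have "conv_pow z ` {Suc n..} \<subseteq> W (n + Suc j)"
    proof safe
      fix m assume "m \<ge> Suc n"
      then have "conv_pow z m = conv_pow z (m - n) \<star> conv_pow z n" by (simp flip: conv_pow_add)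
      then have "conv_pow z m \<in> W (n + j + (m - n))" using W_mult[OF Suc.IH] by simp
      then show "conv_pow z m \<in> W (n + Suc j)" using W_mono[of "n + Suc j" "n + j + (m - n)"] \<open>m \<ge> Suc n\<close> by auto
    qed
    then have "W (Suc n) \<subseteq> W (n + Suc j)"
      unfolding W_def by (intro V.span_minimal V.subspace_span)
    with n show ?case by blast
  qed
  from this[of "Suc n"] have "conv_pow z n \<in> W (Suc (2 * n))" by (simp add: mult_2)
  moreover have "\<exists>h \<in> S. h \<star> z = z \<star> h \<and> a = conv_pow z (2 * n) \<star> h" if "a \<in> W (Suc (2 * n))" for a
    using that unfolding W_def
  proof (induction rule: V.span_induct_alt)
    case base show ?case using S by (intro bexI[of _ 0]) (auto simp: subalgebraD)
  next
    case (step c x y)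
    then obtain h m where h: "h \<in> S" "h \<star> z = z \<star> h" "y = conv_pow z (2 * n) \<star> h"
      and m: "m \<ge> Suc (2 * n)" "x = conv_pow z m" by auto
    have "conv_pow z (2 * n) \<star> conv_pow z (m - 2 * n) = conv_pow z m" using m by (simp flip: conv_pow_add)
    moreover have "conv_pow z (m - 2 * n) \<in> S" using m S z by (intro conv_pow_subalgebra) auto
    ultimately show ?case using h m S zs
      by (intro bexI[of _ "scale c (conv_pow z (m - 2 * n)) + h"])
        (auto simp: subalgebraD conv_add_left conv_add_right conv_scale_left conv_scale_right conv_pow_commute)
  qed
  ultimately obtain h where h: "h \<in> S" "h \<star> z = z \<star> h" "conv_pow z n = conv_pow z (2 * n) \<star> h" by blast
  have hn: "h \<star> conv_pow z m = conv_pow z m \<star> h" for m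
  proof (induction m)
    case 0 show ?case using h S by (simp add: subalgebraD)
  next
    case (Suc m) then show ?case using h by (metis conv_assoc conv_pow_Suc)
  qed
  define w where "w = conv_pow z n \<star> h"
  have pw: "w \<star> conv_pow z n = conv_pow z n"
    using h(3) by (simp add: w_def conv_assoc hn mult_2 conv_pow_add)
  have "w \<star> w = w \<star> conv_pow z n \<star> h" by (simp add: w_def conv_assoc)
  then have ww: "w \<star> w = w" using pw by (simp add: w_def)
  obtain m where m: "n = Suc m" using n by (cases n) auto
  define h' where "h' = conv_pow z m \<star> h"
  have "h' \<in> S"
  proof (cases m)
    case 0 then show ?thesis using h S by (simp add: h'_def subalgebraD)
  next
    case (Suc k)
    then have "conv_pow z m \<in> S" using S z by (intro conv_pow_subalgebra) auto
    then show ?thesis using h S by (simp add: h'_def subalgebraD)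
  qed
  moreover have "z \<star> h' = w" by (simp add: h'_def w_def m conv_pow_Suc conv_assoc)
  moreover have "h' \<star> z = z \<star> h'"
    by (metis conv_assoc h'_def h(2) conv_pow_commute zs)
  moreover have "conv_pow z n = 0" if "w = 0" using pw that by simp
  ultimately show ?thesis using ww n by metis
qed

text \<open>
  If \<open>d < e\<close> are idempotents, the right ideal \<open>dA\<close> is properly contained in \<open>eA\<close>; choose \<open>e\<close> with
  \<open>eA\<close> of least dimension.
\<close>
lemma idempotent_minimal:
  assumes "E \<noteq> {}" and E: "\<And>e. e \<in> E \<Longrightarrow> e \<in> supported (carrier G) \<and> e \<star> e = e"
  shows "\<exists>e \<in> E. \<forall>d \<in> E. d \<star> e = d \<longrightarrow> e \<star> d = d \<longrightarrow> d = e"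
proof -
  define R where "R e = {a \<in> supported (carrier G). e \<star> a = a}" for e
  \<comment> \<open>the maximum of \<open>Cs e\<close> is the dimension of the right ideal \<open>R e\<close>\<close>
  define Cs where "Cs e = card ` {B. V.independent B \<and> B \<subseteq> R e}" for e
  have Cs: "finite (Cs e)" "Cs e \<noteq> {}" for e
  proof -
    have "Cs e \<subseteq> {..card (carrier G)}" using independent_bound(2) by (auto simp: Cs_def R_def)
    then show "finite (Cs e)" using finite_subset by blast
    show "Cs e \<noteq> {}" using V.independent_empty by (auto simp: Cs_def)
  qed
  obtain e where e: "e \<in> E" "\<And>d. d \<in> E \<Longrightarrow> Max (Cs e) \<le> Max (Cs d)"
    using ex_has_least_nat[of "\<lambda>e. e \<in> E" _ "\<lambda>e. Max (Cs e)"] assms(1) by blast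
  have "d = e" if d: "d \<in> E" "d \<star> e = d" "e \<star> d = d" for d
  proof (rule ccontr)
    assume "d \<noteq> e"
    have "\<exists>B. V.independent B \<and> B \<subseteq> R d \<and> card B = n" if "n \<in> Cs d" for n
      using that unfolding Cs_def by blast
    from this[OF Max_in[OF Cs(1) Cs(2)]]
    obtain B where B: "V.independent B" "B \<subseteq> R d" "card B = Max (Cs d)" by blast
    have finB: "finite B" using B independent_bound(1) by (auto simp: R_def)
    have "V.subspace (R d)"
      unfolding R_def V.subspace_def
      by (auto simp: conv_add_right conv_scale_right supported_def fun_apply)
    then have "V.span B \<subseteq> R d" using B V.span_minimal by blast
    moreover have "e \<notin> R d" using d \<open>d \<noteq> e\<close> by (auto simp: R_def)
    ultimately have ni: "e \<notin> V.span B" by blast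
    have "V.independent (insert e B)" using B ni by (simp add: V.independent_insertI)
    moreover have "insert e B \<subseteq> R e"
    proof -
      have "e \<star> a = a" if "a \<in> B" for a
      proof -
        have "d \<star> a = a" using that B(2) by (auto simp: R_def)
        then show ?thesis using d(3) by (metis conv_assoc)
      qed
      then show ?thesis using B(2) E[OF e(1)] by (auto simp: R_def)
    qed
    ultimately have "card (insert e B) \<in> Cs e" unfolding Cs_def by blast
    then have "card (insert e B) \<le> Max (Cs e)" using Cs by simp
    moreover have "e \<notin> B" using ni V.span_base by blast
    ultimately show False using e(2)[OF d(1)] B(3) finB by simp
  qed
  with e show ?thesis by blast
qed

text \<open>
  Primitivity relative to the carrier \<open>S\<close> of an algebra, so that the fixed point algebras and the centres can be
  treated uniformly inside the group algebra of \<open>G\<close>.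
\<close>
definition primitive_in :: "('g \<Rightarrow> 'k) set \<Rightarrow> ('g \<Rightarrow> 'k) \<Rightarrow> bool" where
  "primitive_in S e \<longleftrightarrow> e \<in> S \<and> e \<star> e = e \<and> e \<noteq> 0 \<and>
     (\<forall>j l. j \<in> S \<longrightarrow> l \<in> S \<longrightarrow> j \<star> j = j \<longrightarrow> l \<star> l = l \<longrightarrow> j \<star> l = 0 \<longrightarrow> l \<star> j = 0 \<longrightarrow> e = j + l \<longrightarrow>
        j = 0 \<or> l = 0)"

lemma primD: "primitive_in S e \<Longrightarrow> e \<in> S" "primitive_in S e \<Longrightarrow> e \<star> e = e" "primitive_in S e \<Longrightarrow> e \<noteq> 0"
  by (auto simp: primitive_in_def)

text \<open>
  Among the idempotents below \<open>i\<close> that satisfy \<open>\<Phi>\<close> a minimal one is primitive, because \<open>\<Phi>\<close> passes to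
  one of the two summands of an orthogonal decomposition. Typically \<open>\<Phi>\<close> says that some additive map does not
  vanish.
\<close>
lemma prim_below:
  assumes S: "S \<subseteq> supported (carrier G)" and i: "i \<in> S" "i \<star> i = i" "\<Phi> i" and "\<not> \<Phi> 0"
    and \<Phi>: "\<And>j l. j \<in> S \<Longrightarrow> l \<in> S \<Longrightarrow> \<Phi> (j + l) \<Longrightarrow> \<Phi> j \<or> \<Phi> l"
  shows "\<exists>j. primitive_in S j \<and> \<Phi> j \<and> j \<star> i = j \<and> i \<star> j = j"
proof -
  define E where "E = {j \<in> S. j \<star> j = j \<and> \<Phi> j \<and> j \<star> i = j \<and> i \<star> j = j}"
  have "i \<in> E" using i by (simp add: E_def)
  then obtain e where e: "e \<in> E" "\<And>d. d \<in> E \<Longrightarrow> d \<star> e = d \<Longrightarrow> e \<star> d = d \<Longrightarrow> d = e"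
  proof -
    have "\<exists>e \<in> E. \<forall>d \<in> E. d \<star> e = d \<longrightarrow> e \<star> d = d \<longrightarrow> d = e"
      by (rule idempotent_minimal) (use S \<open>i \<in> E\<close> in \<open>auto simp: E_def\<close>)
    then show ?thesis using that by blast
  qed
  have part: "j = e" if "j \<in> S" "j \<star> j = j" "j \<star> l = 0" "l \<star> j = 0" "e = j + l" "\<Phi> j" for j l
  proof -
    have je: "j \<star> e = j" "e \<star> j = j" using that by (simp_all add: conv_add_left conv_add_right)
    moreover have "j \<star> i = j" "i \<star> j = j" using je e(1) unfolding E_def
      by (metis (mono_tags, lifting) conv_assoc mem_Collect_eq)+
    ultimately show ?thesis using that e(2)[of j] by (simp add: E_def)
  qed
  have "primitive_in S e"
    unfolding primitive_in_def
  proof (intro conjI allI impI)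
    show "e \<in> S" "e \<star> e = e" using e by (auto simp: E_def)
    show "e \<noteq> 0" using e \<open>\<not> \<Phi> 0\<close> by (auto simp: E_def)
    fix j l assume jl: "j \<in> S" "l \<in> S" "j \<star> j = j" "l \<star> l = l" "j \<star> l = 0" "l \<star> j = 0" "e = j + l"
    have "\<Phi> j \<or> \<Phi> l" using \<Phi> jl e(1) unfolding E_def by blast
    then show "j = 0 \<or> l = 0"
      using part[OF jl(1,3,5,6,7)] part[OF jl(2,4,6,5)] jl(7) by (auto simp: add.commute)
  qed
  with e show ?thesis unfolding E_def by blast
qed

lemma prim_fixed_iff: "primitive_idempotent (ga_fixed G P) i \<longleftrightarrow> primitive_in (fixed P) i"
proof -
  have [simp]: "\<zero>\<^bsub>ga_fixed G P\<^esub> = (0 :: 'g \<Rightarrow> 'k)" "a \<oplus>\<^bsub>ga_fixed G P\<^esub> b = a + b" for a b :: "'g \<Rightarrow> 'k"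
    by (auto simp: ga_fixed_def group_algebra_def fun_eq_iff fun_apply)
  show ?thesis by (auto simp: primitive_idempotent_def idempotent_of_def primitive_in_def)
qed

text \<open>
  \<open>e = ze + (e - ze)\<close> is an orthogonal decomposition.
\<close>
lemma prim_dichotomy:
  assumes e: "primitive_in S e" and S: "subalgebra S" and z: "z \<in> S" "z \<star> z = z" and comm: "z \<star> e = e \<star> z"
  shows "z \<star> e = 0 \<or> z \<star> e = e"
proof -
  have ee: "e \<in> S" "e \<star> e = e" using e by (auto simp: primitive_in_def)
  have 1: "z \<star> e \<star> (z \<star> e) = z \<star> e" by (metis comm conv_assoc ee(2) z(2))
  have 2: "z \<star> e \<star> e = z \<star> e" "e \<star> (z \<star> e) = z \<star> e" by (metis conv_assoc ee(2)) (metis comm conv_assoc ee(2))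
  have "z \<star> e = 0 \<or> e - z \<star> e = 0"
    using e ee z S 1 2 unfolding primitive_in_def
    by (elim conjE allE[of _ "z \<star> e"] allE[of _ "e - z \<star> e"])
      (auto simp: subalgebraD subalgebra_diff conv_diff_left conv_diff_right)
  then show ?thesis by auto
qed

section \<open>Blocks\<close>

definition central :: "'g set \<Rightarrow> ('g \<Rightarrow> 'k) set" where
  "central C = {z \<in> supported C. \<forall>a \<in> supported C. z \<star> a = a \<star> z}"

text \<open>
  From here on a block of the group algebra of \<open>C\<close> is a primitive idempotent of \<open>central C\<close>.
\<close>
lemma block_idempotent_iff:
  assumes "subgroup C G"
  shows "block_idempotent (G\<lparr>carrier := C\<rparr>) e \<longleftrightarrow> primitive_in (central C) e"
proof -
  let ?A = "group_algebra (G\<lparr>carrier := C\<rparr>) :: ('g \<Rightarrow> 'k) ring"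
  have car: "carrier ?A = supported C" by (auto simp: group_algebra_def supported_def)
  have m: "a \<otimes>\<^bsub>?A\<^esub> b = a \<star> b" if "a \<in> supported C" "b \<in> supported C" for a b
    using subgroup_algebra_mult[OF assms that] .
  have cc: "carrier (ring_center ?A) = central C"
    by (auto simp: ring_center_def central_def car m)
  have [simp]: "\<zero>\<^bsub>ring_center ?A\<^esub> = 0" "a \<oplus>\<^bsub>ring_center ?A\<^esub> b = a + b" for a b
    by (auto simp: ring_center_def group_algebra_def fun_eq_iff fun_apply)
  have m': "a \<otimes>\<^bsub>ring_center ?A\<^esub> b = a \<star> b" if "a \<in> central C" "b \<in> central C" for a b
  proof -
    have "a \<otimes>\<^bsub>ring_center ?A\<^esub> b = a \<otimes>\<^bsub>?A\<^esub> b" by (simp add: ring_center_def)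
    also have "\<dots> = a \<star> b" by (rule m) (use that in \<open>auto simp: central_def\<close>)
    finally show ?thesis .
  qed
  have "block_idempotent (G\<lparr>carrier := C\<rparr>) e \<longleftrightarrow> (e \<in> central C \<and> e \<star> e = e) \<and> e \<noteq> 0 \<and>
      \<not> (\<exists>j l. (j \<in> central C \<and> j \<star> j = j) \<and> (l \<in> central C \<and> l \<star> l = l) \<and> j \<noteq> 0 \<and> l \<noteq> 0 \<and>
          j \<star> l = 0 \<and> l \<star> j = 0 \<and> e = j + l)"
    unfolding block_idempotent_def primitive_idempotent_def idempotent_of_def cc
    by (simp add: m' cong: conj_cong)
  then show ?thesis unfolding primitive_in_def by blast
qed

lemma ga_conj_eq_iff:
  assumes x: "x \<in> carrier G" and a: "a \<in> supported (carrier G)"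
  shows "ga_conj G x a = a \<longleftrightarrow> ga_basis x \<star> a = a \<star> ga_basis x"
proof -
  have *: "ga_basis (inv y) \<star> ga_basis y = unit" if "y \<in> carrier G" for y
    using that unfolding fun_eq_iff unit_def
    by (subst ga_basis_conv) (auto simp: ga_basis_conv ga_basis_def)
  have i1: "ga_basis (inv x) \<star> ga_basis x = unit" and i2: "ga_basis x \<star> ga_basis (inv x) = unit"
    using *[of x] *[of "inv x"] x by auto
  have *: "ga_conj G x a \<star> ga_basis x = ga_basis x \<star> a"
    using i1 a by (simp add: ga_conj_def conv_assoc)
  have "a = ga_basis x \<star> a \<star> ga_basis (inv x)" if "ga_basis x \<star> a = a \<star> ga_basis x"
    using i2 a that by (simp add: conv_assoc)
  then show ?thesis using * by (metis ga_conj_def)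
qed

text \<open>
  The basis elements \<open>x \<in> C\<close> span the algebra, and commuting with \<open>x\<close> means being fixed by conjugation
  with \<open>x\<close>.
\<close>
lemma central_eq:
  assumes "subgroup C G"
  shows "central C = supported C \<inter> fixed C"
proof -
  interpret C: subgroup C G by fact
  have sup: "a \<in> supported (carrier G)" if "a \<in> supported C" for a
    using that C.subset supported_mono by blast
  have b: "ga_basis x \<in> supported C" if "x \<in> C" for x using that by (auto simp: supported_def ga_basis_def)
  have "z \<star> a = a \<star> z" if z: "z \<in> supported C" "z \<in> fixed C" and a: "a \<in> supported C" for z a
  proof -
    have x: "scale (a x) (z \<star> ga_basis x) = scale (a x) (ga_basis x \<star> z)" if "x \<in> carrier G" for x
    proof (cases "x \<in> C")
      case True
      then have "ga_basis x \<star> z = z \<star> ga_basis x"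
        using ga_conj_eq_iff[OF that, of z] z by (simp add: fixed_def)
      then show ?thesis by simp
    next
      case False then show ?thesis using a by (simp add: supportedD)
    qed
    have "z \<star> a = z \<star> (\<Sum>x \<in> carrier G. scale (a x) (ga_basis x))" using supported_span[OF sup[OF a]] by simp
    also have "\<dots> = (\<Sum>x \<in> carrier G. scale (a x) (ga_basis x)) \<star> z"
      unfolding conv_sum_left conv_sum_right conv_scale_left conv_scale_right by (rule sum.cong[OF refl x])
    also have "\<dots> = a \<star> z" using supported_span[OF sup[OF a]] by simp
    finally show ?thesis .
  qed
  moreover have "z \<in> fixed C" if "z \<in> central C" for z
    using that b sup ga_conj_eq_iff[of _ z] unfolding fixed_def central_def by auto
  ultimately show ?thesis by (auto simp: central_def)
qed

lemma subalgebra_supported: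
  assumes C: "subgroup C G"
  shows "subalgebra (supported C)"
  using supported_conv[OF C] supported_mono[OF subgroup.subset[OF C]]
  unfolding subalgebra_def by (auto simp: supported_def fun_apply)

lemma subalgebra_fixed: "M \<subseteq> carrier G \<Longrightarrow> subalgebra (fixed M)"
  by (auto simp: subalgebra_def fixed_conv) (auto simp: fixed_def ga_conj_add ga_conj_scale supported_def fun_apply)

lemma subalgebra_Int: "subalgebra S \<Longrightarrow> subalgebra T \<Longrightarrow> subalgebra (S \<inter> T)"
  by (auto simp: subalgebra_def)

lemma subalgebra_central: "subgroup C G \<Longrightarrow> subalgebra (central C)"
  by (simp add: central_eq subalgebra_Int subalgebra_supported subalgebra_fixed subgroup.subset)

lemma central_commute: "z \<in> central C \<Longrightarrow> a \<in> supported C \<Longrightarrow> z \<star> a = a \<star> z"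
  by (simp add: central_def)

lemma central_supported: "z \<in> central C \<Longrightarrow> z \<in> supported C"
  by (simp add: central_def)

lemma unit_central:
  assumes C: "subgroup C G"
  shows "unit \<in> central C"
  using subgroup.one_closed[OF C] supported_mono[OF subgroup.subset[OF C]]
  by (auto simp: central_def unit_in_supported)

lemma block_dichotomy:
  assumes "subgroup C G" "primitive_in (central C) e" "z \<in> central C" "z \<star> z = z"
  shows "z \<star> e = 0 \<or> z \<star> e = e"
  by (rule prim_dichotomy[OF assms(2) subalgebra_central[OF assms(1)] assms(3,4)
      central_commute[OF assms(3) central_supported[OF primD(1)[OF assms(2)]]]])

lemma blocks_orthogonal:
  assumes C: "subgroup C G" and e: "primitive_in (central C) e" and f: "primitive_in (central C) f" and "e \<star> f \<noteq> 0"
  shows "e = f"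
  using block_dichotomy[OF C f primD(1,2)[OF e]] block_dichotomy[OF C e primD(1,2)[OF f]] assms(4)
    central_commute[OF primD(1)[OF e] central_supported[OF primD(1)[OF f]]] by auto

lemma block_conv_sum:
  assumes C: "subgroup C G" and F: "finite F" "F \<subseteq> {e. primitive_in (central C) e}" and b: "primitive_in (central C) b"
  shows "b \<star> \<Sum>F = (if b \<in> F then b else 0)"
proof -
  have "b \<star> \<Sum>F = (\<Sum>f \<in> F. b \<star> f)" using conv_sum_right[of b "\<lambda>x. x" F] by simp
  also have "\<dots> = (\<Sum>f \<in> F. if f = b then b else 0)"
    using F b blocks_orthogonal[OF C b] by (intro sum.cong) (auto simp: primD)
  finally show ?thesis using F by (simp add: sum.delta)
qed

text \<open>
  Take a minimal idempotent of the form \<open>1 - \<Sum>F\<close> with a finite set \<open>F\<close> of blocks. A block below it could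
  be added to \<open>F\<close>, so it is \<open>0\<close>, and then \<open>F\<close> contains every block.
\<close>
lemma sum_blocks:
  assumes C: "subgroup C G"
  shows "finite {e. primitive_in (central C) e}" "\<Sum>{e. primitive_in (central C) e} = unit"
proof -
  let ?B = "{e. primitive_in (central C) e}"
  note alg = subalgebra_central[OF C]
  have sup: "a \<in> supported (carrier G)" if "a \<in> central C" for a using alg that by (rule subalgebraD)
  have orth: "b \<star> \<Sum>F = (if b \<in> F then b else 0)" if "finite F" "F \<subseteq> ?B" "b \<in> ?B" for b F
    using block_conv_sum[OF C that(1,2)] that(3) by simp
  have sumc: "\<Sum>F \<in> central C" if "finite F" "F \<subseteq> ?B" for F
    using that by (induction F) (auto intro: subalgebraD[OF alg] primD)
  define E where "E = (\<lambda>F. unit - \<Sum>F) ` {F. finite F \<and> F \<subseteq> ?B}"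
  have Ec: "e \<in> central C" if "e \<in> E" for e
    using that sumc unit_central[OF C] subalgebra_diff[OF alg] by (auto simp: E_def)
  have "E \<noteq> {}" by (auto simp: E_def)
  moreover have "e \<in> supported (carrier G) \<and> e \<star> e = e" if eE: "e \<in> E" for e
  proof
    show "e \<in> supported (carrier G)" using Ec[OF eE] sup by blast
    obtain F where F: "finite F" "F \<subseteq> ?B" "e = unit - \<Sum>F" using eE by (auto simp: E_def)
    have "\<Sum>F \<star> \<Sum>F = (\<Sum>f \<in> F. f \<star> \<Sum>F)" using conv_sum_left[of "\<lambda>x. x" F] by simp
    also have "\<dots> = \<Sum>F" using orth[OF F(1,2)] F(2) by (intro sum.cong) auto
    finally show "e \<star> e = e" using sup[OF sumc[OF F(1,2)]] sup[OF unit_central[OF C]] F(3)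
      by (simp add: conv_diff_left conv_diff_right)
  qed
  ultimately obtain e where e: "e \<in> E" "\<And>d. d \<in> E \<Longrightarrow> d \<star> e = d \<Longrightarrow> e \<star> d = d \<Longrightarrow> d = e"
    and ee: "e \<star> e = e"
    using idempotent_minimal[of E] by blast
  then obtain F where F: "finite F" "F \<subseteq> ?B" "e = unit - \<Sum>F" by (auto simp: E_def)
  have "e = 0"
  proof (rule ccontr)
    assume "e \<noteq> 0"
    have "\<exists>j. primitive_in (central C) j \<and> j \<noteq> 0 \<and> j \<star> e = j \<and> e \<star> j = j"
      by (rule prim_below) (use sup Ec[OF e(1)] ee \<open>e \<noteq> 0\<close> in auto)
    then obtain b where b: "primitive_in (central C) b" "b \<noteq> 0" "b \<star> e = b" "e \<star> b = b" by blast
    have "b \<star> e = b - b \<star> \<Sum>F" using sup[OF primD(1)[OF b(1)]] F(3) by (simp add: conv_diff_right)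
    then have bF: "b \<notin> F" using orth[OF F(1,2), of b] b by auto
    have "e - b = unit - \<Sum>(insert b F)" using F bF by simp
    then have "e - b \<in> E" using F b unfolding E_def by (intro image_eqI[of _ _ "insert b F"]) auto
    moreover have "(e - b) \<star> e = e - b" "e \<star> (e - b) = e - b"
      using ee b by (simp_all add: conv_diff_left conv_diff_right)
    ultimately have "e - b = e" using e(2) by blast
    then show False using b by simp
  qed
  then have u: "unit = \<Sum>F" using F by simp
  have "b \<in> F" if b: "b \<in> ?B" for b
  proof -
    have "b \<in> supported (carrier G)" using b sup primD(1) by blast
    then have "b = b \<star> \<Sum>F" unfolding u[symmetric] by simp
    then show "b \<in> F" using orth[OF F(1,2) b] primD(3)[of "central C" b] b by (auto split: if_splits)
  qed
  then have "?B = F" using F by blast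
  then show "finite ?B" "\<Sum>?B = unit" using F u by auto
qed

lemma exists_block:
  assumes C: "subgroup C G" and z: "z \<in> supported C" "z \<noteq> 0"
  shows "\<exists>e. primitive_in (central C) e \<and> e \<star> z \<noteq> 0"
proof (rule ccontr)
  assume "\<not> ?thesis"
  then have "(\<Sum>e \<in> {e. primitive_in (central C) e}. e \<star> z) = 0" by (intro sum.neutral) auto
  then have "unit \<star> z = 0" using sum_blocks(2)[OF C] conv_sum_left[of "\<lambda>x. x" "{e. primitive_in (central C) e}" z] by simp
  then show False using z supported_mono[OF subgroup.subset[OF C] z(1)] by simp
qed

section \<open>Lifting along the Brauer homomorphism\<close>

text \<open>
  This takes the place of the fact that \<open>Br T\<close> maps the relative traces from \<open>T\<close> to \<open>M\<close> onto the relative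
  traces from \<open>T\<close> to \<open>N\<close> in the group algebra of the centralizer of \<open>T\<close>, where \<open>N\<close> is the normalizer of \<open>T\<close>
  in \<open>M\<close>. The role of the trace ideal is played by those \<open>M\<close>-fixed elements \<open>a\<close> for
  which \<open>Br Q a = 0\<close> unless \<open>Q\<close> is \<open>M\<close>-conjugate into \<open>T\<close>; this is visibly an ideal, as an intersection of
  kernels of Brauer homomorphisms.
  
  The lift \<open>a\<close> is \<open>x\<close> spread over the \<open>M\<close>-conjugacy classes. It is well defined by Sylow's theorem: if
  \<open>x g \<noteq> 0\<close>, the hypothesis on \<open>Br X x\<close> makes \<open>T\<close> a Sylow subgroup of the centralizer of \<open>g\<close> in \<open>M\<close>, so
  two \<open>M\<close>-conjugate elements of the support of \<open>x\<close> are already conjugate under \<open>N\<close>.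
\<close>
lemma lift_stable:
  assumes M: "subgroup M G" and T: "p_subgroup p G T" "T \<subseteq> M"
    and x: "x \<in> supported (cent T)" and xN: "x \<in> fixed (normalizer_in M T)"
    and van: "\<And>X. p_subgroup p G X \<Longrightarrow> T \<subset> X \<Longrightarrow> X \<subseteq> normalizer_in M T \<Longrightarrow> Br X x = 0"
  shows "\<exists>a \<in> fixed M. Br T a = x \<and>
    (\<forall>Q. p_subgroup p G Q \<longrightarrow> Q \<subseteq> M \<longrightarrow> (\<forall>m \<in> M. \<not> conj_by G m ` Q \<subseteq> T) \<longrightarrow> Br Q a = 0) \<and>
    (\<forall>g. a g \<noteq> 0 \<longrightarrow> (\<exists>m \<in> M. conj_by G m g \<in> cent T))"
proof -
  interpret M: subgroup M G by fact
  have sT: "subgroup T G" using T by (simp add: p_subgroup_imp_subgroup)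
  interpret T: subgroup T G by fact
  have finM: "finite M" using M.subset finite_carrier finite_subset by blast
  have xc: "g \<in> cent T" if "x g \<noteq> 0" for g using x that by (auto dest: supportedD)
  have into: "\<exists>d \<in> M. conj_by G d g = g \<and> conj_by G d ` Q \<subseteq> T"
    if g: "x g \<noteq> 0" and Q: "p_subgroup p G Q" "Q \<subseteq> M" "\<And>q. q \<in> Q \<Longrightarrow> conj_by G q g = g" for g Q
  proof -
    have gT: "g \<in> cent T" using xc g by blast
    then have gG: "g \<in> carrier G" using centralizer_subset by blast
    define D where "D = {m \<in> M. conj_by G m g = g}"
    have sD: "subgroup D G"
      unfolding D_def
    proof
      show "inv a \<in> {m \<in> M. conj_by G m g = g}" if "a \<in> {m \<in> M. conj_by G m g = g}" for a
        using that gG conj_by_inv_conj_by(1)[of a g] by auto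
    qed (use gG in \<open>auto simp flip: conj_by_conj_by\<close>)
    have TD: "T \<subseteq> D" using gT T T.subset by (auto simp: D_def mem_centralizer_iff)
    have DM: "D \<subseteq> M" by (auto simp: D_def)
    have "\<exists>d \<in> D. conj_by G d ` Q \<subseteq> T"
    proof (rule p_subgroups_conj_into[OF sD _ T(1) TD prime_p _ Q(1)])
      show "finite D" using DM finM finite_subset by blast
      show "Q \<subseteq> D" using Q by (auto simp: D_def)
      fix X assume X: "p_subgroup p G X" "T \<subset> X" "X \<subseteq> normalizer_in D T"
      then have "Br X x = 0" using DM by (intro van) auto
      moreover have "g \<in> cent X"
        using X gG p_subgroup_subset_carrier[OF X(1)] by (auto simp: mem_centralizer_iff D_def)
      ultimately show False using g by (metis Br_apply zero_fun_apply)
    qed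
    then show ?thesis by (auto simp: D_def)
  qed
  \<comment> \<open>the conjugate of \<open>T\<close> by \<open>inv n\<close> centralizes \<open>g\<close> as well, so some element fixing \<open>g\<close> moves it back to \<open>T\<close>\<close>
  have inj: "x (conj_by G n g) = x g" if g: "x g \<noteq> 0" and n: "n \<in> M" "conj_by G n g \<in> cent T" for g n
  proof -
    have gG: "g \<in> carrier G" using xc[OF g] centralizer_subset by blast
    have nG: "n \<in> carrier G" using n by auto
    let ?Q = "conj_by G (inv n) ` T"
    have "p_subgroup p G ?Q" using T nG by (simp add: p_subgroup_conj_by)
    moreover have "?Q \<subseteq> M" using n T(2) by (auto simp: conj_by_def)
    moreover have "conj_by G q g = g" if "q \<in> ?Q" for q
    proof -
      obtain t where t: "t \<in> T" "q = conj_by G (inv n) t" using \<open>q \<in> ?Q\<close> by auto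
      have tG: "t \<in> carrier G" using t by auto
      have "conj_by G t (conj_by G n g) = conj_by G n g"
        using n t by (simp add: mem_centralizer_iff[OF T.subset])
      then have "conj_by G (inv n) (conj_by G t (conj_by G n g)) = g" using nG gG by simp
      moreover have "conj_by G q g = conj_by G (inv n) (conj_by G t (conj_by G n g))"
        using t tG nG gG by (simp add: conj_by_conj_by m_assoc) (simp add: conj_by_def m_assoc)
      ultimately show ?thesis by simp
    qed
    ultimately have "\<exists>d \<in> M. conj_by G d g = g \<and> conj_by G d ` ?Q \<subseteq> T" by (rule into[OF g])
    then obtain d where d: "d \<in> M" "conj_by G d g = g" "conj_by G d ` ?Q \<subseteq> T" by blast
    have dG: "d \<in> carrier G" using d by auto
    let ?k = "d \<otimes> inv n"
    have kM: "?k \<in> M" "?k \<in> carrier G" using d n by auto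
    have "conj_by G ?k ` T \<subseteq> T" using d(3) dG nG T.subset by (simp add: conj_by_image_conj_by)
    then have "conj_by G ?k ` T = T"
      using kM T.subset finM T(2) by (intro image_conj_by_eqI) (auto intro: finite_subset)
    then have "x (conj_by G ?k (conj_by G n g)) = x (conj_by G n g)"
      using kM nG gG by (intro fixed_apply[OF xN]) auto
    moreover have "conj_by G ?k (conj_by G n g) = g"
      using d dG nG gG by (simp add: conj_by_conj_by m_assoc)
    ultimately show ?thesis by simp
  qed
  define a where "a g = (if g \<in> carrier G \<and> (\<exists>m \<in> M. x (conj_by G m g) \<noteq> 0) then
    x (conj_by G (SOME m. m \<in> M \<and> x (conj_by G m g) \<noteq> 0) g) else 0)" for g
  have val: "a g = x (conj_by G m g)" if g: "g \<in> carrier G" and m: "m \<in> M" "x (conj_by G m g) \<noteq> 0" for g m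
  proof -
    define n where "n = (SOME m. m \<in> M \<and> x (conj_by G m g) \<noteq> 0)"
    have n: "n \<in> M" "x (conj_by G n g) \<noteq> 0"
      using someI[of "\<lambda>m. m \<in> M \<and> x (conj_by G m g) \<noteq> 0" m] m by (auto simp: n_def)
    have "conj_by G (n \<otimes> inv m) (conj_by G m g) = conj_by G n g"
      using m n g by (simp add: conj_by_conj_by m_assoc)
    then have "x (conj_by G n g) = x (conj_by G m g)"
      using inj[of "conj_by G m g" "n \<otimes> inv m"] m n xc by auto
    moreover have "a g = x (conj_by G n g)" using g m unfolding a_def n_def by auto
    ultimately show ?thesis by simp
  qed
  have val0: "a g = 0" if "\<And>m. m \<in> M \<Longrightarrow> x (conj_by G m g) = 0" for g
    using that by (auto simp: a_def)
  have afix: "a \<in> fixed M"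
  proof (rule fixedI[OF M])
    show "a \<in> supported (carrier G)" by (auto simp: supported_def a_def)
    fix m g assume m: "m \<in> M" and g: "g \<in> carrier G"
    have c: "x (conj_by G n (conj_by G m g)) = x (conj_by G (n \<otimes> m) g)" if "n \<in> M" for n
      using that m g by (simp add: conj_by_conj_by)
    show "a (conj_by G m g) = a g"
    proof (cases "\<exists>n \<in> M. x (conj_by G n (conj_by G m g)) \<noteq> 0")
      case True
      then obtain n where n: "n \<in> M" "x (conj_by G n (conj_by G m g)) \<noteq> 0" by blast
      have "a (conj_by G m g) = x (conj_by G n (conj_by G m g))" using n m g by (intro val) auto
      also have "\<dots> = a g" using val[of g "n \<otimes> m"] c[of n] n m g by auto
      finally show ?thesis .
    next
      case False
      have "x (conj_by G n g) = 0" if "n \<in> M" for n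
      proof -
        have "x (conj_by G (n \<otimes> inv m) (conj_by G m g)) = 0" using False that m by auto
        then show ?thesis using that m g by (simp add: conj_by_conj_by m_assoc)
      qed
      then have "a g = 0" by (rule val0)
      moreover have "a (conj_by G m g) = 0" using False by (intro val0) auto
      ultimately show ?thesis by simp
    qed
  qed
  have "Br T a = x"
  proof
    fix g
    show "Br T a g = x g"
    proof (cases "g \<in> cent T")
      case gT: True
      then have gG: "g \<in> carrier G" using centralizer_subset by blast
      have "a g = x g"
      proof (cases "\<exists>m \<in> M. x (conj_by G m g) \<noteq> 0")
        case True
        then obtain m where m: "m \<in> M" "x (conj_by G m g) \<noteq> 0" by blast
        have "conj_by G (inv m) (conj_by G m g) = g" using m gG by simp
        then have "x g = x (conj_by G m g)" using inj[OF m(2), of "inv m"] m gT by simp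
        then show ?thesis using val[OF gG m] by simp
      next
        case False
        then have z: "x (conj_by G m g) = 0" if "m \<in> M" for m using that by blast
        have "x g = 0" using z[OF M.one_closed] gG by simp
        then show ?thesis using val0[of g] z by auto
      qed
      then show ?thesis using gT by (simp add: Br_apply)
    next
      case False then show ?thesis using x by (simp add: Br_apply supportedD)
    qed
  qed
  moreover have "Br Q a = 0"
    if Q: "p_subgroup p G Q" "Q \<subseteq> M" "\<forall>m \<in> M. \<not> conj_by G m ` Q \<subseteq> T" for Q
  proof (rule ccontr)
    have QG: "Q \<subseteq> carrier G" using Q by (simp add: p_subgroup_subset_carrier)
    assume "Br Q a \<noteq> 0"
    then obtain g where g: "g \<in> cent Q" "a g \<noteq> 0" by (auto simp: fun_eq_iff Br_apply zero_fun_apply split: if_splits)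
    then have gG: "g \<in> carrier G" using centralizer_subset by blast
    from g obtain m where m: "m \<in> M" "x (conj_by G m g) \<noteq> 0" using val0 by blast
    have mG: "m \<in> carrier G" using m by auto
    have "p_subgroup p G (conj_by G m ` Q)" using Q mG by (simp add: p_subgroup_conj_by)
    moreover have "conj_by G m ` Q \<subseteq> M" using m Q(2) by (auto simp: conj_by_def)
    moreover have "conj_by G q (conj_by G m g) = conj_by G m g" if q: "q \<in> conj_by G m ` Q" for q
    proof -
      obtain u where u: "u \<in> Q" "q = conj_by G m u" using q by auto
      have uG: "u \<in> carrier G" using u QG by auto
      have "conj_by G u g = g" using g u QG by (simp add: mem_centralizer_iff)
      then have "u \<otimes> g = g \<otimes> u" using uG gG by (simp add: conj_by_fixed_iff)
      then have "q \<otimes> conj_by G m g = conj_by G m g \<otimes> q"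
        using u uG gG mG by (simp flip: conj_by_mult)
      then show ?thesis using u uG gG mG by (simp add: conj_by_fixed_iff)
    qed
    ultimately have "\<exists>d \<in> M. conj_by G d (conj_by G m g) = conj_by G m g \<and> conj_by G d ` conj_by G m ` Q \<subseteq> T"
      by (rule into[OF m(2)])
    then obtain d where d: "d \<in> M" "conj_by G d ` conj_by G m ` Q \<subseteq> T" by blast
    then have "conj_by G (d \<otimes> m) ` Q \<subseteq> T" using mG QG by (simp add: conj_by_image_conj_by)
    then show False using Q(3) d m by auto
  qed
  moreover have "\<exists>m \<in> M. conj_by G m g \<in> cent T" if "a g \<noteq> 0" for g
    using that val0 xc by blast
  ultimately show ?thesis using afix by blast
qed

section \<open>Brauer pairs\<close>

abbreviation is_block :: "'g set \<Rightarrow> ('g \<Rightarrow> 'k) \<Rightarrow> bool" where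
  "is_block T e \<equiv> primitive_in (central (cent T)) e"

lemma brauer_pair_iff: "brauer_pair p G (T, e) \<longleftrightarrow> p_subgroup p G T \<and> is_block T e"
  by (auto simp: brauer_pair_def block_idempotent_iff subgroup_centralizer p_subgroup_subset_carrier)

lemma block_supported: "is_block T e \<Longrightarrow> e \<in> supported (cent T)"
  by (auto dest!: primD(1) simp: central_def)

lemma block_supported_carrier: "is_block T e \<Longrightarrow> e \<in> supported (carrier G)"
  using block_supported supported_mono centralizer_subset by blast

lemma associated_iff:
  assumes "p_subgroup p G P" "is_block P e"
  shows "associated G i (P, e) \<longleftrightarrow>
    i \<in> fixed P \<and> i \<star> i = i \<and> e \<star> Br P i = Br P i \<and> Br P i \<noteq> 0"
proof -
  have "\<zero>\<^bsub>centralizer_algebra G P\<^esub> = (0 :: 'g \<Rightarrow> 'k)"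
    by (auto simp: group_algebra_def fun_eq_iff zero_fun_apply)
  moreover have "e \<otimes>\<^bsub>centralizer_algebra G P\<^esub> Br P i = e \<star> Br P i"
    using assms by (intro subgroup_algebra_mult subgroup_centralizer block_supported Br_supported p_subgroup_subset_carrier)
  ultimately show ?thesis by (simp add: associated_def idempotent_of_def)
qed

lemma Br_nonzero_mono: "Q \<subseteq> P \<Longrightarrow> Br P i \<noteq> 0 \<Longrightarrow> Br Q i \<noteq> 0"
  using Br_Br Br_zero by metis

lemma fixed_idem_mono: "primitive_in (fixed P) i \<Longrightarrow> Q \<subseteq> P \<Longrightarrow> i \<in> fixed Q \<and> i \<star> i = i"
  using fixed_mono primD by blast

text \<open>
  Since \<open>Br P\<close> factors through \<open>Br Q\<close>, the condition \<open>Br Q i \<noteq> 0\<close> follows from \<open>Br P i \<noteq> 0\<close>.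
\<close>
lemma brauer_le_iff:
  assumes "p_subgroup p G Q" "is_block Q f" "p_subgroup p G P" "is_block P e" "Q \<subseteq> P"
  shows "brauer_le p G (Q, f) (P, e) \<longleftrightarrow>
    (\<forall>i. primitive_in (fixed P) i \<longrightarrow> e \<star> Br P i = Br P i \<longrightarrow> Br P i \<noteq> 0 \<longrightarrow> f \<star> Br Q i = Br Q i)"
  using assms Br_nonzero_mono[OF assms(5)] fixed_idem_mono[OF _ assms(5)]
  by (auto simp: brauer_le_def brauer_pair_iff associated_iff prim_fixed_iff primD)

lemma brauer_leD:
  assumes "brauer_le p G (Q, f) (P, e)"
  shows "p_subgroup p G Q" "is_block Q f" "p_subgroup p G P" "is_block P e" "Q \<subseteq> P"
  using assms by (auto simp: brauer_le_def brauer_pair_iff)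

lemma prim_fixed_below:
  assumes P: "p_subgroup p G P" and i: "i \<in> fixed P" "i \<star> i = i" "Br P i \<noteq> 0"
  shows "\<exists>j. primitive_in (fixed P) j \<and> Br P j \<noteq> 0 \<and> j \<star> i = j \<and> i \<star> j = j"
  by (rule prim_below[where \<Phi> = "\<lambda>i. Br P i \<noteq> 0", OF _ i]) (auto simp: Br_add)

text \<open>
  The block \<open>e\<close> is itself a \<open>P\<close>-fixed idempotent of the group algebra of \<open>G\<close> with \<open>Br P e = e\<close>, so a
  primitive idempotent below it will do.
\<close>
lemma exists_associated:
  assumes P: "p_subgroup p G P" and e: "is_block P e"
  shows "\<exists>i. primitive_in (fixed P) i \<and> e \<star> Br P i = Br P i \<and> Br P i \<noteq> 0"
proof -
  have ef: "e \<in> fixed P"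
    using supported_centralizer_fixed[OF p_subgroup_imp_subgroup[OF P] block_supported[OF e]] .
  have Be: "Br P e = e" using Br_id[OF block_supported[OF e]] .
  obtain i where i: "primitive_in (fixed P) i" "Br P i \<noteq> 0" "e \<star> i = i"
    using prim_fixed_below[OF P ef primD(2)[OF e]] Be primD(3)[OF e] by auto
  then have "Br P (e \<star> i) = Br P i" by simp
  then have "e \<star> Br P i = Br P i" using Br_conv[OF P ef primD(1)[OF i(1)]] Be by simp
  with i show ?thesis by blast
qed

lemma blocks_eqI:
  assumes T: "T \<subseteq> carrier G" and e: "is_block T e" and f: "is_block T f"
    and a: "e \<star> a = a" "f \<star> a = a" "a \<noteq> 0"
  shows "e = f"
proof (rule blocks_orthogonal[OF subgroup_centralizer[OF T] e f])
  have "e \<star> f \<star> a = a" using a by (simp add: conv_assoc)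
  then show "e \<star> f \<noteq> 0" using a by auto
qed

lemma brauer_le_unique:
  fixes e f f' :: "'g \<Rightarrow> 'k"
  assumes f: "brauer_le p G (Q, f) (P, e)" and f': "brauer_le p G (Q, f') (P, e)"
  shows "f = f'"
proof -
  note le = brauer_leD[OF f] and f'b = brauer_leD(2)[OF f']
  obtain i where i: "primitive_in (fixed P) i" "e \<star> Br P i = Br P i" "Br P i \<noteq> 0"
    using exists_associated[OF le(3,4)] by blast
  have "f \<star> Br Q i = Br Q i" using f i brauer_le_iff[OF le] by blast
  moreover have "f' \<star> Br Q i = Br Q i" using f' i brauer_le_iff[OF le(1) f'b le(3-5)] by blast
  ultimately show ?thesis
    using Br_nonzero_mono[OF le(5) i(3)] blocks_eqI[OF p_subgroup_subset_carrier[OF le(1)] le(2) f'b] by blast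
qed

lemma Br_idem: "p_subgroup p G P \<Longrightarrow> i \<in> fixed P \<Longrightarrow> i \<star> i = i \<Longrightarrow> Br P i \<star> Br P i = Br P i"
  using Br_conv by metis

text \<open>
  An element of the group algebra of the centralizer of \<open>N\<close> is its own image under \<open>Br N\<close>, so commuting with it is
  preserved.
\<close>
lemma Br_central:
  assumes N: "p_subgroup p G N" and T: "T \<subseteq> N" and z: "z \<in> central (cent T)" "z \<in> fixed N"
  shows "Br N z \<in> central (cent N)"
  unfolding central_def
proof (intro CollectI conjI ballI)
  fix a assume a: "a \<in> supported (cent N)"
  have af: "a \<in> fixed N" using supported_centralizer_fixed[OF p_subgroup_imp_subgroup[OF N] a] .
  have "a \<in> supported (cent T)" using a supported_mono centralizer_mono[OF T] by blast
  then have "z \<star> a = a \<star> z" by (rule central_commute[OF z(1)])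
  then have "Br N z \<star> Br N a = Br N a \<star> Br N z" using Br_conv[OF N] z af by metis
  then show "Br N z \<star> a = a \<star> Br N z" using Br_id[OF a] by simp
qed simp

lemma Br_fixed_normal:
  assumes "N \<subseteq> carrier G" "T \<subseteq> carrier G" "\<And>n. n \<in> N \<Longrightarrow> conj_by G n ` T = T" and a: "a \<in> fixed N"
  shows "Br T a \<in> fixed N"
  using assms by (auto simp: fixed_def Br_conj subset_iff)

lemma ga_conj_in_fixed:
  assumes x: "x \<in> carrier G" and M: "M \<subseteq> carrier G" and a: "a \<in> fixed M"
  shows "ga_conj G x a \<in> fixed (conj_by G x ` M)"
  unfolding fixed_def
proof (intro CollectI conjI ballI)
  fix y assume "y \<in> conj_by G x ` M"
  then obtain m where m: "m \<in> M" "y = conj_by G x m" by auto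
  have mG: "m \<in> carrier G" using m M by auto
  have "ga_conj G y (ga_conj G x a) = ga_conj G x (ga_conj G m a)"
    using m mG x by (simp add: ga_conj_ga_conj) (simp add: conj_by_def m_assoc)
  then show "ga_conj G y (ga_conj G x a) = ga_conj G x a" using a m by (simp add: fixed_conj)
qed simp

lemma conj_image_inv:
  assumes "x \<in> carrier G" "A \<subseteq> carrier G"
  shows "conj_by G (inv x) ` conj_by G x ` A = A" "conj_by G x ` conj_by G (inv x) ` A = A"
  using assms by (simp_all add: conj_by_image_conj_by conj_by_image_one)

lemma prim_conj:
  assumes x: "x \<in> carrier G" and S: "S \<subseteq> supported (carrier G)" "S' \<subseteq> supported (carrier G)"
    and e: "primitive_in S e" and e': "ga_conj G x e \<in> S'" and inv: "\<And>b. b \<in> S' \<Longrightarrow> ga_conj G (inv x) b \<in> S"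
  shows "primitive_in S' (ga_conj G x e)"
  unfolding primitive_in_def
proof (intro conjI allI impI)
  have eS: "e \<in> supported (carrier G)" using e S primD(1) by blast
  show "ga_conj G x e \<in> S'" by fact
  show "ga_conj G x e \<star> ga_conj G x e = ga_conj G x e"
    using primD(2)[OF e] ga_conj_conv[OF x] by metis
  show "ga_conj G x e \<noteq> 0" using primD(3)[OF e] ga_conj_eq_0_iff[OF x eS] by simp
  fix j l assume jl: "j \<in> S'" "l \<in> S'" "j \<star> j = j" "l \<star> l = l" "j \<star> l = 0" "l \<star> j = 0" "ga_conj G x e = j + l"
  let ?c = "ga_conj G (inv x) :: ('g \<Rightarrow> 'k) \<Rightarrow> _"
  have ix: "inv x \<in> carrier G" using x by simp
  note cc = ga_conj_conv[OF ix, symmetric]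
  have "e = ?c (ga_conj G x e)" using x eS by simp
  then have "e = ?c j + ?c l" unfolding jl(7) by (simp add: ga_conj_add)
  moreover have "?c j \<star> ?c j = ?c j" "?c l \<star> ?c l = ?c l" "?c j \<star> ?c l = 0" "?c l \<star> ?c j = 0"
    using jl by (simp_all add: cc)
  ultimately have "?c j = 0 \<or> ?c l = 0" using e inv[OF jl(1)] inv[OF jl(2)] unfolding primitive_in_def by blast
  then show "j = 0 \<or> l = 0" using ga_conj_eq_0_iff[OF ix] jl S by blast
qed

lemma prim_fixed_conj:
  assumes x: "x \<in> carrier G" and M: "M \<subseteq> carrier G" and i: "primitive_in (fixed M) i"
  shows "primitive_in (fixed (conj_by G x ` M)) (ga_conj G x i)"
proof (rule prim_conj[OF x _ _ i])
  show "ga_conj G x i \<in> fixed (conj_by G x ` M)" by (rule ga_conj_in_fixed[OF x M primD(1)[OF i]])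
  fix b assume "b \<in> fixed (conj_by G x ` M)"
  from ga_conj_in_fixed[OF _ _ this, of "inv x"] show "ga_conj G (inv x) b \<in> fixed M"
    using x M by (simp add: conj_image_inv conj_by_image_subset)
qed auto

lemma central_conj:
  assumes x: "x \<in> carrier G" and C: "subgroup C G" and z: "z \<in> central C"
  shows "ga_conj G x z \<in> central (conj_by G x ` C)"
  using z ga_conj_in_fixed[OF x subgroup.subset[OF C]] ga_conj_supported[OF x _ subgroup.subset[OF C]]
  by (auto simp: central_eq C subgroup_conj_by x)

lemma block_conj:
  assumes x: "x \<in> carrier G" and T: "T \<subseteq> carrier G" and e: "is_block T e"
  shows "is_block (conj_by G x ` T) (ga_conj G x e)"
proof (rule prim_conj[OF x _ _ e])
  have sub: "central (cent S) \<subseteq> supported (carrier G)" for S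
    using supported_mono[OF centralizer_subset] by (auto simp: central_def)
  show "central (cent T) \<subseteq> supported (carrier G)" "central (cent (conj_by G x ` T)) \<subseteq> supported (carrier G)"
    by (rule sub)+
  show "ga_conj G x e \<in> central (cent (conj_by G x ` T))"
    using central_conj[OF x subgroup_centralizer[OF T] primD(1)[OF e]] by (simp add: centralizer_conj_by x T)
  fix b assume "b \<in> central (cent (conj_by G x ` T))"
  from central_conj[OF _ subgroup_centralizer this, of "inv x"]
  have "ga_conj G (inv x) b \<in> central (cent (conj_by G (inv x) ` conj_by G x ` T))"
    using x T by (simp add: centralizer_conj_by conj_by_image_subset)
  then show "ga_conj G (inv x) b \<in> central (cent T)" using x T by (simp add: conj_image_inv)
qed

text \<open>
  The coefficients at \<open>N\<close>-fixed group elements are constant on \<open>N\<close>-orbits of \<open>F\<close>.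
\<close>
lemma Br_sum_stable:
  assumes N: "p_subgroup p G N" and F: "finite F" "F \<subseteq> supported (carrier G)"
    and stable: "\<And>n e. n \<in> N \<Longrightarrow> e \<in> F \<Longrightarrow> ga_conj G n e \<in> F"
  shows "Br N (\<Sum>F) = (\<Sum>e \<in> {e \<in> F. e \<in> fixed N}. Br N e)"
proof
  fix g
  have NG: "N \<subseteq> carrier G" using N by (rule p_subgroup_subset_carrier)
  show "Br N (\<Sum>F) g = (\<Sum>e \<in> {e \<in> F. e \<in> fixed N}. Br N e) g"
  proof (cases "g \<in> cent N")
    case True
    then have gG: "g \<in> carrier G" using centralizer_subset by blast
    have inv: "conj_by G n g = g" if "n \<in> N" for n using True that by (simp add: mem_centralizer_iff NG)
    have "\<exists>r. (\<Sum>e \<in> F. e g) = (\<Sum>e \<in> {e \<in> F. \<forall>n \<in> N. ga_conj G n e = e}. e g) + of_nat p * r"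
    proof (rule p_group_action_sum[OF N prime_p F(1) stable])
      show "ga_conj G \<one> e = e" if "e \<in> F" for e using that F by auto
      show "ga_conj G (n \<otimes> m) e = ga_conj G n (ga_conj G m e)" if "n \<in> N" "m \<in> N"
          for n m and e :: "'g \<Rightarrow> 'k"
        using that NG by (simp add: ga_conj_ga_conj subset_iff)
      show "ga_conj G n e g = e g" if "n \<in> N" for n and e :: "'g \<Rightarrow> 'k"
        using that NG gG inv[of "inv n"] subgroup.m_inv_closed[OF p_subgroup_imp_subgroup[OF N]]
        by (simp add: ga_conj_apply subset_iff)
    qed
    moreover have "{e \<in> F. \<forall>n \<in> N. ga_conj G n e = e} = {e \<in> F. e \<in> fixed N}"
      using F by (auto simp: fixed_def)
    ultimately show ?thesis using True by (simp add: Br_apply sum_fun_apply)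
  next
    case False then show ?thesis by (simp add: Br_apply sum_fun_apply)
  qed
qed

text \<open>
  Applying \<open>Br N\<close> to the decomposition of \<open>1\<close> into blocks kills the blocks that \<open>N\<close> moves.
\<close>
lemma exists_normal_block:
  assumes N: "p_subgroup p G N" "is_block N e" and T: "T \<subseteq> N"
    and norm: "\<And>n. n \<in> N \<Longrightarrow> conj_by G n ` T = T"
  shows "\<exists>f. is_block T f \<and> f \<in> fixed N \<and> Br N f \<star> e = e"
proof -
  let ?B = "{f. is_block T f}"
  have NG: "N \<subseteq> carrier G" using N by (simp add: p_subgroup_subset_carrier)
  then have TG: "T \<subseteq> carrier G" using T by blast
  note sb = sum_blocks[OF subgroup_centralizer[OF TG]]
  have "Br N (\<Sum>?B) = (\<Sum>f \<in> {f \<in> ?B. f \<in> fixed N}. Br N f)"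
  proof (rule Br_sum_stable[OF N(1) sb(1)])
    show "?B \<subseteq> supported (carrier G)" using block_supported_carrier by blast
    show "ga_conj G n f \<in> ?B" if "n \<in> N" "f \<in> ?B" for n f
      using that block_conj[of n T f] NG TG norm by auto
  qed
  then have u: "unit = (\<Sum>f \<in> {f \<in> ?B. f \<in> fixed N}. Br N f)" using sb(2) NG by simp
  have "e = unit \<star> e" using block_supported_carrier[OF N(2)] by simp
  also have "\<dots> = (\<Sum>f \<in> {f \<in> ?B. f \<in> fixed N}. Br N f \<star> e)" unfolding u by (rule conv_sum_left)
  finally have "\<exists>f \<in> {f \<in> ?B. f \<in> fixed N}. Br N f \<star> e \<noteq> 0"
    using primD(3)[OF N(2)] by (metis (no_types, lifting) sum.neutral)
  then obtain f where f: "is_block T f" "f \<in> fixed N" "Br N f \<star> e \<noteq> 0" by blast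
  then have "Br N f \<star> e = e"
    using block_dichotomy[OF subgroup_centralizer[OF NG] N(2) Br_central[OF N(1) T primD(1)[OF f(1)] f(2)]
        Br_idem[OF N(1) f(2) primD(2)[OF f(1)]]] by blast
  with f show ?thesis by blast
qed

lemma conv_pow_idem: "x \<in> supported (carrier G) \<Longrightarrow> x \<star> x = x \<Longrightarrow> n \<ge> 1 \<Longrightarrow> conv_pow x n = x"
proof (induction n)
  case (Suc n) then show ?case by (cases n) (simp_all add: conv_pow_1 conv_pow_Suc)
qed simp

lemma Br_conv_pow:
  assumes T: "p_subgroup p G T" and z: "z \<in> fixed T"
  shows "n \<ge> 1 \<Longrightarrow> Br T (conv_pow z n) = conv_pow (Br T z) n"
proof (induction n)
  case (Suc n)
  have alg: "subalgebra (fixed T)" using T by (simp add: subalgebra_fixed p_subgroup_subset_carrier)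
  show ?case
  proof (cases n)
    case 0 then show ?thesis using z fixed_supported by (auto simp: conv_pow_1)
  next
    case (Suc m)
    then have "conv_pow z n \<in> fixed T" using conv_pow_subalgebra[OF alg z] by simp
    then have "Br T (z \<star> conv_pow z n) = Br T z \<star> Br T (conv_pow z n)" by (rule Br_conv[OF T z])
    then show ?thesis using Suc Suc.IH by (simp add: conv_pow_Suc)
  qed
qed simp

section \<open>The partial order on Brauer pairs\<close>

text \<open>
  Induction on the index of \<open>T\<close> in \<open>P\<close>. Let \<open>N\<close> be the normalizer of \<open>T\<close> in \<open>P\<close>, which is larger than
  \<open>T\<close>, and let \<open>f\<close> be the \<open>N\<close>-stable block below the block of \<open>N\<close> given by induction. For a
  primitive idempotent \<open>i\<close> associated to \<open>(P, e)\<close> the claim is that the rest \<open>x = Br T i \<star> (1 - f)\<close>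
  vanishes. Every subgroup \<open>X\<close> of \<open>N\<close> larger than \<open>T\<close> satisfies \<open>Br X x = 0\<close>, so \<open>x\<close> lifts to an
  element \<open>a\<close> with \<open>Br P a = 0\<close>. Since \<open>Br P i \<noteq> 0\<close> and \<open>i\<close> is primitive, \<open>i \<star> a \<star> i\<close> is
  nilpotent, and so is its image \<open>x\<close>, which is an idempotent.
\<close>
lemma exists_brauer_le:
  assumes P: "p_subgroup p G P" "is_block P e"
  shows "subgroup T G \<Longrightarrow> T \<subseteq> P \<Longrightarrow> \<exists>f. brauer_le p G (T, f) (P, e)"
proof (induction "card P - card T" arbitrary: T rule: less_induct)
  case (less T)
  have sP: "subgroup P G" and PG: "P \<subseteq> carrier G"
    using P by (auto simp: p_subgroup_imp_subgroup p_subgroup_subset_carrier)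
  have finP: "finite P" using PG finite_carrier finite_subset by blast
  have T: "p_subgroup p G T" using p_subgroup_subgroup[OF P(1) prime_p less.prems] .
  have TG: "T \<subseteq> carrier G" using less.prems PG by blast
  have refl: "brauer_le p G (P, e) (P, e)" using P by (simp add: brauer_le_iff)
  show ?case
  proof (cases "T = P")
    case True then show ?thesis using refl by blast
  next
    case False
    then have TP: "T \<subset> P" using less.prems by blast
    have IH: "\<exists>g. brauer_le p G (X, g) (P, e)" if "p_subgroup p G X" "T \<subset> X" "X \<subseteq> P" for X
    proof (rule less.hyps)
      have "card T < card X" "card X \<le> card P"
        using that finP by (auto intro!: psubset_card_mono card_mono intro: finite_subset)
      then show "card P - card X < card P - card T" by simp
    qed (use that in \<open>auto simp: p_subgroup_imp_subgroup\<close>)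
    let ?N = "normalizer_in P T"
    have sN: "subgroup ?N G" using sP TG by (rule subgroup_normalizer_in)
    have NP: "?N \<subseteq> P" by auto
    have N: "p_subgroup p G ?N" using p_subgroup_subgroup[OF P(1) prime_p sN NP] .
    have NG: "?N \<subseteq> carrier G" using PG by auto
    have TN': "T \<subseteq> ?N" by (rule subset_normalizer_in[OF less.prems])
    moreover obtain m where "m \<in> P - T" "conj_by G m ` T = T"
      using p_subgroup_normalizer_grows[OF T P(1) finP TP prime_p] by blast
    ultimately have TN: "T \<subset> ?N" by blast
    obtain eN where eN: "brauer_le p G (?N, eN) (P, e)" using IH[OF N TN NP] by blast
    obtain f where f: "is_block T f" "f \<in> fixed ?N" "Br ?N f \<star> eN = eN"
      using exists_normal_block[OF brauer_leD(1,2)[OF eN] TN'] by blast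
    have sC: "subgroup (cent T) G" using TG by (rule subgroup_centralizer)
    have fc: "f \<in> central (cent T)" "f \<star> f = f" using f(1) by (auto dest: primD)
    have fs: "f \<in> supported (carrier G)" using f(1) by (rule block_supported_carrier)
    have "f \<star> Br T i = Br T i" if i: "primitive_in (fixed P) i" "e \<star> Br P i = Br P i" "Br P i \<noteq> 0" for i
    proof -
      have iP: "i \<in> fixed P" "i \<star> i = i" using i(1) by (auto dest: primD)
      define s where "s = unit - f"
      define x where "x = Br T i \<star> s"
      have iN: "i \<in> fixed ?N" using fixed_mono[OF NP iP(1)] .
      have iT: "i \<in> fixed T" using fixed_mono[OF less.prems(2) iP(1)] .
      have bN: "Br T i \<in> fixed ?N" using Br_fixed_normal[OF NG TG _ iN] by auto
      have bb: "Br T i \<star> Br T i = Br T i" using Br_idem[OF T iT iP(2)] .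
      have uN: "unit \<in> fixed ?N"
        using supported_centralizer_fixed[OF sN, of unit] subgroup.one_closed[OF subgroup_centralizer[OF NG]] by auto
      have alg: "subalgebra (fixed ?N)" using NG by (rule subalgebra_fixed)
      have sfix: "s \<in> fixed ?N" unfolding s_def by (rule subalgebra_diff[OF alg uN f(2)])
      have sc: "s \<in> central (cent T)"
        unfolding s_def by (rule subalgebra_diff[OF subalgebra_central[OF sC] unit_central[OF sC] fc(1)])
      have ss: "s \<star> s = s" using fs fc by (simp add: s_def conv_diff_left conv_diff_right unit_in_supported)
      have comm: "s \<star> Br T i = Br T i \<star> s" using central_commute[OF sc Br_supported] .
      have xsup: "x \<in> supported (cent T)"
        unfolding x_def by (rule supported_conv[OF sC Br_supported central_supported[OF sc]])
      have xfix: "x \<in> fixed ?N" unfolding x_def by (rule subalgebraD(5)[OF alg bN sfix])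
      have xx: "x \<star> x = x" unfolding x_def by (metis bb comm conv_assoc ss)
      have bx: "Br T i \<star> x = x" "x \<star> Br T i = x" unfolding x_def by (metis bb comm conv_assoc)+
      have "Br X x = 0" if X: "p_subgroup p G X" "T \<subset> X" "X \<subseteq> ?N" for X
      proof -
        have TX: "T \<subseteq> X" and XP: "X \<subseteq> P" using X by auto
        have XG: "X \<subseteq> carrier G" using X(1) by (rule p_subgroup_subset_carrier)
        obtain eX where eX: "brauer_le p G (X, eX) (P, e)" using IH[OF X(1,2) XP] by blast
        have ei: "eX \<star> Br X i = Br X i" "eN \<star> Br ?N i = Br ?N i"
          using i eX eN brauer_le_iff[OF brauer_leD[OF eX]] brauer_le_iff[OF brauer_leD[OF eN]] by blast+
        note fX = fixed_mono[OF X(3)]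
        have fXc: "Br X f \<in> central (cent X)" "Br X f \<star> Br X f = Br X f"
          using Br_central[OF X(1) TX fc(1) fX[OF f(2)]] Br_idem[OF X(1) fX[OF f(2)] fc(2)] by auto
        have fi: "Br X f \<star> Br X i = Br X (f \<star> Br T i)"
          using Br_conv[OF X(1) fX[OF f(2)] fX[OF bN]] Br_Br[OF TX] by simp
        have "Br X f \<star> eX \<noteq> 0"
        proof
          assume z: "Br X f \<star> eX = 0"
          have "Br X f \<star> Br X i = Br X f \<star> eX \<star> Br X i" using ei by (simp add: conv_assoc)
          then have "Br X (f \<star> Br T i) = 0" using z fi by simp
          then have "Br ?N (f \<star> Br T i) = 0" using Br_Br[OF X(3), of "f \<star> Br T i"] by simp
          moreover have "Br ?N (f \<star> Br T i) = Br ?N f \<star> Br ?N i"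
            using Br_conv[OF N f(2) bN] Br_Br[OF TN'] by simp
          moreover have "Br ?N f \<star> Br ?N i = Br ?N f \<star> eN \<star> Br ?N i" using ei by (simp add: conv_assoc)
          ultimately have "Br ?N i = 0" using ei f(3) by simp
          then show False using Br_nonzero_mono[OF NP i(3)] by simp
        qed
        then have "Br X f \<star> eX = eX"
          using block_dichotomy[OF subgroup_centralizer[OF XG] brauer_leD(2)[OF eX] fXc] by blast
        then have "Br X f \<star> Br X i = Br X i" using ei by (metis conv_assoc)
        then have "Br X i \<star> Br X f = Br X i" using central_commute[OF fXc(1) Br_supported] by simp
        moreover have "Br X x = Br X i \<star> Br X s"
          unfolding x_def using Br_conv[OF X(1) fX[OF bN] fX[OF sfix]] Br_Br[OF TX] by simp
        moreover have "Br X s = unit - Br X f" using XG by (simp add: s_def Br_diff)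
        ultimately show ?thesis by (simp add: conv_diff_right)
      qed
      then obtain a where a: "a \<in> fixed P" "Br T a = x"
        and aQ: "\<And>Q. p_subgroup p G Q \<Longrightarrow> Q \<subseteq> P \<Longrightarrow> \<forall>m \<in> P. \<not> conj_by G m ` Q \<subseteq> T \<Longrightarrow> Br Q a = 0"
        using lift_stable[OF sP T less.prems(2) xsup xfix] by blast
      have "\<not> conj_by G m ` P \<subseteq> T" if "m \<in> P" for m
      proof
        assume "conj_by G m ` P \<subseteq> T"
        moreover have "finite T" using TP finP finite_subset by blast
        ultimately have "card (conj_by G m ` P) \<le> card T" by (intro card_mono)
        then have "card P \<le> card T" using card_conj_by[of m P] PG that by auto
        then show False using psubset_card_mono[OF finP TP] by simp
      qed
      then have aP: "Br P a = 0" using aQ[OF P(1)] by auto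
      \<comment> \<open>the kernel of \<open>Br P\<close> in the corner of \<open>i\<close>, an ideal that does not contain \<open>i\<close>\<close>
      define S where "S = {b \<in> fixed P. Br P b = 0 \<and> i \<star> b = b \<and> b \<star> i = b}"
      have algP: "subalgebra (fixed P)" using PG by (rule subalgebra_fixed)
      have algS: "subalgebra S"
        unfolding subalgebra_def
      proof (intro conjI ballI allI)
        show "S \<subseteq> supported (carrier G)" by (auto simp: S_def)
        show "0 \<in> S" using algP by (auto simp: S_def subalgebraD)
        show "b + c \<in> S" if "b \<in> S" "c \<in> S" for b c
          using that algP by (auto simp: S_def subalgebraD Br_add conv_add_left conv_add_right)
        show "scale r b \<in> S" if "b \<in> S" for r b
          using that algP by (auto simp: S_def subalgebraD Br_scale conv_scale_left conv_scale_right)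
        show "b \<star> c \<in> S" if "b \<in> S" "c \<in> S" for b c
        proof -
          have "Br P (b \<star> c) = 0" using that Br_conv[OF P(1), of b c] by (simp add: S_def)
          moreover have "i \<star> (b \<star> c) = b \<star> c" using that by (simp add: S_def flip: conv_assoc)
          ultimately show ?thesis using that algP by (simp add: S_def subalgebraD conv_assoc)
        qed
      qed
      define z where "z = i \<star> a \<star> i"
      have ia: "i \<star> a \<in> fixed P" using algP iP a by (simp add: subalgebraD)
      have zP: "z \<in> fixed P" unfolding z_def using algP iP ia by (simp add: subalgebraD)
      have "Br P z = 0"
        unfolding z_def using Br_conv[OF P(1) ia iP(1)] Br_conv[OF P(1) iP(1) a(1)] aP by simp
      moreover have "i \<star> z = z" "z \<star> i = z" unfolding z_def by (metis conv_assoc iP(2))+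
      ultimately have zS: "z \<in> S" using zP by (simp add: S_def)
      have "Br T z = Br T (i \<star> a) \<star> Br T i"
        unfolding z_def using Br_conv[OF T] fixed_mono[OF less.prems(2)] ia iT by blast
      also have "Br T (i \<star> a) = Br T i \<star> Br T a"
        using Br_conv[OF T iT] fixed_mono[OF less.prems(2) a(1)] by blast
      finally have Bz: "Br T z = x" using a bx by simp
      have no: "w = 0" if w: "w \<in> S" "w \<star> w = w" for w
      proof (rule ccontr)
        assume "w \<noteq> 0"
        have "i = w + (i - w)" by simp
        moreover have "w \<in> fixed P" "i - w \<in> fixed P" "w \<star> (i - w) = 0" "(i - w) \<star> w = 0"
          "(i - w) \<star> (i - w) = i - w"
          using w iP subalgebra_diff[OF algP iP(1)] by (auto simp: S_def conv_diff_left conv_diff_right)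
        ultimately have "i - w = 0" using i(1) w \<open>w \<noteq> 0\<close> unfolding primitive_in_def by blast
        then have "i = w" by simp
        then show False using w i(3) by (simp add: S_def)
      qed
      have "\<exists>n \<ge> 1. conv_pow z n = 0"
      proof (rule ccontr)
        assume "\<not> ?thesis"
        then obtain h where "h \<in> S" "(z \<star> h) \<star> (z \<star> h) = z \<star> h" "z \<star> h \<noteq> 0"
          using power_idempotent[OF algS zS] by blast
        then show False using no[of "z \<star> h"] algS zS by (simp add: subalgebraD)
      qed
      then obtain n where n: "n \<ge> 1" "conv_pow z n = 0" by blast
      have "x = conv_pow x n" using conv_pow_idem[OF _ xx n(1)] xfix fixed_supported by simp
      also have "\<dots> = Br T (conv_pow z n)" using Br_conv_pow[OF T fixed_mono[OF less.prems(2) zP] n(1)] Bz by simp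
      finally have "x = 0" using n by simp
      then have "Br T i - Br T i \<star> f = 0" by (simp add: x_def s_def conv_diff_right)
      then show ?thesis using central_commute[OF fc(1) Br_supported] by simp
    qed
    then have "brauer_le p G (T, f) (P, e)"
      using T f(1) P less.prems by (subst brauer_le_iff) auto
    then show ?thesis by blast
  qed
qed

lemma brauer_le_refl:
  "p_subgroup p G P \<Longrightarrow> is_block P e \<Longrightarrow> brauer_le p G (P, e) (P, e)"
  by (simp add: brauer_le_iff)

text \<open>
  Compare \<open>f\<close> with the block \<open>f'\<close> of \<open>Q\<close> below \<open>(P, e)\<close>: a primitive idempotent associated to \<open>(P, e)\<close>
  has a summand that is associated to \<open>(R, g)\<close>, and on that summand both \<open>f\<close> and \<open>f'\<close> act as the identity.
\<close>
lemma brauer_le_trans: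
  fixes e f g :: "'g \<Rightarrow> 'k"
  assumes QR: "brauer_le p G (Q, f) (R, g)" and RP: "brauer_le p G (R, g) (P, e)"
  shows "brauer_le p G (Q, f) (P, e)"
proof -
  note l1 = brauer_leD[OF QR] and l2 = brauer_leD[OF RP]
  have QP: "Q \<subseteq> P" using l1 l2 by blast
  obtain f' where f': "brauer_le p G (Q, f') (P, e)"
    using exists_brauer_le[OF l2(3,4) p_subgroup_imp_subgroup[OF l1(1)] QP] by blast
  note l3 = brauer_leD[OF f']
  obtain i where i: "primitive_in (fixed P) i" "e \<star> Br P i = Br P i" "Br P i \<noteq> 0"
    using exists_associated[OF l2(3,4)] by blast
  have iR: "i \<in> fixed R" "i \<star> i = i" "i \<in> fixed Q"
    using fixed_idem_mono[OF i(1) l2(5)] fixed_idem_mono[OF i(1) QP] by auto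
  have gi: "g \<star> Br R i = Br R i" using RP i brauer_le_iff[OF l2] by blast
  obtain j where j: "primitive_in (fixed R) j" "Br R j \<noteq> 0" "i \<star> j = j"
    using prim_fixed_below[OF l2(1) iR(1,2) Br_nonzero_mono[OF l2(5) i(3)]] by blast
  have "Br R i \<star> Br R j = Br R j" using Br_conv[OF l2(1) iR(1) primD(1)[OF j(1)]] j(3) by simp
  then have "g \<star> Br R j = Br R j" using gi by (metis conv_assoc)
  then have "f \<star> Br Q j = Br Q j" using QR j brauer_le_iff[OF l1] by blast
  moreover have "f' \<star> Br Q j = Br Q j"
  proof -
    have "f' \<star> Br Q i = Br Q i" using f' i brauer_le_iff[OF l3] by blast
    moreover have "Br Q i \<star> Br Q j = Br Q j"
      using Br_conv[OF l1(1) iR(3) fixed_mono[OF l1(5) primD(1)[OF j(1)]]] j(3) by simp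
    ultimately show ?thesis by (metis conv_assoc)
  qed
  moreover have "Br Q j \<noteq> 0" using Br_nonzero_mono[OF l1(5) j(2)] .
  ultimately have "f = f'" using blocks_eqI[OF p_subgroup_subset_carrier[OF l1(1)] l1(2) l3(2)] by blast
  then show ?thesis using f' by simp
qed

lemma brauer_le_conj:
  fixes e f :: "'g \<Rightarrow> 'k"
  assumes x: "x \<in> carrier G" and le: "brauer_le p G (Q, f) (P, e)"
  shows "brauer_le p G (conj_by G x ` Q, ga_conj G x f) (conj_by G x ` P, ga_conj G x e)"
proof -
  note l = brauer_leD[OF le]
  have QG: "Q \<subseteq> carrier G" and PG: "P \<subseteq> carrier G" using l p_subgroup_subset_carrier by auto
  have ix: "inv x \<in> carrier G" using x by simp
  show ?thesis
  proof (subst brauer_le_iff)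
    show "p_subgroup p G (conj_by G x ` Q)" "p_subgroup p G (conj_by G x ` P)"
      using l x by (simp_all add: p_subgroup_conj_by)
    show "is_block (conj_by G x ` Q) (ga_conj G x f)" "is_block (conj_by G x ` P) (ga_conj G x e)"
      using l x QG PG by (simp_all add: block_conj)
    show "conj_by G x ` Q \<subseteq> conj_by G x ` P" using l by blast
    show "\<forall>i. primitive_in (fixed (conj_by G x ` P)) i \<longrightarrow>
       ga_conj G x e \<star> Br (conj_by G x ` P) i = Br (conj_by G x ` P) i \<longrightarrow> Br (conj_by G x ` P) i \<noteq> 0 \<longrightarrow>
       ga_conj G x f \<star> Br (conj_by G x ` Q) i = Br (conj_by G x ` Q) i"
    proof (intro allI impI)
      fix i assume i: "primitive_in (fixed (conj_by G x ` P)) i"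
        "ga_conj G x e \<star> Br (conj_by G x ` P) i = Br (conj_by G x ` P) i" "Br (conj_by G x ` P) i \<noteq> 0"
      define j where "j = ga_conj G (inv x) i"
      have isup: "i \<in> supported (carrier G)" using primD(1)[OF i(1)] by blast
      have ij: "i = ga_conj G x j" using isup x by (simp add: j_def)
      have "primitive_in (fixed (conj_by G (inv x) ` conj_by G x ` P)) j"
        unfolding j_def by (rule prim_fixed_conj[OF ix _ i(1)]) (use x PG in auto)
      then have j: "primitive_in (fixed P) j" using x PG by (simp add: conj_image_inv)
      have BP: "Br (conj_by G x ` P) i = ga_conj G x (Br P j)" using Br_conj[OF x PG] ij by simp
      have BQ: "Br (conj_by G x ` Q) i = ga_conj G x (Br Q j)" using Br_conj[OF x QG] ij by simp
      have "ga_conj G x (e \<star> Br P j) = ga_conj G x (Br P j)" using i(2) BP ga_conj_conv[OF x] by simp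
      then have "e \<star> Br P j = Br P j" using ga_conj_inv(1)[OF x] by (metis Br_supported_carrier conv_supported_carrier)
      moreover have "Br P j \<noteq> 0" using i(3) BP by auto
      ultimately have "f \<star> Br Q j = Br Q j" using le j brauer_le_iff[OF l] by blast
      then show "ga_conj G x f \<star> Br (conj_by G x ` Q) i = Br (conj_by G x ` Q) i"
        using BQ ga_conj_conv[OF x] by metis
    qed
  qed
qed

lemma block_fixed:
  assumes "T \<subseteq> carrier G" "is_block T e"
  shows "e \<in> fixed (cent T)"
  using primD(1)[OF assms(2)] by (simp add: central_eq subgroup_centralizer assms(1))

text \<open>
  Conjugation by \<open>N\<close> fixes \<open>(N, e)\<close>, hence by uniqueness also the pair \<open>(T, f)\<close> below it. The two central
  idempotents \<open>Br N f\<close> and \<open>e\<close> cannot be orthogonal, because both act as the identity on \<open>Br N i\<close> for an associated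
  idempotent \<open>i\<close>.
\<close>
lemma brauer_le_normal:
  assumes le: "brauer_le p G (T, f) (N, e)" and norm: "\<And>n. n \<in> N \<Longrightarrow> conj_by G n ` T = T"
  shows "f \<in> fixed N" "Br N f \<star> e = e"
proof -
  note l = brauer_leD[OF le]
  have NG: "N \<subseteq> carrier G" and TG: "T \<subseteq> carrier G" using l p_subgroup_subset_carrier by auto
  have fs: "f \<in> supported (carrier G)" using l block_supported_carrier by auto
  have ef: "e \<in> fixed N"
    using supported_centralizer_fixed[OF p_subgroup_imp_subgroup[OF l(3)] block_supported[OF l(4)]] .
  have "ga_conj G n f = f" if n: "n \<in> N" for n
  proof -
    have nG: "n \<in> carrier G" using n NG by blast
    have "conj_by G n ` N = N"
      using subset_normalizer_in[OF p_subgroup_imp_subgroup[OF l(3)], of N] n by auto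
    then have "brauer_le p G (T, ga_conj G n f) (N, e)"
      using brauer_le_conj[OF nG le] norm[OF n] fixed_conj[OF ef n] by simp
    then show ?thesis using brauer_le_unique le by blast
  qed
  then show fN: "f \<in> fixed N" using fs by (simp add: fixed_def)
  obtain i where i: "primitive_in (fixed N) i" "e \<star> Br N i = Br N i" "Br N i \<noteq> 0"
    using exists_associated[OF l(3,4)] by blast
  have "f \<star> Br T i = Br T i" using le i brauer_le_iff[OF l] by blast
  moreover have "Br T i \<in> fixed N" using Br_fixed_normal[OF NG TG norm primD(1)[OF i(1)]] .
  ultimately have fi: "Br N f \<star> Br N i = Br N i" using Br_conv[OF l(3) fN] Br_Br[OF l(5)] by metis
  have "Br N f \<star> e \<noteq> 0"
  proof
    assume "Br N f \<star> e = 0"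
    then have "Br N f \<star> (e \<star> Br N i) = 0" by (simp flip: conv_assoc)
    then show False using i fi by simp
  qed
  then show "Br N f \<star> e = e"
    using block_dichotomy[OF subgroup_centralizer[OF NG] l(4) Br_central[OF l(3,5) primD(1)[OF l(2)] fN]
      Br_idem[OF l(3) fN primD(2)[OF l(2)]]] by blast
qed

lemma brauer_le_normalI:
  assumes N: "p_subgroup p G N" "is_block N e" and T: "subgroup T G" "T \<subseteq> N" "is_block T f"
    and norm: "\<And>n. n \<in> N \<Longrightarrow> conj_by G n ` T = T"
    and f: "f \<in> fixed N" "Br N f \<star> e = e"
  shows "brauer_le p G (T, f) (N, e)"
proof -
  obtain f' where f': "brauer_le p G (T, f') (N, e)" using exists_brauer_le[OF N T(1,2)] by blast
  note n' = brauer_le_normal[OF f' norm]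
  have f'b: "is_block T f'" using brauer_leD(2)[OF f'] .
  have "Br N (f \<star> f') \<star> e = e" using Br_conv[OF N(1) f(1) n'(1)] f(2) n'(2) by (simp add: conv_assoc)
  then have "f \<star> f' \<noteq> 0" using primD(3)[OF N(2)] by auto
  then have "f = f'"
    using blocks_orthogonal[OF subgroup_centralizer T(3) f'b] subgroup.subset[OF T(1)] by blast
  with f' show ?thesis by simp
qed

section \<open>Conjugacy of maximal Brauer pairs\<close>

text \<open>
  The maximal pair \<open>(P, e)\<close> plays the part of a defect group of the block \<open>b\<close> of \<open>H\<close>. Let \<open>s\<close> be the sum of
  the conjugates of \<open>e\<close> under the normalizer of \<open>P\<close> in \<open>H\<close>. If \<open>Br X s \<noteq> 0\<close> for some larger \<open>X\<close>, then
  some conjugate of \<open>e\<close> is \<open>X\<close>-stable and \<open>(P, e)\<close> lies below a pair on a conjugate of \<open>X\<close>; so maximality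
  allows \<open>s\<close> to be lifted to an element \<open>a\<close>. As \<open>Br P (b \<star> a) = s\<close> is a nonzero idempotent, \<open>b \<star> a\<close> is
  not nilpotent, and since \<open>b\<close> is primitive, Fitting's lemma yields \<open>b = b \<star> a \<star> h\<close>. Applying \<open>Br P\<close> and
  \<open>Br Q\<close> to this equation gives the two claims.
\<close>
lemma maximal_pair_defect:
  fixes b e :: "'g \<Rightarrow> 'k"
  assumes H: "subgroup H G" and R: "\<forall>h \<in> H. conj_by G h ` R = R" "cent R \<subseteq> H"
    and b: "b \<in> fixed H"
    and P: "P \<subseteq> H" "brauer_le p G (R, b) (P, e)"
    and max: "\<forall>X d. X \<subseteq> H \<longrightarrow> brauer_le p G (P, e) (X, d) \<longrightarrow> X = P"
  shows "Br P b = \<Sum>((\<lambda>n. ga_conj G n e) ` normalizer_in H P)" (is ?A)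
    and "\<And>Q. p_subgroup p G Q \<Longrightarrow> Q \<subseteq> H \<Longrightarrow> Br Q b \<noteq> 0 \<Longrightarrow> \<exists>h \<in> H. conj_by G h ` Q \<subseteq> P" (is "PROP ?B")
proof -
  interpret H: subgroup H G by fact
  note l = brauer_leD[OF P(2)]
  have PG: "P \<subseteq> carrier G" and RG: "R \<subseteq> carrier G" using l p_subgroup_subset_carrier by auto
  have sCP: "subgroup (cent P) G" and sCR: "subgroup (cent R) G" using PG RG by (auto intro: subgroup_centralizer)
  let ?N = "normalizer_in H P"
  have sN: "subgroup ?N G" using H PG by (rule subgroup_normalizer_in)
  interpret N: subgroup ?N G by fact
  define F where "F = (\<lambda>n. ga_conj G n e) ` ?N"
  have finF: "finite F" using N.subset finite_carrier finite_subset unfolding F_def by blast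
  have es: "e \<in> supported (carrier G)" using block_supported_carrier[OF l(4)] .
  have Fb: "is_block P f" if "f \<in> F" for f
  proof -
    obtain n where n: "n \<in> ?N" "f = ga_conj G n e" using \<open>f \<in> F\<close> unfolding F_def by blast
    then have "n \<in> carrier G" "conj_by G n ` P = P" by auto
    then show ?thesis using block_conj[OF _ PG l(4), of n] n(2) by simp
  qed
  then have fsup: "f \<in> supported (carrier G)" if "f \<in> F" for f using that block_supported_carrier by blast
  from Fb have FB: "F \<subseteq> {f. is_block P f}" by blast
  have stable: "ga_conj G n f \<in> F" if n: "n \<in> ?N" and f: "f \<in> F" for n f
  proof -
    obtain m where m: "m \<in> ?N" "f = ga_conj G m e" using f unfolding F_def by blast
    have nm: "n \<in> carrier G" "m \<in> carrier G" using n m by auto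
    have "ga_conj G n f = ga_conj G (n \<otimes> m) e" using m nm by (simp add: ga_conj_ga_conj)
    moreover have "n \<otimes> m \<in> ?N" using n m(1) by (rule N.m_closed)
    ultimately show ?thesis unfolding F_def by (rule image_eqI)
  qed
  define s where "s = \<Sum>F"
  have absorb: "f \<star> s = f" if "f \<in> F" for f
    using block_conv_sum[OF sCP finF FB Fb[OF that]] that by (simp add: s_def)
  have eF: "e \<in> F" unfolding F_def by (rule image_eqI[OF _ N.one_closed]) (simp add: es)
  have sc: "s \<in> central (cent P)"
    unfolding s_def using finF FB
    by (induction F) (auto intro: subalgebraD[OF subalgebra_central[OF sCP]] primD)
  have ssup: "s \<in> supported (cent P)" using sc by (rule central_supported)
  have ss: "s \<star> s = s"
  proof -
    have "s \<star> s = (\<Sum>f \<in> F. f \<star> s)" using conv_sum_left[of "\<lambda>x. x" F s] by (simp add: s_def)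
    also have "\<dots> = s" unfolding s_def by (rule sum.cong[OF refl]) (use absorb in \<open>simp add: s_def\<close>)
    finally show ?thesis .
  qed
  have s0: "s \<noteq> 0" using absorb[OF eF] primD(3)[OF l(4)] by auto
  have sfix: "s \<in> fixed ?N"
    unfolding fixed_def
  proof (intro CollectI conjI ballI)
    show "s \<in> supported (carrier G)" using supported_mono[OF centralizer_subset ssup] .
    fix n assume n: "n \<in> ?N"
    have nG: "n \<in> carrier G" and ni: "inv n \<in> ?N" using n N.m_inv_closed by auto
    have "bij_betw (ga_conj G n) F F"
      by (rule bij_betw_byWitness[where f' = "ga_conj G (inv n)"])
        (use stable[OF n] stable[OF ni] nG fsup in auto)
    then have "(\<Sum>f \<in> F. ga_conj G n f) = \<Sum>F" by (rule sum.reindex_bij_betw)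
    then show "ga_conj G n s = s" using ga_conj_sum[of n "\<lambda>x. x" F] by (simp add: s_def)
  qed
  have van: "Br X s = 0" if X: "p_subgroup p G X" "P \<subset> X" "X \<subseteq> ?N" for X
  proof -
    have XG: "X \<subseteq> carrier G" using X(1) by (rule p_subgroup_subset_carrier)
    have "Br X f = 0" if f: "f \<in> F" "f \<in> fixed X" for f
    proof (rule ccontr)
      assume nz: "Br X f \<noteq> 0"
      obtain n where n: "n \<in> ?N" "f = ga_conj G n e" using f by (auto simp: F_def)
      have nG: "n \<in> carrier G" "inv n \<in> H" "inv n \<in> carrier G" using n by auto
      obtain d where d: "is_block X d" "d \<star> Br X f \<noteq> 0"
        using exists_block[OF subgroup_centralizer[OF XG] Br_supported nz] by blast
      have PX: "P \<subseteq> X" using X by blast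
      have fc: "Br X f \<in> central (cent X)" "Br X f \<star> Br X f = Br X f"
        using Br_central[OF X(1) PX primD(1)[OF Fb[OF f(1)]] f(2)]
          Br_idem[OF X(1) f(2) primD(2)[OF Fb[OF f(1)]]] by auto
      have "Br X f \<star> d = d \<star> Br X f" using central_commute[OF fc(1) block_supported[OF d(1)]] .
      then have fd: "Br X f \<star> d = d"
        using block_dichotomy[OF subgroup_centralizer[OF XG] d(1) fc] d(2) by auto
      have "brauer_le p G (P, f) (X, d)"
        by (rule brauer_le_normalI[OF X(1) d(1) p_subgroup_imp_subgroup[OF l(3)] PX Fb[OF f(1)] _ f(2) fd])
          (use X(3) in auto)
      from brauer_le_conj[OF nG(3) this]
      have "brauer_le p G (conj_by G (inv n) ` P, ga_conj G (inv n) f) (conj_by G (inv n) ` X, ga_conj G (inv n) d)" .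
      moreover have "conj_by G (inv n) ` P = P" using N.m_inv_closed[OF n(1)] by auto
      moreover have "ga_conj G (inv n) f = e" using n nG es by simp
      ultimately have "brauer_le p G (P, e) (conj_by G (inv n) ` X, ga_conj G (inv n) d)" by simp
      moreover have "conj_by G (inv n) ` X \<subseteq> H"
        using X(3) nG n(1) by (auto simp: conj_by_def)
      ultimately have "conj_by G (inv n) ` X = P" using max by blast
      then have "card X = card P" using card_conj_by[OF nG(3) XG] by simp
      moreover have "finite X" using XG finite_carrier finite_subset by blast
      ultimately show False using psubset_card_mono X(2) by (metis less_irrefl)
    qed
    moreover have "Br X s = (\<Sum>f \<in> {f \<in> F. f \<in> fixed X}. Br X f)"
      unfolding s_def
      by (rule Br_sum_stable[OF X(1) finF]) (use FB block_supported_carrier stable X(3) in blast)+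
    ultimately show ?thesis by (simp add: sum.neutral)
  qed
  obtain a where a: "a \<in> fixed H" "Br P a = s"
    and aQ: "\<And>Q. p_subgroup p G Q \<Longrightarrow> Q \<subseteq> H \<Longrightarrow> \<forall>m \<in> H. \<not> conj_by G m ` Q \<subseteq> P \<Longrightarrow> Br Q a = 0"
    and asup: "\<And>g. a g \<noteq> 0 \<Longrightarrow> \<exists>m \<in> H. conj_by G m g \<in> cent P"
    using lift_stable[OF H l(3) P(1) ssup sfix van] by blast
  have aR: "a \<in> supported (cent R)"
  proof (rule supportedI, rule ccontr)
    fix g assume g: "g \<notin> cent R" "a g \<noteq> 0"
    then obtain m where m: "m \<in> H" "conj_by G m g \<in> cent P" using asup by blast
    have gG: "g \<in> carrier G" using g(2) supportedD[OF fixed_supported[OF a(1)]] by blast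
    have mG: "m \<in> carrier G" "inv m \<in> H" "inv m \<in> carrier G" using m by auto
    have "conj_by G m g \<in> cent R" using m centralizer_mono[OF l(5)] by blast
    then have "conj_by G (inv m) (conj_by G m g) \<in> conj_by G (inv m) ` cent R" by blast
    also have "\<dots> = cent R" using centralizer_conj_by[OF mG(3) RG] bspec[OF R(1) mG(2)] by simp
    finally show False using g mG gG by simp
  qed
  \<comment> \<open>these elements are central in the group algebra of the centralizer of \<open>R\<close>, where \<open>b\<close> is a block\<close>
  define S where "S = supported (cent R) \<inter> fixed H"
  have algS: "subalgebra S"
    unfolding S_def by (intro subalgebra_Int subalgebra_supported subalgebra_fixed sCR H.subset)
  have Sc: "w \<in> central (cent R)" if "w \<in> S" for w
    using that fixed_mono[OF R(2)] by (auto simp: S_def central_eq sCR)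
  have SP: "w \<in> fixed Q" if "w \<in> S" "Q \<subseteq> H" for w Q using that fixed_mono by (auto simp: S_def)
  have bS: "b \<in> S" using b block_supported[OF l(2)] by (simp add: S_def)
  have aS: "a \<in> S" using a aR by (simp add: S_def)
  define z where "z = b \<star> a"
  have zS: "z \<in> S" unfolding z_def using algS bS aS by (rule subalgebraD)
  have norm: "conj_by G n ` R = R" if "n \<in> P" for n using R(1) that P(1) by blast
  have be: "Br P b \<star> e = e" using brauer_le_normal(2)[OF P(2) norm] .
  have bF: "Br P b \<star> f = f" if f: "f \<in> F" for f
  proof -
    obtain n where n: "n \<in> ?N" "f = ga_conj G n e" using f by (auto simp: F_def)
    have nG: "n \<in> carrier G" using n by auto
    have "ga_conj G n (Br P b) = Br P b" using Br_conj[OF nG PG] n fixed_conj[OF b] by simp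
    then show ?thesis using be n ga_conj_conv[OF nG] by metis
  qed
  have bs: "Br P b \<star> s = s"
    unfolding s_def conv_sum_right by (rule sum.cong[OF refl bF])
  have Bz: "Br P z = s" unfolding z_def using Br_conv[OF l(3) SP[OF bS P(1)] SP[OF aS P(1)]] a bs by simp
  have "conv_pow z n \<noteq> 0" if n: "n \<ge> 1" for n
  proof
    assume "conv_pow z n = 0"
    moreover have "conv_pow s n = s" using conv_pow_idem[OF _ ss n] supported_mono[OF centralizer_subset ssup] by blast
    ultimately show False using Br_conv_pow[OF l(3) SP[OF zS P(1)] n] Bz s0 by simp
  qed
  then obtain h where h: "h \<in> S" "(z \<star> h) \<star> (z \<star> h) = z \<star> h" "z \<star> h \<noteq> 0"
    using power_idempotent[OF algS zS] by blast
  have zh: "z \<star> h \<in> S" using algS zS h(1) by (rule subalgebraD)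
  have bzh: "b \<star> (z \<star> h) = z \<star> h" unfolding z_def using primD(2)[OF l(2)] by (simp flip: conv_assoc)
  have "(z \<star> h) \<star> b = z \<star> h"
    using central_commute[OF Sc[OF zh] block_supported[OF l(2)]] bzh by simp
  then have bz: "z \<star> h = b" using block_dichotomy[OF sCR l(2) Sc[OF zh] h(2)] h(3) by auto
  have Bb: "Br Q b = Br Q b \<star> Br Q a \<star> Br Q h" if Q: "p_subgroup p G Q" "Q \<subseteq> H" for Q
  proof -
    have "Br Q (z \<star> h) = Br Q z \<star> Br Q h" using Br_conv[OF Q(1) SP[OF zS Q(2)] SP[OF h(1) Q(2)]] .
    moreover have "Br Q z = Br Q b \<star> Br Q a"
      unfolding z_def using Br_conv[OF Q(1) SP[OF bS Q(2)] SP[OF aS Q(2)]] .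
    ultimately show ?thesis using bz by simp
  qed
  have "Br P b = s \<star> Br P h" using Bb[OF l(3) P(1)] a bs by simp
  then have "s \<star> Br P b = Br P b" using ss by (metis conv_assoc)
  moreover have "s \<star> Br P b = Br P b \<star> s" using central_commute[OF sc Br_supported] .
  ultimately show ?A using bs by (simp add: s_def F_def)
  show "\<exists>h \<in> H. conj_by G h ` Q \<subseteq> P" if Q: "p_subgroup p G Q" "Q \<subseteq> H" "Br Q b \<noteq> 0" for Q
  proof (rule ccontr)
    assume "\<not> ?thesis"
    then have "Br Q a = 0" using aQ[OF Q(1,2)] by blast
    then show False using Bb[OF Q(1,2)] Q(3) by simp
  qed
qed

text \<open>
  Larger pairs on the same subgroup are equal, so it suffices to maximize the subgroup.
\<close>
lemma exists_maximal_above: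
  fixes d :: "'g \<Rightarrow> 'k"
  assumes Q: "p_subgroup p G Q" "is_block Q d" "Q \<subseteq> H"
  shows "\<exists>X e. X \<subseteq> H \<and> brauer_le p G (Q, d) (X, e) \<and>
    (\<forall>Y e'. Y \<subseteq> H \<longrightarrow> brauer_le p G (X, e) (Y, e') \<longrightarrow> Y = X)"
proof -
  let ?A = "{X. X \<subseteq> H \<and> (\<exists>e. brauer_le p G (Q, d) (X, e))}"
  have "?A \<subseteq> Pow (carrier G)" using brauer_leD(3) p_subgroup_subset_carrier by blast
  then have "finite ?A" by (rule finite_subset) simp
  moreover have "Q \<in> ?A" using Q brauer_le_refl by blast
  ultimately have "\<exists>X \<in> ?A. \<forall>Y \<in> ?A. X \<subseteq> Y \<longrightarrow> X = Y" by (intro finite_has_maximal) auto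
  then obtain X where X: "X \<in> ?A" "\<forall>Y \<in> ?A. X \<subseteq> Y \<longrightarrow> X = Y" by (rule bexE)
  then obtain e where e: "brauer_le p G (Q, d) (X, e)" by blast
  have "Y = X" if "Y \<subseteq> H" "brauer_le p G (X, e) (Y, e')" for Y e'
  proof -
    have "Y \<in> ?A" using that brauer_le_trans[OF e that(2)] by blast
    then show ?thesis using X(2) brauer_leD(5)[OF that(2)] by blast
  qed
  then show ?thesis using X e by blast
qed

text \<open>
  Two maximal pairs \<open>(P, e)\<close> and \<open>(X, f)\<close> over \<open>(R, b)\<close> have conjugate subgroups, as each is conjugate into the
  other; and once \<open>X = P\<close>, the formula for \<open>Br P b\<close> shows that \<open>f\<close> is one of the conjugates of \<open>e\<close>. The case
  \<open>H = G\<close>, \<open>R = 1\<close> is the conjugacy of the maximal Brauer pairs of a block; the general case is the same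
  statement for \<open>b\<close> as a block of \<open>H\<close>.
\<close>
theorem maximal_pair_contains_conjugate:
  fixes b d e :: "'g \<Rightarrow> 'k"
  assumes H: "subgroup H G" and R: "\<forall>h \<in> H. conj_by G h ` R = R" "cent R \<subseteq> H"
    and b: "b \<in> fixed H"
    and P: "P \<subseteq> H" "brauer_le p G (R, b) (P, e)"
    and max: "\<forall>X d. X \<subseteq> H \<longrightarrow> brauer_le p G (P, e) (X, d) \<longrightarrow> X = P"
    and Q: "Q \<subseteq> H" "brauer_le p G (R, b) (Q, d)"
  shows "\<exists>h \<in> H. brauer_le p G (conj_by G h ` Q, ga_conj G h d) (P, e)"
proof -
  interpret H: subgroup H G by fact
  obtain X f where X: "X \<subseteq> H" "brauer_le p G (Q, d) (X, f)"
    and Xmax: "\<forall>Y e'. Y \<subseteq> H \<longrightarrow> brauer_le p G (X, f) (Y, e') \<longrightarrow> Y = X"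
    using exists_maximal_above[OF brauer_leD(3,4)[OF Q(2)] Q(1)] by blast
  have RX: "brauer_le p G (R, b) (X, f)" using brauer_le_trans[OF Q(2) X(2)] .
  note lP = brauer_leD[OF P(2)] and lX = brauer_leD[OF RX]
  have PG: "P \<subseteq> carrier G" and XG: "X \<subseteq> carrier G" using lP lX p_subgroup_subset_carrier by auto
  have finP: "finite P" "finite X" using PG XG finite_carrier finite_subset by blast+
  note defP = maximal_pair_defect[OF H R b P max] and defX = maximal_pair_defect[OF H R b X(1) RX Xmax]
  have nP: "Br P b \<star> e = e" by (rule brauer_le_normal(2)[OF P(2)]) (use R(1) P(1) in blast)
  have nX: "Br X b \<star> f = f" by (rule brauer_le_normal(2)[OF RX]) (use R(1) X(1) in blast)
  have "Br P b \<noteq> 0" "Br X b \<noteq> 0" using nP nX primD(3)[OF lP(4)] primD(3)[OF lX(4)] by auto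
  then obtain h h' where h: "h \<in> H" "conj_by G h ` X \<subseteq> P" and h': "h' \<in> H" "conj_by G h' ` P \<subseteq> X"
    using defP(2)[OF lX(3) X(1)] defX(2)[OF lP(3) P(1)] by blast
  have hG: "h \<in> carrier G" "h' \<in> carrier G" using h h' by auto
  have "card P \<le> card X" using card_mono[OF finP(2) h'(2)] card_conj_by[OF hG(2) PG] by simp
  then have hX: "conj_by G h ` X = P"
    using card_seteq[OF finP(1) h(2)] card_conj_by[OF hG(1) XG] by simp
  define d1 where "d1 = ga_conj G h f"
  have d1: "is_block P d1" using block_conj[OF hG(1) XG lX(4)] hX by (simp add: d1_def)
  have "ga_conj G h (Br X b) = Br P b" using Br_conj[OF hG(1) XG] hX fixed_conj[OF b h(1)] by simp
  then have bd: "Br P b \<star> d1 = d1" using nX ga_conj_conv[OF hG(1)] unfolding d1_def by metis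
  let ?N = "normalizer_in H P" and ?F = "(\<lambda>n. ga_conj G n e) ` normalizer_in H P"
  have "d1 \<in> ?F"
  proof (rule ccontr)
    assume ni: "d1 \<notin> ?F"
    have "finite H" using H.subset finite_carrier finite_subset by blast
    then have "finite ?F" by simp
    moreover have "?F \<subseteq> {f. is_block P f}"
    proof safe
      fix n assume "n \<in> H" "conj_by G n ` P = P"
      then show "is_block P (ga_conj G n e)" using block_conj[OF _ PG lP(4), of n] by simp
    qed
    ultimately have "d1 \<star> Br P b = 0"
      using block_conv_sum[OF subgroup_centralizer[OF PG] _ _ d1] ni defP(1) by simp
    moreover have "d1 \<star> Br P b = Br P b \<star> d1"
      using central_commute[OF primD(1)[OF d1] Br_supported] .
    ultimately show False using bd primD(3)[OF d1] by simp
  qed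
  then obtain n where n: "n \<in> ?N" "d1 = ga_conj G n e" by blast
  have nG: "n \<in> carrier G" "inv n \<in> carrier G" using n by auto
  let ?k = "inv n \<otimes> h"
  have kH: "?k \<in> H" using n h by auto
  then have kG: "?k \<in> carrier G" by auto
  have "conj_by G (inv n) ` P = P"
    using subgroup.m_inv_closed[OF subgroup_normalizer_in[OF H PG] n(1)] by auto
  then have "conj_by G ?k ` X = P" using hX conj_by_image_conj_by[OF nG(2) hG(1) XG] by simp
  moreover have "ga_conj G ?k f = e"
    using ga_conj_ga_conj[OF nG(2) hG(1), of f] n(2) nG block_supported_carrier[OF lP(4)]
    by (simp add: d1_def)
  ultimately have "brauer_le p G (conj_by G ?k ` Q, ga_conj G ?k d) (P, e)"
    using brauer_le_conj[OF kG X(2)] by simp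
  then show ?thesis using kH by blast
qed

section \<open>Fusion systems of blocks\<close>

lemma conj_pair_apply [simp]: "conj_pair G x (Q, e) = (conj_by G x ` Q, ga_conj G x e)"
  by (simp add: conj_pair_def)

lemma brauer_block_eq:
  fixes e f :: "'g \<Rightarrow> 'k"
  assumes "brauer_le p G (Q, e) (P, f)"
  shows "brauer_block p G (P, f) Q = e"
  unfolding brauer_block_def using assms brauer_le_unique by blast

lemma brauer_block_le:
  fixes f :: "'g \<Rightarrow> 'k"
  assumes "p_subgroup p G P" "is_block P f" "subgroup Q G" "Q \<subseteq> P"
  shows "brauer_le p G (Q, brauer_block p G (P, f) Q) (P, f)"
  using exists_brauer_le[OF assms] brauer_block_eq by metis

lemma brauer_block_mono:
  fixes f :: "'g \<Rightarrow> 'k"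
  assumes P: "p_subgroup p G P" "is_block P f" and Q: "subgroup Q G" "Q \<subseteq> N" and N: "subgroup N G" "N \<subseteq> P"
  shows "brauer_le p G (Q, brauer_block p G (P, f) Q) (N, brauer_block p G (P, f) N)"
proof -
  have NP: "brauer_le p G (N, brauer_block p G (P, f) N) (P, f)" using brauer_block_le[OF P N] .
  obtain e where e: "brauer_le p G (Q, e) (N, brauer_block p G (P, f) N)"
    using exists_brauer_le[OF brauer_leD(1,2)[OF NP] Q] by blast
  have "brauer_block p G (P, f) Q = e" using brauer_block_eq[OF brauer_le_trans[OF e NP]] .
  with e show ?thesis by simp
qed

lemma conj_by_restrict:
  assumes "subgroup P G" "y \<in> P"
  shows "conj_by (G\<lparr>carrier := P\<rparr>) y u = conj_by G y u"
  using m_inv_consistent[OF assms] by (simp add: conj_by_def)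

text \<open>
  An element \<open>y\<close> of \<open>P\<close> such that \<open>xyx\<^sup>-\<^sup>1\<close> acts on \<open>R = xQx\<^sup>-\<^sup>1\<close> like an element of its normalizer
  automatically normalizes \<open>Q\<close>.
\<close>
lemma extension_group_eq:
  assumes P: "subgroup P G" and Q: "subgroup Q G" "Q \<subseteq> P" and x: "x \<in> carrier G"
    and \<phi>: "\<forall>u \<in> Q. \<phi> u = conj_by G x u" and R: "\<phi> ` Q = R" "R \<subseteq> P"
  shows "extension_group (G\<lparr>carrier := P\<rparr>) Q \<phi> =
    {y \<in> P. \<exists>z \<in> normalizer_in P R. \<forall>u \<in> R. conj_by G (conj_by G x y) u = conj_by G z u}"
proof -
  interpret P: subgroup P G by fact
  interpret Q: subgroup Q G by fact
  have QG: "Q \<subseteq> carrier G" by (rule Q.subset)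
  have finQ: "finite Q" using QG finite_carrier finite_subset by blast
  have Rx: "R = conj_by G x ` Q" using R \<phi> by force
  have key: "conj_by G (conj_by G x y) (conj_by G x u) = conj_by G x (conj_by G y u)"
    if "y \<in> P" "u \<in> Q" for y u
    using that x QG Q P.subset by (simp add: conj_by_conj_by subset_iff) (simp add: conj_by_def m_assoc subset_iff)
  have stable: "conj_by G y ` Q = Q"
    if y: "y \<in> P" and z: "z \<in> normalizer_in P R" "\<forall>u \<in> R. conj_by G (conj_by G x y) u = conj_by G z u" for y z
  proof (rule image_conj_by_eqI[OF _ finQ QG])
    show yG: "y \<in> carrier G" using y by auto
    show "conj_by G y ` Q \<subseteq> Q"
    proof safe
      fix u assume u: "u \<in> Q"
      have "conj_by G x u \<in> R" using u Rx by blast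
      then have "conj_by G z (conj_by G x u) \<in> R" using z(1) by blast
      moreover have "conj_by G (conj_by G x y) (conj_by G x u) = conj_by G z (conj_by G x u)"
        using z(2) \<open>conj_by G x u \<in> R\<close> by blast
      ultimately have "conj_by G x (conj_by G y u) \<in> conj_by G x ` Q"
        unfolding key[OF y u] Rx by (simp only:)
      then obtain v where v: "v \<in> Q" "conj_by G x (conj_by G y u) = conj_by G x v" by blast
      then have "conj_by G y u = v"
        using inj_onD[OF inj_on_conj_by[OF x subset_refl] v(2)] u yG QG by blast
      then show "conj_by G y u \<in> Q" using v by simp
    qed
  qed
  have cond: "(\<forall>u \<in> Q. \<phi> (conj_by (G\<lparr>carrier := P\<rparr>) y u) = conj_by (G\<lparr>carrier := P\<rparr>) z (\<phi> u)) \<longleftrightarrow>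
      (\<forall>u \<in> R. conj_by G (conj_by G x y) u = conj_by G z u)"
    if y: "y \<in> P" "conj_by G y ` Q = Q" and z: "z \<in> P" for y z
  proof -
    have "\<phi> (conj_by (G\<lparr>carrier := P\<rparr>) y u) = conj_by G (conj_by G x y) (conj_by G x u)" if u: "u \<in> Q" for u
    proof -
      have "conj_by G y u \<in> Q" using y(2) u by blast
      then show ?thesis using key[OF y(1) u] \<phi> conj_by_restrict[OF P y(1)] by simp
    qed
    moreover have "conj_by (G\<lparr>carrier := P\<rparr>) z (\<phi> u) = conj_by G z (conj_by G x u)" if "u \<in> Q" for u
      using that \<phi> conj_by_restrict[OF P z] by simp
    ultimately show ?thesis by (simp add: Rx)
  qed
  show ?thesis
    unfolding extension_group_def R(1) normalizer_restrict[OF P Q(2)] normalizer_restrict[OF P R(2)]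
  proof (intro subset_antisym subsetI CollectI)
    fix y assume "y \<in> {y \<in> normalizer_in P Q. \<exists>z \<in> normalizer_in P R. \<forall>u \<in> Q.
      \<phi> (conj_by (G\<lparr>carrier := P\<rparr>) y u) = conj_by (G\<lparr>carrier := P\<rparr>) z (\<phi> u)}"
    then obtain z where y: "y \<in> P" "conj_by G y ` Q = Q" and z: "z \<in> normalizer_in P R"
      and e: "\<forall>u \<in> Q. \<phi> (conj_by (G\<lparr>carrier := P\<rparr>) y u) = conj_by (G\<lparr>carrier := P\<rparr>) z (\<phi> u)" by blast
    have "z \<in> P" using z by blast
    then show "y \<in> P \<and> (\<exists>z \<in> normalizer_in P R. \<forall>u \<in> R. conj_by G (conj_by G x y) u = conj_by G z u)"
      using cond[OF y] e y z by blast
  next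
    fix y assume "y \<in> {y \<in> P. \<exists>z \<in> normalizer_in P R. \<forall>u \<in> R. conj_by G (conj_by G x y) u = conj_by G z u}"
    then obtain z where y: "y \<in> P" and z: "z \<in> normalizer_in P R"
      and e: "\<forall>u \<in> R. conj_by G (conj_by G x y) u = conj_by G z u" by blast
    have zP: "z \<in> P" using z by blast
    have yQ: "conj_by G y ` Q = Q" using stable[OF y z e] .
    have "\<forall>u \<in> Q. \<phi> (conj_by (G\<lparr>carrier := P\<rparr>) y u) = conj_by (G\<lparr>carrier := P\<rparr>) z (\<phi> u)"
      using cond[OF y yQ zP] e by blast
    then show "y \<in> normalizer_in P Q \<and> (\<exists>z \<in> normalizer_in P R. \<forall>u \<in> Q.
      \<phi> (conj_by (G\<lparr>carrier := P\<rparr>) y u) = conj_by (G\<lparr>carrier := P\<rparr>) z (\<phi> u))"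
      using y yQ z by blast
  qed
qed

lemma block_fusion_system_iff:
  "\<phi> \<in> block_fusion_system p G (P, f) Q R \<longleftrightarrow>
     \<phi> \<in> hom (G\<lparr>carrier := Q\<rparr>) (G\<lparr>carrier := R\<rparr>) \<and> \<phi> \<in> extensional Q \<and>
     (\<exists>x \<in> carrier G. (\<forall>u \<in> Q. \<phi> u = conj_by G x u) \<and>
        brauer_le p G (conj_by G x ` Q, ga_conj G x (brauer_block p G (P, f) Q)) (R, brauer_block p G (P, f) R))"
  by (auto simp: block_fusion_system_def)

lemma restrict_conj_in_block_fusion_system:
  fixes f :: "'g \<Rightarrow> 'k"
  assumes x: "x \<in> carrier G" and Q: "subgroup Q G"
    and le: "brauer_le p G (conj_by G x ` Q, ga_conj G x (brauer_block p G (P, f) Q)) (R, brauer_block p G (P, f) R)"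
  shows "restrict (conj_by G x) Q \<in> block_fusion_system p G (P, f) Q R"
  unfolding block_fusion_system_iff
proof (intro conjI bexI[of _ x] homI)
  interpret Q: subgroup Q G by fact
  show "restrict (conj_by G x) Q u \<in> carrier (G\<lparr>carrier := R\<rparr>)" if "u \<in> carrier (G\<lparr>carrier := Q\<rparr>)" for u
    using that brauer_leD(5)[OF le] by auto
  show "restrict (conj_by G x) Q (u \<otimes>\<^bsub>G\<lparr>carrier := Q\<rparr>\<^esub> v) =
      restrict (conj_by G x) Q u \<otimes>\<^bsub>G\<lparr>carrier := R\<rparr>\<^esub> restrict (conj_by G x) Q v"
    if "u \<in> carrier (G\<lparr>carrier := Q\<rparr>)" "v \<in> carrier (G\<lparr>carrier := Q\<rparr>)" for u v
    using that x by (simp add: conj_by_mult)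
qed (use le x in auto)

lemma fusion_isomorphic_conj:
  fixes f :: "'g \<Rightarrow> 'k"
  assumes R: "subgroup R G" "brauer_le p G (R, brauer_block p G (P, f) R) (P, f)" and g: "g \<in> carrier G"
    and le: "brauer_le p G (conj_by G g ` R, ga_conj G g (brauer_block p G (P, f) R)) (P, f)"
  shows "fusion_isomorphic (block_fusion_system p G (P, f)) R (conj_by G g ` R)"
proof -
  let ?R = "conj_by G g ` R" and ?e = "brauer_block p G (P, f)"
  have RG: "R \<subseteq> carrier G" using R(1) by (rule subgroup.subset)
  have ig: "inv g \<in> carrier G" using g by simp
  have eR: "?e ?R = ga_conj G g (?e R)" using brauer_block_eq[OF le] .
  have inverse: "conj_by G (inv g) ` ?R = R" "ga_conj G (inv g) (?e ?R) = ?e R"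
    using g RG block_supported_carrier[OF brauer_leD(2)[OF R(2)]] by (simp_all add: conj_image_inv eR)
  have "brauer_le p G (?R, ga_conj G g (?e R)) (?R, ?e ?R)"
    unfolding eR using brauer_leD(1,2)[OF le] by (rule brauer_le_refl)
  then have 1: "restrict (conj_by G g) R \<in> block_fusion_system p G (P, f) R ?R"
    by (rule restrict_conj_in_block_fusion_system[OF g R(1)])
  have "brauer_le p G (conj_by G (inv g) ` ?R, ga_conj G (inv g) (?e ?R)) (R, ?e R)"
    unfolding inverse using brauer_leD(1,2)[OF R(2)] by (rule brauer_le_refl)
  then have 2: "restrict (conj_by G (inv g)) ?R \<in> block_fusion_system p G (P, f) ?R R"
    by (rule restrict_conj_in_block_fusion_system[OF ig subgroup_conj_by[OF g R(1)]])
  have "compose R (restrict (conj_by G (inv g)) ?R) (restrict (conj_by G g) R) = (\<lambda>u \<in> R. u)"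
    using g RG by (auto simp: compose_def fun_eq_iff subset_iff)
  moreover have "compose ?R (restrict (conj_by G g) R) (restrict (conj_by G (inv g)) ?R) = (\<lambda>u \<in> ?R. u)"
    using g RG by (auto simp: compose_def fun_eq_iff subset_iff)
  ultimately show ?thesis unfolding fusion_isomorphic_def using 1 2 by blast
qed

lemma subgroup_induces_conj_by:
  assumes S: "subgroup S G" and R: "R \<subseteq> carrier G" "\<And>s. s \<in> S \<Longrightarrow> conj_by G s ` R = R"
  shows "subgroup {h \<in> carrier G. \<exists>z \<in> S. \<forall>u \<in> R. conj_by G h u = conj_by G z u} G" (is "subgroup ?H G")
proof
  interpret S: subgroup S G by fact
  have cl: "conj_by G z u \<in> R" if "z \<in> S" "u \<in> R" for z u using R(2) that by blast
  show "?H \<subseteq> carrier G" by auto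
  show "\<one> \<in> ?H" using S.one_closed by auto
  show "h \<otimes> k \<in> ?H" if hk: "h \<in> ?H" "k \<in> ?H" for h k
  proof -
    obtain z w where z: "z \<in> S" "\<forall>u \<in> R. conj_by G h u = conj_by G z u"
      and w: "w \<in> S" "\<forall>u \<in> R. conj_by G k u = conj_by G w u" using hk by blast
    have G: "h \<in> carrier G" "k \<in> carrier G" "z \<in> carrier G" "w \<in> carrier G" using hk z w by auto
    have "conj_by G (h \<otimes> k) u = conj_by G (z \<otimes> w) u" if u: "u \<in> R" for u
    proof -
      have uG: "u \<in> carrier G" using u R by blast
      have "conj_by G (h \<otimes> k) u = conj_by G h (conj_by G k u)" using G uG by (simp add: conj_by_conj_by)
      also have "\<dots> = conj_by G z (conj_by G w u)" using w z cl[OF w(1) u] u by simp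
      also have "\<dots> = conj_by G (z \<otimes> w) u" using G uG by (simp add: conj_by_conj_by)
      finally show ?thesis .
    qed
    then show ?thesis using G z w by auto
  qed
  show "inv h \<in> ?H" if h: "h \<in> ?H" for h
  proof -
    obtain z where z: "z \<in> S" "\<forall>u \<in> R. conj_by G h u = conj_by G z u" using h by blast
    have G: "h \<in> carrier G" "z \<in> carrier G" using h z by auto
    have "conj_by G (inv h) u = conj_by G (inv z) u" if u: "u \<in> R" for u
    proof -
      have uG: "u \<in> carrier G" using u R by blast
      have "conj_by G (inv z) u \<in> R" using cl[OF S.m_inv_closed[OF z(1)] u] .
      then have "conj_by G h (conj_by G (inv z) u) = u" using z G uG by simp
      then show ?thesis using G uG conj_by_inv_conj_by(1)[of h "conj_by G (inv z) u"] by simp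
    qed
    then show ?thesis using G S.m_inv_closed[OF z(1)] by blast
  qed
qed

text \<open>
  The trivial subgroup has centralizer \<open>G\<close>, so \<open>(1, c)\<close> is a Brauer pair. It is stable under \<open>P\<close>, and the
  criterion for normal subgroups applies.
\<close>
lemma block_brauer_pair_iff:
  fixes c f :: "'g \<Rightarrow> 'k"
  assumes c: "block_idempotent G c"
  shows "block_brauer_pair p G c (P, f) \<longleftrightarrow> brauer_le p G ({\<one>}, c) (P, f)"
proof -
  have norm: "conj_by G n ` {\<one>} = {\<one>}" if "n \<in> P" "p_subgroup p G P" for n
    using that p_subgroup_subset_carrier by fastforce
  have cent1: "cent {\<one>} = carrier G" by (auto simp: centralizer_def)
  have cb: "is_block {\<one>} c"
    using c block_idempotent_iff[OF subgroup_self, of c] by (simp add: cent1)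
  have mult: "Br P c \<otimes>\<^bsub>centralizer_algebra G P\<^esub> f = Br P c \<star> f" if "p_subgroup p G P" "is_block P f"
    by (rule subgroup_algebra_mult[OF subgroup_centralizer[OF p_subgroup_subset_carrier[OF that(1)]]
        Br_supported block_supported[OF that(2)]])
  show ?thesis
  proof
    assume L: "block_brauer_pair p G c (P, f)"
    then have P: "p_subgroup p G P" "is_block P f" by (auto simp: block_brauer_pair_def brauer_pair_iff)
    have eq: "Br P c \<star> f = f" using L mult[OF P] by (simp add: block_brauer_pair_def)
    have cP: "c \<in> fixed P"
      using block_fixed[OF _ cb] fixed_mono[OF p_subgroup_subset_carrier[OF P(1)]] by (simp add: cent1)
    show "brauer_le p G ({\<one>}, c) (P, f)"
      by (rule brauer_le_normalI[OF P triv_subgroup _ cb norm cP eq])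
        (use P subgroup.one_closed[OF p_subgroup_imp_subgroup[OF P(1)]] in auto)
  next
    assume le: "brauer_le p G ({\<one>}, c) (P, f)"
    note P = brauer_leD(3,4)[OF le]
    have "Br P c \<star> f = f" using brauer_le_normal(2)[OF le norm] P by blast
    then show "block_brauer_pair p G c (P, f)"
      using mult[OF P] P by (simp add: block_brauer_pair_def brauer_pair_iff)
  qed
qed

lemma brauer_pair_conj_into_maximal:
  fixes c d f :: "'g \<Rightarrow> 'k"
  assumes c: "block_idempotent G c" and max: "maximal_brauer_pair p G c (P, f)"
    and X: "block_brauer_pair p G c (X, d)"
  shows "\<exists>g \<in> carrier G. brauer_le p G (conj_by G g ` X, ga_conj G g d) (P, f)"
proof -
  note bp = block_brauer_pair_iff[OF c]
  have le: "brauer_le p G ({\<one>}, c) (P, f)" and leX: "brauer_le p G ({\<one>}, c) (X, d)"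
    using max X by (auto simp: maximal_brauer_pair_def bp)
  have cent1: "cent {\<one>} = carrier G" by (auto simp: centralizer_def)
  show ?thesis
  proof (rule maximal_pair_contains_conjugate[OF subgroup_self _ _ _ _ le _ _ leX])
    show "\<forall>h \<in> carrier G. conj_by G h ` {\<one>} = {\<one>}" by auto
    show "cent {\<one>} \<subseteq> carrier G" by (rule centralizer_subset)
    show "c \<in> fixed (carrier G)" using block_fixed[OF _ brauer_leD(2)[OF le]] by (simp add: cent1)
    show "P \<subseteq> carrier G" "X \<subseteq> carrier G"
      using brauer_leD(3)[OF le] brauer_leD(3)[OF leX] p_subgroup_subset_carrier by auto
    show "\<forall>Y e. Y \<subseteq> carrier G \<longrightarrow> brauer_le p G (P, f) (Y, e) \<longrightarrow> Y = P"
      using max brauer_le_trans[OF le] by (auto simp: maximal_brauer_pair_def bp)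
  qed
qed

text \<open>
  The two applications of conjugacy are the maximality of \<open>(S, e\<^sub>S)\<close>, where being fully normalized enters, and the
  choice of \<open>h\<close>.
\<close>
theorem block_fusion_system_extension_axiom:
  fixes c f :: "'g \<Rightarrow> 'k"
  assumes c: "block_idempotent G c" and max: "maximal_brauer_pair p G c (P, f)"
  shows "extension_axiom (G\<lparr>carrier := P\<rparr>) (block_fusion_system p G (P, f))"
  unfolding extension_axiom_def
proof (intro allI impI, elim conjE)
  let ?F = "block_fusion_system p G (P, f)" and ?e = "brauer_block p G (P, f)" and ?P = "G\<lparr>carrier := P\<rparr>"
  fix Q \<phi>
  assume Q0: "subgroup Q ?P" and \<phi>: "\<phi> \<in> ?F Q (carrier ?P)" and full: "fully_normalized ?P ?F (\<phi> ` Q)"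
  note bp = block_brauer_pair_iff[OF c]
  have cP: "brauer_le p G ({\<one>}, c) (P, f)" using max by (simp add: maximal_brauer_pair_def bp)
  have P: "p_subgroup p G P" "is_block P f" using brauer_leD[OF cP] by auto
  have sP: "subgroup P G" using P(1) by (rule p_subgroup_imp_subgroup)
  interpret P: subgroup P G by fact
  have finP: "finite P" using P.subset finite_carrier finite_subset by blast
  have eP: "?e P = f" by (rule brauer_block_eq[OF brauer_le_refl[OF P]])
  have Q: "subgroup Q G" "Q \<subseteq> P" using Q0 sP incl_subgroup subgroup.subset[OF Q0] by auto
  have QG: "Q \<subseteq> carrier G" using Q(1) by (rule subgroup.subset)
  obtain x where x: "x \<in> carrier G" "\<And>u. u \<in> Q \<Longrightarrow> \<phi> u = conj_by G x u"
    and lex: "brauer_le p G (conj_by G x ` Q, ga_conj G x (?e Q)) (P, f)"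
    using \<phi> by (auto simp: block_fusion_system_iff eP)
  have xQ: "\<forall>u \<in> Q. \<phi> u = conj_by G x u" using x(2) by blast
  define R where "R = conj_by G x ` Q"
  have \<phi>Q: "\<phi> ` Q = R" using x(2) by (auto simp: R_def)
  have R: "subgroup R G" "R \<subseteq> P" "p_subgroup p G R"
    using brauer_leD[OF lex] by (auto simp: R_def p_subgroup_imp_subgroup)
  have RG: "R \<subseteq> carrier G" using R(1) by (rule subgroup.subset)
  have eR: "?e R = ga_conj G x (?e Q)" using brauer_block_eq[OF lex] by (simp add: R_def)
  define S where "S = normalizer_in P R"
  have S: "subgroup S G" "S \<subseteq> P" "R \<subseteq> S"
    using subgroup_normalizer_in[OF sP RG] subset_normalizer_in[OF R(1,2)] by (auto simp: S_def)
  interpret S: subgroup S G by (rule S(1))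
  have normS: "conj_by G s ` R = R" if "s \<in> S" for s using that by (simp add: S_def)
  define H where "H = {h \<in> carrier G. \<exists>z \<in> S. \<forall>u \<in> R. conj_by G h u = conj_by G z u}"
  have sH: "subgroup H G" unfolding H_def by (rule subgroup_induces_conj_by[OF S(1) RG normS])
  interpret H: subgroup H G by (rule sH)
  have SH: "S \<subseteq> H" unfolding H_def using S.subset by blast
  have CH: "cent R \<subseteq> H"
  proof
    fix h assume "h \<in> cent R"
    then have "h \<in> carrier G" "\<forall>u \<in> R. conj_by G h u = conj_by G \<one> u"
      using RG by (auto simp: mem_centralizer_iff' subset_iff)
    then show "h \<in> H" unfolding H_def using S.one_closed by blast
  qed
  have normH: "\<forall>h \<in> H. conj_by G h ` R = R"
  proof
    fix h assume "h \<in> H"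
    then obtain z where z: "z \<in> S" "\<forall>u \<in> R. conj_by G h u = conj_by G z u" unfolding H_def by blast
    then have "conj_by G h ` R = conj_by G z ` R" by (intro image_cong) auto
    then show "conj_by G h ` R = R" using normS z by simp
  qed
  \<comment> \<open>\<open>H\<close> is the product of \<open>S\<close> and the centralizer of \<open>R\<close>\<close>
  have split: "\<exists>z \<in> S. inv z \<otimes> h \<in> cent R" if h: "h \<in> H" for h
  proof -
    obtain z where z: "z \<in> S" "\<forall>u \<in> R. conj_by G h u = conj_by G z u" using h unfolding H_def by blast
    have G: "h \<in> carrier G" "z \<in> carrier G" using h z by auto
    have "conj_by G (inv z \<otimes> h) u = u" if u: "u \<in> R" for u
    proof -
      have "u \<in> carrier G" using u RG by blast
      then have "conj_by G (inv z \<otimes> h) u = conj_by G (inv z) (conj_by G z u)"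
        using G z(2) u by (simp flip: conj_by_conj_by)
      then show ?thesis using G \<open>u \<in> carrier G\<close> by simp
    qed
    then show ?thesis using z G RG by (auto simp: mem_centralizer_iff')
  qed
  have RS: "brauer_le p G (R, ?e R) (S, ?e S)" using brauer_block_mono[OF P R(1) S(3) S(1,2)] .
  have SP: "brauer_le p G (S, ?e S) (P, f)" using brauer_block_le[OF P S(1,2)] .
  have RP: "brauer_le p G (R, ?e R) (P, f)" using brauer_le_trans[OF RS SP] .
  have eRb: "is_block R (?e R)" using brauer_leD[OF RP] by simp
  have eRs: "?e R \<in> supported (carrier G)" using eRb by (rule block_supported_carrier)
  have eRH: "?e R \<in> fixed H"
    unfolding fixed_def
  proof (intro CollectI conjI ballI eRs)
    fix h assume h: "h \<in> H"
    obtain z where z: "z \<in> S" "inv z \<otimes> h \<in> cent R" using split[OF h] by blast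
    have G: "h \<in> carrier G" "z \<in> carrier G" using h z by auto
    have "ga_conj G z (ga_conj G (inv z \<otimes> h) (?e R)) = ga_conj G z (?e R)"
      using fixed_conj[OF block_fixed[OF RG eRb] z(2)] by simp
    also have "\<dots> = ?e R" using fixed_conj[OF brauer_le_normal(1)[OF RS normS] z(1)] .
    finally show "ga_conj G h (?e R) = ?e R" using G by (simp add: ga_conj_ga_conj flip: m_assoc)
  qed
  \<comment> \<open>a pair on a larger subgroup \<open>X\<close> of \<open>H\<close> has a conjugate below \<open>(P, f)\<close>, and then the corresponding
     conjugate of \<open>R\<close> would have a normalizer in \<open>P\<close> at least as large as \<open>X\<close>\<close>
  have Smax: "X = S" if X: "X \<subseteq> H" "brauer_le p G (S, ?e S) (X, d)" for X d
  proof -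
    note lX = brauer_leD[OF X(2)]
    have XG: "X \<subseteq> carrier G" using lX p_subgroup_subset_carrier by blast
    have e1: "?e {\<one>} = c" using brauer_block_eq[OF cP] .
    have "brauer_le p G ({\<one>}, c) (S, ?e S)"
      using brauer_block_mono[OF P triv_subgroup _ S(1,2)] S.one_closed e1 by auto
    then have "block_brauer_pair p G c (X, d)" unfolding bp by (rule brauer_le_trans[OF _ X(2)])
    then obtain g where g: "g \<in> carrier G" "brauer_le p G (conj_by G g ` X, ga_conj G g d) (P, f)"
      using brauer_pair_conj_into_maximal[OF c max] by blast
    have "brauer_le p G (R, ?e R) (X, d)" using brauer_le_trans[OF RS X(2)] .
    from brauer_le_trans[OF brauer_le_conj[OF g(1) this] g(2)]
    have leg: "brauer_le p G (conj_by G g ` R, ga_conj G g (?e R)) (P, f)" .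
    have "fusion_isomorphic ?F R (conj_by G g ` R)" using fusion_isomorphic_conj[OF R(1) RP g(1) leg] .
    moreover have gR: "conj_by G g ` R \<subseteq> P" using brauer_leD[OF leg] by simp
    moreover have "subgroup (conj_by G g ` R) ?P"
      using subgroup_conj_by[OF g(1) R(1)] gR sP by (simp add: subgroup_incl)
    ultimately have "card (normalizer ?P (conj_by G g ` R)) \<le> card (normalizer ?P R)"
      using full unfolding fully_normalized_def \<phi>Q by blast
    then have card: "card (normalizer_in P (conj_by G g ` R)) \<le> card S"
      by (simp add: normalizer_restrict[OF sP gR] normalizer_restrict[OF sP R(2)] S_def)
    have "conj_by G g ` X \<subseteq> normalizer_in P (conj_by G g ` R)"
    proof safe
      fix y assume y: "y \<in> X"
      show "conj_by G g y \<in> P" using brauer_leD(5)[OF g(2)] y by blast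
      have yG: "y \<in> carrier G" using y XG by blast
      have yR: "conj_by G y ` R = R" using normH X(1) y by blast
      have "conj_by G (conj_by G g y) ` conj_by G g ` R = conj_by G g ` conj_by G y ` R"
        using g(1) yG RG by (simp add: conj_by_image_conj_by) (simp add: conj_by_def m_assoc)
      then have *: "conj_by G (conj_by G g y) ` conj_by G g ` R = conj_by G g ` R" using yR by simp
      show "conj_by G (conj_by G g y) (conj_by G g u) \<in> conj_by G g ` R" if "u \<in> R" for u
        using * that by blast
      show "conj_by G g u \<in> conj_by G (conj_by G g y) ` conj_by G g ` R" if "u \<in> R" for u
        using * that by blast
    qed
    then have "card (conj_by G g ` X) \<le> card (normalizer_in P (conj_by G g ` R))"
      using finP by (intro card_mono) auto
    then have "card X \<le> card S" using card card_conj_by[OF g(1) XG] by simp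
    moreover have "finite X" using XG finite_carrier finite_subset by blast
    ultimately show "X = S" using card_seteq[of X S] lX(5) by simp
  qed
  define E where "E = extension_group ?P Q \<phi>"
  have E_eq: "E = {y \<in> P. conj_by G x y \<in> H}"
    unfolding E_def extension_group_eq[OF sP Q x(1) xQ \<phi>Q R(2)] H_def S_def
    using conj_by_closed[OF x(1)] P.subset by blast
  have sE: "subgroup E G"
    unfolding E_eq
  proof
    show "\<one> \<in> {y \<in> P. conj_by G x y \<in> H}" using x(1) by simp
    show "y \<otimes> y' \<in> {y \<in> P. conj_by G x y \<in> H}"
      if "y \<in> {y \<in> P. conj_by G x y \<in> H}" "y' \<in> {y \<in> P. conj_by G x y \<in> H}" for y y'
      using that x(1) by (auto simp: conj_by_mult)
    show "inv y \<in> {y \<in> P. conj_by G x y \<in> H}" if "y \<in> {y \<in> P. conj_by G x y \<in> H}" for y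
      using that x(1) by (auto simp: conj_by_inv_right)
  qed auto
  have EP: "E \<subseteq> P" by (auto simp: E_eq)
  have EG: "E \<subseteq> carrier G" using EP P.subset by blast
  have QE: "Q \<subseteq> E"
  proof
    fix u assume u: "u \<in> Q"
    then have "conj_by G x u \<in> H" using S(3) SH by (auto simp: R_def)
    then show "u \<in> E" using u Q(2) by (auto simp: E_eq)
  qed
  define T where "T = conj_by G x ` E"
  have TH: "T \<subseteq> H" by (auto simp: T_def E_eq)
  have RT: "brauer_le p G (R, ?e R) (T, ga_conj G x (?e E))"
    using brauer_le_conj[OF x(1) brauer_block_mono[OF P Q(1) QE sE EP]]
    unfolding eR unfolding R_def T_def .
  have Smax': "\<forall>X d. X \<subseteq> H \<longrightarrow> brauer_le p G (S, ?e S) (X, d) \<longrightarrow> X = S" using Smax by blast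
  obtain h where h: "h \<in> H" "brauer_le p G (conj_by G h ` T, ga_conj G h (ga_conj G x (?e E))) (S, ?e S)"
    using maximal_pair_contains_conjugate[OF sH normH CH eRH SH RS Smax' TH RT] by blast
  obtain z where z: "z \<in> S" "inv z \<otimes> h \<in> cent R" using split[OF h(1)] by blast
  have G: "h \<in> carrier G" "z \<in> carrier G" "inv z \<in> S" "inv z \<in> carrier G" using h z by auto
  \<comment> \<open>dividing \<open>h\<close> by \<open>z\<close> makes it centralize \<open>R\<close>, so that \<open>w\<close> still induces \<open>\<phi>\<close> on \<open>Q\<close>; nothing is
     lost because \<open>z \<in> S\<close> fixes the pair on \<open>S\<close>\<close>
  define w where "w = inv z \<otimes> h \<otimes> x"
  have wG: "w \<in> carrier G" using G x(1) by (simp add: w_def)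
  have "brauer_le p G (conj_by G w ` E, ga_conj G w (?e E)) (S, ?e S)"
  proof -
    have "conj_by G (inv z) ` S = S" using subset_normalizer_in[OF S(1), of S] G(3) by auto
    moreover have "ga_conj G (inv z) (?e S) = ?e S"
      using fixed_conj[OF supported_centralizer_fixed[OF S(1) block_supported[OF brauer_leD(2)[OF SP]]] G(3)] .
    moreover have "conj_by G (inv z) ` conj_by G h ` T = conj_by G w ` E"
      using G x(1) EG by (simp add: T_def w_def conj_by_image_conj_by conj_by_image_subset m_assoc)
    moreover have "ga_conj G (inv z) (ga_conj G h (ga_conj G x (?e E))) = ga_conj G w (?e E)"
      using G x(1) by (simp add: w_def ga_conj_ga_conj m_assoc)
    ultimately show ?thesis using brauer_le_conj[OF G(4) h(2)] by simp
  qed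
  then have lew: "brauer_le p G (conj_by G w ` E, ga_conj G w (?e E)) (P, ?e P)"
    using brauer_le_trans[OF _ SP] eP by simp
  have "restrict (conj_by G w) E \<in> ?F E (carrier ?P)"
    using restrict_conj_in_block_fusion_system[OF wG sE lew] by simp
  moreover have "restrict (restrict (conj_by G w) E) Q = \<phi>"
  proof
    fix u
    show "restrict (restrict (conj_by G w) E) Q u = \<phi> u"
    proof (cases "u \<in> Q")
      case True
      have uG: "u \<in> carrier G" using True QG by blast
      have "conj_by G x u \<in> R" using True by (simp add: R_def)
      then have "conj_by G (inv z \<otimes> h) (conj_by G x u) = conj_by G x u"
        using z(2) RG by (simp add: mem_centralizer_iff')
      then show ?thesis using True QE x uG G by (auto simp: w_def conj_by_conj_by)
    next
      case False
      then show ?thesis using \<phi> by (auto simp: block_fusion_system_iff extensional_def)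
    qed
  qed
  ultimately show "\<exists>\<psi> \<in> ?F (extension_group ?P Q \<phi>) (carrier ?P). restrict \<psi> Q = \<phi>"
    unfolding E_def by blast
qed

end

theorem theorem6p2:
  fixes G :: "('g, 'm) monoid_scheme"
    and p :: nat
    and c f :: "'g \<Rightarrow> 'k::field"
    and P :: "'g set"
  assumes "group G" and "finite (carrier G)"
    and "CHAR('k) = p" and "p > 0"
    and "block_idempotent G c"
    and "maximal_brauer_pair p G c (P, f)"
  shows "extension_axiom (G\<lparr>carrier := P\<rparr>) (block_fusion_system p G (P, f))"
proof -
  interpret modular_group_algebra G "TYPE('k)" p
    using assms by (simp add: modular_group_algebra_def modular_group_algebra_axioms_def)
  show ?thesis using assms(5,6) by (rule block_fusion_system_extension_axiom)
qed

end
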